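(* Let $f:M\to\mathbb{S}^3\times\mathbb{S}^3$, $x\mapsto f(x)=(p(x),q(x))$, be a Lagrangian immersion into the nearly Kähler $\mathbb{S}^3\times\mathbb{S}^3$. If the angle functions $\theta_1,\theta_2,\theta_3$ of $f$ are constant, then either $M$ is totally geodesic or $M$ (with the metric induced by $f$) has constant sectional curvature.
   Context: Identify $\mathbb{S}^3$ with the unit quaternions in $\mathbb{H}\cong\mathbb{R}^4$, with Euclidean metric $\langle\cdot,\cdot\rangle$; tangent vectors at $p$ are $p\alpha$ with $\alpha$ an imaginary quaternion. For $(U,V)\in T_{(p,q)}(\mathbb{S}^3\times\mathbb{S}^3)\cong T_p\mathbb{S}^3\oplus T_q\mathbb{S}^3$ define the almost complex structure $$J(U,V)_{(p,q)}=\tfrac{1}{\sqrt3}\left(2pq^{-1}V-U,\,-2qp^{-1}U+V\right),$$ and the metric $g(Z,Z')=\frac12(\langle Z,Z'\rangle+\langle JZ,JZ'\rangle)$, where $\langle\cdot,\cdot\rangle$ is the usual Euclidean product metric on $\mathbb{S}^3\times\mathbb{S}^3$. With $(g,J)$, $\mathbb{S}^3\times\mathbb{S}^3$ is a nearly Kähler manifold. Define also the almost product structure $P(U,V)_{(p,q)}=(pq^{-1}V,\,qp^{-1}U)$. An immersion $f:M\to\mathbb{S}^3\times\mathbb{S}^3$ is Lagrangian if $\dim M=3$ and $J$ maps $df(T_xM)$ into the $g$-normal space for every $x\in M$. $M$ carries the induced metric $f^*g$. For a Lagrangian immersion there are symmetric endomorphisms $A,B$ of $TM$ with $P\,df(X)=df(AX)+J\,df(BX)$;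 they commute and satisfy $A^2+B^2=\mathrm{Id}$. Hence around each point of an open dense subset of $M$ there is a local orthonormal frame $E_1,E_2,E_3$ and functions $\theta_1,\theta_2,\theta_3$ (the angle functions, each determined modulo $\pi$) such that $AE_i=\cos(2\theta_i)E_i$ and $BE_i=\sin(2\theta_i)E_i$, i.e. $P\,df(E_i)=\cos(2\theta_i)\,df(E_i)+\sin(2\theta_i)\,J\,df(E_i)$, for $i=1,2,3$. "$M$ is totally geodesic" means that the second fundamental form of $f$ vanishes identically.
   Formalization: M is assumed connected; otherwise the disjoint union of the flat Lagrangian torus and the round sphere of curvature 3/16 (both with angles 0, π/3, 2π/3) is neither totally geodesic nor of constant sectional curvature. *)

theory Defs
  imports "HOL-Analysis.Analysis"
begin

section \<open>Smooth maps and smooth manifolds\<close>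

text \<open>Used for open \<open>S\<close> only.\<close>

primrec Ck_on :: "nat \<Rightarrow> 'a::euclidean_space set \<Rightarrow> ('a \<Rightarrow> 'b::euclidean_space) \<Rightarrow> bool" where
  "Ck_on 0 S f \<longleftrightarrow> continuous_on S f"
| "Ck_on (Suc k) S f \<longleftrightarrow>
     (\<forall>x\<in>S. f differentiable (at x)) \<and> (\<forall>v. Ck_on k S (\<lambda>x. frechet_derivative f (at x) v))"

definition smooth_on :: "'a::euclidean_space set \<Rightarrow> ('a \<Rightarrow> 'b::euclidean_space) \<Rightarrow> bool" where
  "smooth_on S f \<longleftrightarrow> (\<forall>k. Ck_on k S f)"

text \<open>A manifold structure is given by local parametrisations \<open>\<psi> : D \<rightarrow> M\<close>
  (inverses of charts), with \<open>D\<close> open in the model space.\<close>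

type_synonym ('a, 'm) atlas = "('a set \<times> ('a \<Rightarrow> 'm)) set"

definition smooth_atlas :: "('a::euclidean_space, 'm::topological_space) atlas \<Rightarrow> bool" where
  "smooth_atlas \<A> \<longleftrightarrow>
     (\<forall>(D, \<psi>)\<in>\<A>. open D \<and> open (\<psi> ` D) \<and> (\<exists>\<phi>. homeomorphism D (\<psi> ` D) \<psi> \<phi>)) \<and>
     (\<Union>(D, \<psi>)\<in>\<A>. \<psi> ` D) = UNIV \<and>
     (\<forall>(D, \<psi>)\<in>\<A>. \<forall>(D', \<psi>')\<in>\<A>.
        smooth_on (D \<inter> \<psi> -` (\<psi>' ` D')) (inv_into D' \<psi>' \<circ> \<psi>))"

section \<open>Levi-Civita connection and curvature\<close>

text \<open>A Riemannian manifold is described here by a subset \<open>N\<close> of a Euclidean space, its tangent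
  spaces \<open>T y\<close> (\<open>y \<in> N\<close>), and a metric tensor \<open>g y\<close>.
  Open subsets of the Euclidean space are covered by \<open>T = (\<lambda>_. UNIV)\<close>. The tensor \<open>g\<close> is given by an
  expression that is smooth on a neighbourhood of \<open>N\<close>; derivatives are only taken
  in directions tangent to \<open>N\<close>, so they do not depend on the values off \<open>N\<close>.\<close>

type_synonym 'a metric = "'a \<Rightarrow> 'a \<Rightarrow> 'a \<Rightarrow> real"

definition vector_field_near ::
  "'a::euclidean_space set \<Rightarrow> ('a \<Rightarrow> 'a set) \<Rightarrow> 'a \<Rightarrow> ('a \<Rightarrow> 'a) \<Rightarrow> bool" where
  "vector_field_near N T z X \<longleftrightarrow>
     (\<exists>U. open U \<and> z \<in> U \<and> smooth_on U X \<and> (\<forall>y\<in>U \<inter> N. X y \<in> T y))"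

definition deriv_along :: "('a::euclidean_space \<Rightarrow> 'a) \<Rightarrow> ('a \<Rightarrow> 'b::euclidean_space) \<Rightarrow> 'a \<Rightarrow> 'b" where
  "deriv_along X h z = frechet_derivative h (at z) (X z)"

definition lie_bracket :: "('a::euclidean_space \<Rightarrow> 'a) \<Rightarrow> ('a \<Rightarrow> 'a) \<Rightarrow> 'a \<Rightarrow> 'a" where
  "lie_bracket X Y z = deriv_along X Y z - deriv_along Y X z"

definition koszul :: "'a::euclidean_space metric \<Rightarrow> ('a \<Rightarrow> 'a) \<Rightarrow> ('a \<Rightarrow> 'a) \<Rightarrow> ('a \<Rightarrow> 'a) \<Rightarrow> 'a \<Rightarrow> real" where
  "koszul g X Y Z z =
       deriv_along X (\<lambda>y. g y (Y y) (Z y)) z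
     + deriv_along Y (\<lambda>y. g y (Z y) (X y)) z
     - deriv_along Z (\<lambda>y. g y (X y) (Y y)) z
     + g z (lie_bracket X Y z) (Z z)
     - g z (lie_bracket X Z z) (Y z)
     - g z (lie_bracket Y Z z) (X z)"

definition levi_civita ::
  "'a::euclidean_space set \<Rightarrow> ('a \<Rightarrow> 'a set) \<Rightarrow> 'a metric \<Rightarrow> ('a \<Rightarrow> 'a) \<Rightarrow> ('a \<Rightarrow> 'a) \<Rightarrow> 'a \<Rightarrow> 'a" where
  "levi_civita N T g X Y z =
     (THE w. w \<in> T z \<and> (\<forall>Z. vector_field_near N T z Z \<longrightarrow> 2 * g z w (Z z) = koszul g X Y Z z))"

definition curvature ::
  "'a::euclidean_space set \<Rightarrow> ('a \<Rightarrow> 'a set) \<Rightarrow> 'a metric \<Rightarrow>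
   ('a \<Rightarrow> 'a) \<Rightarrow> ('a \<Rightarrow> 'a) \<Rightarrow> ('a \<Rightarrow> 'a) \<Rightarrow> 'a \<Rightarrow> 'a" where
  "curvature N T g X Y Z z =
       levi_civita N T g X (levi_civita N T g Y Z) z
     - levi_civita N T g Y (levi_civita N T g X Z) z
     - levi_civita N T g (lie_bracket X Y) Z z"

text \<open>On an open set \<open>D\<close>, tangent vectors are extended to constant vector fields.\<close>

definition sectional_curvature ::
  "'a::euclidean_space set \<Rightarrow> 'a metric \<Rightarrow> 'a \<Rightarrow> 'a \<Rightarrow> 'a \<Rightarrow> real" where
  "sectional_curvature D g z u v =
     g z (curvature D (\<lambda>_. UNIV) g (\<lambda>_. u) (\<lambda>_. v) (\<lambda>_. v) z) u /
     (g z u u * g z v v - (g z u v)\<^sup>2)"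

section \<open>The nearly Kaehler structure on the product of two 3-spheres\<close>

type_synonym quat = "real ^ 4"

text \<open>The coordinates 1, 2, 3, 4 belong to the basis \<open>1, i, j, k\<close> of the quaternions.\<close>

definition qmul :: "quat \<Rightarrow> quat \<Rightarrow> quat" (infixl \<open>\<odot>\<close> 70) where
  "a \<odot> b = vector
     [a$1 * b$1 - a$2 * b$2 - a$3 * b$3 - a$4 * b$4,
      a$1 * b$2 + a$2 * b$1 + a$3 * b$4 - a$4 * b$3,
      a$1 * b$3 - a$2 * b$4 + a$3 * b$1 + a$4 * b$2,
      a$1 * b$4 + a$2 * b$3 - a$3 * b$2 + a$4 * b$1]"

definition qinv :: "quat \<Rightarrow> quat" where
  "qinv a = (1 / (norm a)\<^sup>2) *\<^sub>R vector [a$1, - a$2, - a$3, - a$4]"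

definition S3S3 :: "(quat \<times> quat) set" where
  "S3S3 = {(p, q). norm p = 1 \<and> norm q = 1}"

definition tangent_S3S3 :: "quat \<times> quat \<Rightarrow> (quat \<times> quat) set" where
  "tangent_S3S3 = (\<lambda>(p, q). {(p \<odot> \<alpha>, q \<odot> \<beta>) | \<alpha> \<beta>. \<alpha>$1 = 0 \<and> \<beta>$1 = 0})"

definition nk_J :: "quat \<times> quat \<Rightarrow> quat \<times> quat \<Rightarrow> quat \<times> quat" where
  "nk_J = (\<lambda>(p, q) (U, V). (1 / sqrt 3) *\<^sub>R
     (2 *\<^sub>R (p \<odot> qinv q \<odot> V) - U, - (2 *\<^sub>R (q \<odot> qinv p \<odot> U)) + V))"

definition nk_P :: "quat \<times> quat \<Rightarrow> quat \<times> quat \<Rightarrow> quat \<times> quat" where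
  "nk_P = (\<lambda>(p, q) (U, V). (p \<odot> qinv q \<odot> V, q \<odot> qinv p \<odot> U))"

definition nk_metric :: "(quat \<times> quat) metric" where
  "nk_metric z Z Z' = 1/2 * (Z \<bullet> Z' + nk_J z Z \<bullet> nk_J z Z')"

section \<open>Lagrangian immersions\<close>

text \<open>For \<open>f : M \<rightarrow> S3S3\<close> and a parametrisation \<open>(D, \<psi>)\<close> of \<open>M\<close>, the local representative of \<open>f\<close> is
  \<open>F = f \<circ> \<psi>\<close>, and \<open>differential F u\<close> represents the differential of \<open>f\<close> at \<open>\<psi> u\<close>.\<close>

definition differential :: "(real^3 \<Rightarrow> quat \<times> quat) \<Rightarrow> real^3 \<Rightarrow> real^3 \<Rightarrow> quat \<times> quat" where
  "differential F u = frechet_derivative F (at u)"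

definition induced_metric :: "(real^3 \<Rightarrow> quat \<times> quat) \<Rightarrow> (real^3) metric" where
  "induced_metric F u v w = nk_metric (F u) (differential F u v) (differential F u w)"

definition immersion :: "(real^3, 'm::topological_space) atlas \<Rightarrow> ('m \<Rightarrow> quat \<times> quat) \<Rightarrow> bool" where
  "immersion \<A> f \<longleftrightarrow>
     range f \<subseteq> S3S3 \<and>
     (\<forall>(D, \<psi>)\<in>\<A>. smooth_on D (f \<circ> \<psi>) \<and> (\<forall>u\<in>D. inj (differential (f \<circ> \<psi>) u)))"

text \<open>The subspace \<open>df(T\<^sub>xM)\<close>.\<close>

definition tangent_image ::
  "(real^3, 'm::topological_space) atlas \<Rightarrow> ('m \<Rightarrow> quat \<times> quat) \<Rightarrow> 'm \<Rightarrow> (quat \<times> quat) set" where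
  "tangent_image \<A> f x =
     {differential (f \<circ> \<psi>) u v | D \<psi> u v. (D, \<psi>) \<in> \<A> \<and> u \<in> D \<and> \<psi> u = x}"

definition normal_space ::
  "(real^3, 'm::topological_space) atlas \<Rightarrow> ('m \<Rightarrow> quat \<times> quat) \<Rightarrow> 'm \<Rightarrow> (quat \<times> quat) set" where
  "normal_space \<A> f x =
     {n \<in> tangent_S3S3 (f x). \<forall>t\<in>tangent_image \<A> f x. nk_metric (f x) n t = 0}"

definition lagrangian :: "(real^3, 'm::topological_space) atlas \<Rightarrow> ('m \<Rightarrow> quat \<times> quat) \<Rightarrow> bool" where
  "lagrangian \<A> f \<longleftrightarrow> (\<forall>x. nk_J (f x) ` tangent_image \<A> f x \<subseteq> normal_space \<A> f x)"

section \<open>Second fundamental form\<close>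

definition normal_part ::
  "(real^3, 'm::topological_space) atlas \<Rightarrow> ('m \<Rightarrow> quat \<times> quat) \<Rightarrow> 'm \<Rightarrow> quat \<times> quat \<Rightarrow> quat \<times> quat" where
  "normal_part \<A> f x w = (THE n. n \<in> normal_space \<A> f x \<and> w - n \<in> tangent_image \<A> f x)"

text \<open>Vector fields on \<open>S3S3\<close> near \<open>f x\<close> that extend a vector field of \<open>M\<close> near \<open>x\<close>. As an immersion is
  locally an embedding, every smooth vector field of \<open>M\<close> has such extensions. The value
  \<open>second_fundamental_form \<A> f x X Y\<close> for such \<open>X, Y\<close> depends only on \<open>X (f x)\<close> and \<open>Y (f x)\<close>.\<close>

definition extends_tangent_field ::
  "(real^3, 'm::topological_space) atlas \<Rightarrow> ('m \<Rightarrow> quat \<times> quat) \<Rightarrow> 'm \<Rightarrow>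
   (quat \<times> quat \<Rightarrow> quat \<times> quat) \<Rightarrow> bool" where
  "extends_tangent_field \<A> f x X \<longleftrightarrow>
     vector_field_near S3S3 tangent_S3S3 (f x) X \<and>
     (\<exists>V. open V \<and> x \<in> V \<and> (\<forall>y\<in>V. X (f y) \<in> tangent_image \<A> f y))"

definition second_fundamental_form ::
  "(real^3, 'm::topological_space) atlas \<Rightarrow> ('m \<Rightarrow> quat \<times> quat) \<Rightarrow> 'm \<Rightarrow>
   (quat \<times> quat \<Rightarrow> quat \<times> quat) \<Rightarrow> (quat \<times> quat \<Rightarrow> quat \<times> quat) \<Rightarrow> quat \<times> quat" where
  "second_fundamental_form \<A> f x X Y =
     normal_part \<A> f x (levi_civita S3S3 tangent_S3S3 nk_metric X Y (f x))"

definition totally_geodesic :: "(real^3, 'm::topological_space) atlas \<Rightarrow> ('m \<Rightarrow> quat \<times> quat) \<Rightarrow> bool" where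
  "totally_geodesic \<A> f \<longleftrightarrow>
     (\<forall>x X Y. extends_tangent_field \<A> f x X \<and> extends_tangent_field \<A> f x Y \<longrightarrow>
        second_fundamental_form \<A> f x X Y = 0)"

definition constant_sectional_curvature ::
  "(real^3, 'm::topological_space) atlas \<Rightarrow> ('m \<Rightarrow> quat \<times> quat) \<Rightarrow> bool" where
  "constant_sectional_curvature \<A> f \<longleftrightarrow>
     (\<exists>c. \<forall>(D, \<psi>)\<in>\<A>. \<forall>z\<in>D. \<forall>u v. u \<noteq> v \<and> independent {u, v} \<longrightarrow>
        sectional_curvature D (induced_metric (f \<circ> \<psi>)) z u v = c)"

section \<open>Angle functions\<close>

definition orthonormal_frame ::
  "(real^3 \<Rightarrow> quat \<times> quat) \<Rightarrow> (real^3) set \<Rightarrow> (3 \<Rightarrow> real^3 \<Rightarrow> real^3) \<Rightarrow> bool" where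
  "orthonormal_frame F U E \<longleftrightarrow>
     (\<forall>i. smooth_on U (E i)) \<and>
     (\<forall>u\<in>U. \<forall>i j. induced_metric F u (E i u) (E j u) = (if i = j then 1 else 0))"

definition angle_functions ::
  "(real^3 \<Rightarrow> quat \<times> quat) \<Rightarrow> (real^3) set \<Rightarrow> (3 \<Rightarrow> real^3 \<Rightarrow> real^3) \<Rightarrow> (3 \<Rightarrow> real^3 \<Rightarrow> real) \<Rightarrow> bool" where
  "angle_functions F U E \<theta> \<longleftrightarrow>
     orthonormal_frame F U E \<and>
     (\<forall>u\<in>U. \<forall>i.
        nk_P (F u) (differential F u (E i u)) =
          cos (2 * \<theta> i u) *\<^sub>R differential F u (E i u)
          + sin (2 * \<theta> i u) *\<^sub>R nk_J (F u) (differential F u (E i u)))"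

text \<open>Angle functions are only determined modulo \<open>\<pi>\<close> and up to the numbering of the frame; they are
  constant if around each point of an open dense set the same three constants are a choice of them.\<close>

definition constant_angle_functions ::
  "(real^3, 'm::topological_space) atlas \<Rightarrow> ('m \<Rightarrow> quat \<times> quat) \<Rightarrow> bool" where
  "constant_angle_functions \<A> f \<longleftrightarrow>
     (\<exists>(c :: 3 \<Rightarrow> real) W. open W \<and> closure W = UNIV \<and>
        (\<forall>x\<in>W. \<exists>(D, \<psi>)\<in>\<A>. \<exists>U E. open U \<and> U \<subseteq> D \<and> x \<in> \<psi> ` U \<and>
           angle_functions (f \<circ> \<psi>) U E (\<lambda>i u. c i)))"

end

theory Submission
  imports Defs
begin

text \<open>Left translation by the unit quaternions \<open>p\<close> and \<open>q\<close> turns a tangent vector \<open>(p \<alpha>, q \<beta>)\<close> into the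
pair \<open>(\<alpha>, \<beta>)\<close> of vectors of \<open>\<real>\<^sup>3\<close>. In this trivialisation the metric, \<open>J\<close> and \<open>P\<close> have constant
coefficients, and the differential of the immersion becomes a one-form \<open>\<omega>\<close> with values in
\<open>\<real>\<^sup>3 \<times> \<real>\<^sup>3\<close> that satisfies the Maurer-Cartan equation (\<open>maurer_cartan\<close>).

Let \<open>E\<close> be an orthonormal frame with constant angles. The equation for \<open>P\<close> says that the two halves
of \<open>\<omega>(E\<^sub>i)\<close> are \<open>a\<^sub>i v\<^sub>i\<close> and \<open>b\<^sub>i v\<^sub>i\<close> with the constant weights \<open>a\<^sub>i = cos (\<theta>\<^sub>i + \<pi>/6)\<close> and
\<open>b\<^sub>i = cos (\<theta>\<^sub>i - \<pi>/6)\<close>; that \<open>E\<close> is orthonormal and the immersion Lagrangian makes \<open>v\<close> orthonormal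
in \<open>\<real>\<^sup>3\<close> (\<open>v_orthonormal\<close>). The immersion is thus encoded in the coframe \<open>e\<close> dual to \<open>E\<close> and in \<open>v\<close>.
The Maurer-Cartan equation holds once with the weights \<open>a\<close> and once with the weights \<open>b\<close>, and so
gives two linear equations for each structure number of \<open>e\<close> in terms of the connection numbers of
\<open>v\<close> (\<open>structure_numbers_at\<close>). Eliminating the former yields a relation between the weights
(\<open>defect_zero\<close>; classically: the sum of the angles is a multiple of \<open>\<pi>\<close>), which makes the second
fundamental form totally symmetric.

If two of the points \<open>(a\<^sub>i, b\<^sub>i)\<close> are proportional, that is, if two angles agree modulo \<open>\<pi>\<close>, then
every component of the second fundamental form vanishes (\<open>sff_zero\<close>), on a dense set and hence, by
continuity, everywhere. Otherwise the linear equations kill the connection numbers with a repeated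
index, and the fact that \<open>v\<close> is a frame of the flat space \<open>\<real>\<^sup>3\<close> adds three quadratic equations
(\<open>flatness\<close>). The resulting algebraic system forces \<open>de = - c e \<times> e\<close> with \<open>c\<^sup>2 = 0\<close> or \<open>c\<^sup>2 = 3/4\<close>
(\<open>structure_constant\<close>, \<open>coframe_constant\<close>). This is the structure equation of an invariant coframe
of flat space or of a round sphere, so all sectional curvatures are \<open>c\<^sup>2/4\<close>, which is \<open>0\<close> or \<open>3/16\<close>
(\<open>sectional_curvature_coframe\<close>). The sectional curvature is continuous in every chart, hence takes
only these two values on all of \<open>M\<close>, and it is constant because \<open>M\<close> is connected.\<close>

section \<open>Smooth maps\<close>

text \<open>The directional derivative, with the point as last argument: \<open>dd f v\<close> is again a map that
can be differentiated.\<close>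

abbreviation dd :: "('a::euclidean_space \<Rightarrow> 'b::euclidean_space) \<Rightarrow> 'a \<Rightarrow> 'a \<Rightarrow> 'b" where
  "dd f v x \<equiv> frechet_derivative f (at x) v"

lemma dd_eqI: "(f has_derivative f') (at x) \<Longrightarrow> dd f v x = f' v"
  by (drule frechet_derivative_at) simp

lemma has_derivative_dd: "f differentiable (at x) \<Longrightarrow> (f has_derivative (\<lambda>v. dd f v x)) (at x)"
  by (simp only: frechet_derivative_works)

lemma dd_cong:
  assumes "open S" "x \<in> S" "\<And>y. y \<in> S \<Longrightarrow> f y = g y"
  shows "dd f v x = dd g v x"
proof -
  have "(f has_derivative f') (at x) \<longleftrightarrow> (g has_derivative f') (at x)" for f'
  proof
    show "(g has_derivative f') (at x)" if "(f has_derivative f') (at x)"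
      by (rule has_derivative_transform_within_open[OF that assms])
    show "(f has_derivative f') (at x)" if "(g has_derivative f') (at x)"
      by (rule has_derivative_transform_within_open[OF that assms(1,2) assms(3)[symmetric]])
  qed
  then show ?thesis by (simp add: frechet_derivative_def)
qed

lemma differentiable_cong:
  assumes "open S" "x \<in> S" "\<And>y. y \<in> S \<Longrightarrow> f y = g y" "f differentiable (at x)"
  shows "g differentiable (at x)"
proof -
  obtain f' where "(f has_derivative f') (at x)" using assms(4) unfolding differentiable_def by blast
  then have "(g has_derivative f') (at x)"
    by (rule has_derivative_transform_within_open[OF _ assms(1-3)])
  then show ?thesis unfolding differentiable_def by (intro exI)
qed

lemma Ck_on_mono_set: "Ck_on k S f \<Longrightarrow> T \<subseteq> S \<Longrightarrow> Ck_on k T f"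
  by (induction k arbitrary: f) (auto intro: continuous_on_subset)

lemma Ck_on_Suc_imp: "Ck_on (Suc k) S f \<Longrightarrow> Ck_on k S f"
proof (induction k arbitrary: f)
  case 0
  then show ?case
    by (simp add: continuous_at_imp_continuous_on differentiable_imp_continuous_within)
qed auto

lemma Ck_on_cong:
  assumes "open S" "\<And>y. y \<in> S \<Longrightarrow> f y = g y" "Ck_on k S f"
  shows "Ck_on k S g"
  using assms(2,3)
proof (induction k arbitrary: f g)
  case 0 then show ?case using continuous_on_cong by fastforce
next
  case (Suc k)
  have "g differentiable (at x)" if "x \<in> S" for x
    using Suc.prems by (intro differentiable_cong[OF assms(1) that, of f g]) (auto simp: that)
  moreover have "Ck_on k S (dd g v)" for v
  proof (rule Suc.IH)
    show "dd f v y = dd g v y" if "y \<in> S" for y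
      using dd_cong[OF assms(1) that] Suc.prems(1) by blast
    show "Ck_on k S (dd f v)" using Suc.prems(2) by simp
  qed
  ultimately show ?case by simp
qed

lemma Ck_on_SucI:
  assumes "\<And>x. x \<in> S \<Longrightarrow> (f has_derivative f' x) (at x)" "\<And>v. Ck_on k S (\<lambda>x. f' x v)" "open S"
  shows "Ck_on (Suc k) S f"
proof -
  have "f differentiable (at x)" if "x \<in> S" for x
    unfolding differentiable_def by (rule exI[of _ "f' x"]) (rule assms(1)[OF that])
  moreover have "Ck_on k S (dd f v)" for v
    by (rule Ck_on_cong[OF assms(3) _ assms(2)[of v]]) (simp only: dd_eqI[OF assms(1)])
  ultimately show ?thesis unfolding Ck_on.simps(2) by (intro conjI ballI allI)
qed

lemma Ck_on_const [simp]: "Ck_on k S (\<lambda>x. c)"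
  by (induction k arbitrary: c) (auto simp: frechet_derivative_const)

lemma Ck_on_linear:
  assumes "linear f" shows "Ck_on k S f"
proof (cases k)
  case 0 then show ?thesis using assms by (simp add: linear_continuous_on linear_conv_bounded_linear)
next
  case (Suc n)
  have "(f has_derivative f) (at x)" for x
    using assms by (simp add: bounded_linear_imp_has_derivative linear_conv_bounded_linear)
  then have "f differentiable (at x)" "dd f v = (\<lambda>x. f v)" for x v
    by (auto simp: differentiable_def dd_eqI)
  then show ?thesis using Suc by simp
qed

lemma Ck_on_add:
  assumes "Ck_on k S f" "Ck_on k S g" "open S"
  shows "Ck_on k S (\<lambda>x. f x + g x)"
  using assms(1,2)
proof (induction k arbitrary: f g)
  case 0 then show ?case by (auto intro: continuous_on_add)
next
  case (Suc k)
  have *: "((\<lambda>x. f x + g x) has_derivative (\<lambda>v. dd f v x + dd g v x)) (at x)" if "x \<in> S" for x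
    using Suc.prems that by (auto intro!: has_derivative_add has_derivative_dd)
  have **: "Ck_on k S (\<lambda>x. dd f v x + dd g v x)" for v
    using Suc.prems by (intro Suc.IH) auto
  show ?case by (rule Ck_on_SucI[OF * ** assms(3)])
qed

lemma Ck_on_bilinear:
  assumes "bounded_bilinear h" "Ck_on k S f" "Ck_on k S g" "open S"
  shows "Ck_on k S (\<lambda>x. h (f x) (g x))"
  using assms(2,3)
proof (induction k arbitrary: f g)
  case 0 then show ?case
    by (simp add: bounded_bilinear.continuous_on[OF assms(1)])
next
  case (Suc k)
  have *: "((\<lambda>x. h (f x) (g x)) has_derivative (\<lambda>v. h (f x) (dd g v x) + h (dd f v x) (g x))) (at x)"
    if "x \<in> S" for x
    using Suc.prems that by (intro bounded_bilinear.FDERIV[OF assms(1)] has_derivative_dd) simp_all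
  have **: "Ck_on k S (\<lambda>x. h (f x) (dd g v x) + h (dd f v x) (g x))" for v
  proof (rule Ck_on_add[OF Suc.IH Suc.IH assms(4)])
    show "Ck_on k S f" "Ck_on k S g" using Suc.prems by (blast intro: Ck_on_Suc_imp)+
    show "Ck_on k S (dd f v)" "Ck_on k S (dd g v)" using Suc.prems by simp_all
  qed
  show ?case by (rule Ck_on_SucI[OF * ** assms(4)])
qed

lemma Ck_on_sum:
  assumes "\<And>i. i \<in> I \<Longrightarrow> Ck_on k S (f i)" "open S"
  shows "Ck_on k S (\<lambda>x. \<Sum>i\<in>I. f i x)"
  using assms(1)
  by (induction I rule: infinite_finite_induct) (auto intro!: Ck_on_add assms(2))

lemma Ck_on_linear_comp:
  assumes "bounded_linear h" "Ck_on k S f" "open S"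
  shows "Ck_on k S (\<lambda>x. h (f x))"
proof -
  interpret bounded_linear h by fact
  have "bounded_bilinear (\<lambda>(c::real) x. c *\<^sub>R h x)"
    using bounded_bilinear.comp[OF bounded_bilinear_scaleR bounded_linear_ident assms(1)] .
  from Ck_on_bilinear[OF this _ assms(2,3), of "\<lambda>_. 1"] show ?thesis by simp
qed

text \<open>By induction on the order: the chain rule writes a directional derivative of the composite as
a sum of products of coordinates of derivatives of \<open>f\<close> with \<open>dd g b \<circ> f\<close> for basis vectors \<open>b\<close>.\<close>

lemma Ck_on_compose:
  assumes "Ck_on k T g" "Ck_on k S f" "open S" "open T" "f ` S \<subseteq> T"
  shows "Ck_on k S (\<lambda>x. g (f x))"
  using assms(1,2)
proof (induction k arbitrary: g)
  case 0 then show ?case using assms(5) continuous_on_compose2 by auto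
next
  case (Suc k)
  have *: "((\<lambda>x. g (f x)) has_derivative (\<lambda>v. \<Sum>b\<in>Basis. (dd f v x \<bullet> b) *\<^sub>R dd g b (f x))) (at x)"
    if "x \<in> S" for x
  proof -
    have df: "(f has_derivative (\<lambda>v. dd f v x)) (at x)"
      using Suc.prems that by (auto intro!: has_derivative_dd)
    have dg: "(g has_derivative (\<lambda>v. dd g v (f x))) (at (f x))"
      using Suc.prems that assms(5) by (auto intro!: has_derivative_dd)
    have lin: "linear (\<lambda>v. dd g v (f x))" using dg by (rule has_derivative_linear)
    have rep: "dd g w (f x) = (\<Sum>b\<in>Basis. (w \<bullet> b) *\<^sub>R dd g b (f x))" for w
      using linear_sum[OF lin, of "\<lambda>b. (w \<bullet> b) *\<^sub>R b" Basis]
      by (simp add: euclidean_representation linear_scale[OF lin])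
    have "((\<lambda>x. g (f x)) has_derivative (\<lambda>v. dd g (dd f v x) (f x))) (at x)"
      by (rule has_derivative_compose[OF df dg])
    then show ?thesis unfolding rep[of "dd f _ x"] .
  qed
  have dg: "Ck_on k T (dd g b)" and df: "Ck_on k S (dd f v)" for b v
    using Suc.prems by simp_all
  have dgf: "Ck_on k S (\<lambda>x. dd g b (f x))" for b
    by (rule Suc.IH[OF dg Ck_on_Suc_imp[OF Suc.prems(2)]])
  have **: "Ck_on k S (\<lambda>x. \<Sum>b\<in>Basis. (dd f v x \<bullet> b) *\<^sub>R dd g b (f x))" for v
    by (intro Ck_on_sum[OF _ assms(3)] Ck_on_bilinear[OF bounded_bilinear_scaleR _ dgf assms(3)]
        Ck_on_bilinear[OF bounded_bilinear_inner df Ck_on_const assms(3)])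
  show ?case by (rule Ck_on_SucI[OF * ** assms(3)])
qed

lemma Ck_on_inverse:
  fixes f :: "'a::euclidean_space \<Rightarrow> real"
  assumes "Ck_on k S f" "open S" "\<And>x. x \<in> S \<Longrightarrow> f x \<noteq> 0"
  shows "Ck_on k S (\<lambda>x. inverse (f x))"
  using assms(1)
proof (induction k)
  case 0 then show ?case using assms by (auto intro: continuous_on_inverse)
next
  case (Suc k)
  have *: "((\<lambda>x. inverse (f x)) has_derivative (\<lambda>v. - (inverse (f x) * dd f v x * inverse (f x)))) (at x)"
    if "x \<in> S" for x
    using Suc.prems that assms(3) by (auto intro!: derivative_eq_intros has_derivative_dd simp: algebra_simps)
  have "Ck_on k S (\<lambda>x. inverse (f x))" by (rule Suc.IH[OF Ck_on_Suc_imp[OF Suc.prems]])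
  moreover have "Ck_on k S (dd f v)" for v using Suc.prems by simp
  ultimately have **: "Ck_on k S (\<lambda>x. - (inverse (f x) * dd f v x * inverse (f x)))" for v
    by (intro Ck_on_linear_comp[OF bounded_linear_minus[OF bounded_linear_ident] _ assms(2)]
         Ck_on_bilinear[OF bounded_bilinear_mult _ _ assms(2)])
  show ?case by (rule Ck_on_SucI[OF * ** assms(2)])
qed

lemma smooth_on_subset: "smooth_on S f \<Longrightarrow> T \<subseteq> S \<Longrightarrow> smooth_on T f"
  by (auto simp: smooth_on_def intro: Ck_on_mono_set)

lemma smooth_on_cong: "smooth_on S f \<Longrightarrow> open S \<Longrightarrow> (\<And>y. y \<in> S \<Longrightarrow> f y = g y) \<Longrightarrow> smooth_on S g"
  by (auto simp: smooth_on_def intro: Ck_on_cong)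

lemma smooth_on_differentiable: "smooth_on S f \<Longrightarrow> x \<in> S \<Longrightarrow> f differentiable (at x)"
  unfolding smooth_on_def by (metis Ck_on.simps(2))

lemma smooth_on_dd: "smooth_on S f \<Longrightarrow> smooth_on S (dd f v)"
  unfolding smooth_on_def by (metis Ck_on.simps(2))

lemma smooth_on_continuous: "smooth_on S f \<Longrightarrow> continuous_on S f"
  unfolding smooth_on_def by (metis Ck_on.simps(1))

lemma smooth_on_has_derivative: "smooth_on S f \<Longrightarrow> x \<in> S \<Longrightarrow> (f has_derivative (\<lambda>v. dd f v x)) (at x)"
  by (simp add: has_derivative_dd smooth_on_differentiable)

lemma smooth_on_const: "smooth_on S (\<lambda>x. c)"
  by (simp add: smooth_on_def)

lemma smooth_on_linear: "linear f \<Longrightarrow> smooth_on S f"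
  by (simp add: smooth_on_def Ck_on_linear)

lemma smooth_on_add: "smooth_on S f \<Longrightarrow> smooth_on S g \<Longrightarrow> open S \<Longrightarrow> smooth_on S (\<lambda>x. f x + g x)"
  by (simp add: smooth_on_def Ck_on_add)

lemma smooth_on_bilinear:
  "bounded_bilinear h \<Longrightarrow> smooth_on S f \<Longrightarrow> smooth_on S g \<Longrightarrow> open S \<Longrightarrow> smooth_on S (\<lambda>x. h (f x) (g x))"
  by (simp add: smooth_on_def Ck_on_bilinear)

lemma smooth_on_linear_comp:
  "bounded_linear h \<Longrightarrow> smooth_on S f \<Longrightarrow> open S \<Longrightarrow> smooth_on S (\<lambda>x. h (f x))"
  by (simp add: smooth_on_def Ck_on_linear_comp)

lemma smooth_on_minus: "smooth_on S f \<Longrightarrow> open S \<Longrightarrow> smooth_on S (\<lambda>x. - f x)"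
  by (rule smooth_on_linear_comp[OF bounded_linear_minus[OF bounded_linear_ident]])

lemma smooth_on_diff: "smooth_on S f \<Longrightarrow> smooth_on S g \<Longrightarrow> open S \<Longrightarrow> smooth_on S (\<lambda>x. f x - g x)"
  using smooth_on_add[of S f "\<lambda>x. - g x"] by (simp add: smooth_on_minus)

lemma smooth_on_sum:
  "(\<And>i. i \<in> I \<Longrightarrow> smooth_on S (f i)) \<Longrightarrow> open S \<Longrightarrow> smooth_on S (\<lambda>x. \<Sum>i\<in>I. f i x)"
  by (simp add: smooth_on_def Ck_on_sum)

lemma smooth_on_inverse:
  fixes f :: "'a::euclidean_space \<Rightarrow> real"
  shows "smooth_on S f \<Longrightarrow> open S \<Longrightarrow> (\<And>x. x \<in> S \<Longrightarrow> f x \<noteq> 0) \<Longrightarrow> smooth_on S (\<lambda>x. inverse (f x))"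
  by (simp add: smooth_on_def Ck_on_inverse)

lemma smooth_on_compose:
  "smooth_on T g \<Longrightarrow> smooth_on S f \<Longrightarrow> open S \<Longrightarrow> open T \<Longrightarrow> f ` S \<subseteq> T \<Longrightarrow> smooth_on S (\<lambda>x. g (f x))"
  unfolding smooth_on_def using Ck_on_compose by blast

lemmas smooth_on_scaleR = smooth_on_bilinear[OF bounded_bilinear_scaleR]
  and smooth_on_mult = smooth_on_bilinear[OF bounded_bilinear_mult]
  and smooth_on_inner = smooth_on_bilinear[OF bounded_bilinear_inner]

lemma dd_linear:
  assumes "f differentiable (at x)" shows "linear (\<lambda>v. dd f v x)"
  using has_derivative_dd[OF assms] by (rule has_derivative_linear)

text \<open>The second difference of \<open>f\<close> over a small parallelogram is, by the mean value theorem applied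
twice, a value of either mixed derivative near \<open>x\<close>; the two are continuous.\<close>

lemma symmetric_dd_real:
  fixes f :: "'a::euclidean_space \<Rightarrow> real"
  assumes f: "smooth_on S f" "open S" "x \<in> S"
  shows "dd (dd f u) v x = dd (dd f v) u x"
proof (rule ccontr)
  assume neq: "dd (dd f u) v x \<noteq> dd (dd f v) u x"
  define e where "e = \<bar>dd (dd f u) v x - dd (dd f v) u x\<bar> / 2"
  have "e > 0" using neq by (simp add: e_def)
  obtain r where r: "r > 0" "ball x r \<subseteq> S" using f(2,3) openE by blast
  have "continuous_on S (dd (dd f u) v)" "continuous_on S (dd (dd f v) u)"
    using f by (auto intro!: smooth_on_continuous smooth_on_dd)
  then have "isCont (dd (dd f u) v) x" "isCont (dd (dd f v) u) x"
    using f continuous_on_eq_continuous_at by blast+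
  then have "\<exists>d>0. \<forall>y. dist y x < d \<longrightarrow> dist (dd (dd f u) v y) (dd (dd f u) v x) < e"
    "\<exists>d>0. \<forall>y. dist y x < d \<longrightarrow> dist (dd (dd f v) u y) (dd (dd f v) u x) < e"
    using \<open>e > 0\<close> unfolding continuous_at_eps_delta by blast+
  then obtain d1 d2 where d: "d1 > 0" "\<And>y. dist y x < d1 \<Longrightarrow> dist (dd (dd f u) v y) (dd (dd f u) v x) < e"
     "d2 > 0" "\<And>y. dist y x < d2 \<Longrightarrow> dist (dd (dd f v) u y) (dd (dd f v) u x) < e"
    by blast
  define d where "d = min r (min d1 d2)"
  \<comment> \<open>the parallelogram with sides \<open>h u\<close> and \<open>h v\<close> stays within distance \<open>d\<close> of \<open>x\<close>\<close>
  define h where "h = d / (2 * (norm u + norm v + 1))"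
  have "d > 0" using r d by (simp add: d_def)
  have "norm u + norm v + 1 > 0" by (smt (verit) norm_ge_zero)
  then have h: "h > 0" using \<open>d > 0\<close> by (simp add: h_def)
  have "h * (norm u + norm v + 1) = d / 2"
    using \<open>norm u + norm v + 1 > 0\<close> unfolding h_def by (simp add: divide_simps)
  then have hd: "h * (norm u + norm v) < d" using h \<open>d > 0\<close> by (simp add: algebra_simps)
  have near: "dist (x + s *\<^sub>R u + t *\<^sub>R v) x < d" if "0 \<le> s" "s \<le> h" "0 \<le> t" "t \<le> h" for s t
  proof -
    have "norm (s *\<^sub>R u + t *\<^sub>R v) \<le> s * norm u + t * norm v"
      using that norm_triangle_ineq[of "s *\<^sub>R u" "t *\<^sub>R v"] by simp
    also have "\<dots> \<le> h * norm u + h * norm v"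
      using that by (intro add_mono mult_right_mono) auto
    finally show ?thesis using hd by (simp add: dist_norm algebra_simps)
  qed
  have der: "((\<lambda>s. g (y + s *\<^sub>R w)) has_real_derivative dd g w (y + s *\<^sub>R w)) (at s)"
    if "smooth_on S g" "y + s *\<^sub>R w \<in> S" for g :: "'a \<Rightarrow> real" and y w s
  proof -
    have g: "(g has_derivative (\<lambda>v. dd g v (y + s *\<^sub>R w))) (at (y + s *\<^sub>R w))"
      using that by (rule smooth_on_has_derivative)
    have a: "((\<lambda>s. y + s *\<^sub>R w) has_derivative (\<lambda>t. t *\<^sub>R w)) (at s)"
      by (auto intro!: derivative_eq_intros)
    have "((\<lambda>s. g (y + s *\<^sub>R w)) has_derivative (\<lambda>t. dd g (t *\<^sub>R w) (y + s *\<^sub>R w))) (at s)"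
      by (rule has_derivative_compose[OF a g])
    moreover have "dd g (t *\<^sub>R w) (y + s *\<^sub>R w) = t * dd g w (y + s *\<^sub>R w)" for t
      using linear_scale[OF has_derivative_linear[OF g]] by simp
    ultimately have "((\<lambda>s. g (y + s *\<^sub>R w)) has_derivative (\<lambda>t. t * dd g w (y + s *\<^sub>R w))) (at s)"
      by simp
    then show ?thesis by (rule has_derivative_imp_has_field_derivative) (rule refl)
  qed
  have mvt: "\<exists>s t. 0 \<le> s \<and> s \<le> h \<and> 0 \<le> t \<and> t \<le> h \<and>
      f (x + h *\<^sub>R u + h *\<^sub>R v) - f (x + h *\<^sub>R u) - f (x + h *\<^sub>R v) + f x
        = h * h * dd (dd f u) v (x + s *\<^sub>R u + t *\<^sub>R v)"
    if nr: "\<And>s t. 0 \<le> s \<Longrightarrow> s \<le> h \<Longrightarrow> 0 \<le> t \<Longrightarrow> t \<le> h \<Longrightarrow> x + s *\<^sub>R u + t *\<^sub>R v \<in> S" for u v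
  proof -
    have nr0: "x + s *\<^sub>R u \<in> S" if "0 \<le> s" "s \<le> h" for s
      using nr[of s 0] that h by simp
    have nr1: "x + h *\<^sub>R v + s *\<^sub>R u \<in> S" if "0 \<le> s" "s \<le> h" for s
      using nr[of s h] that h by (simp add: algebra_simps)
    have "\<exists>s. 0 < s \<and> s < h \<and> (f (x + h *\<^sub>R v + h *\<^sub>R u) - f (x + h *\<^sub>R u)) - (f (x + h *\<^sub>R v + 0 *\<^sub>R u) - f (x + 0 *\<^sub>R u)) =
       (h - 0) * (dd f u (x + h *\<^sub>R v + s *\<^sub>R u) - dd f u (x + s *\<^sub>R u))"
      by (rule MVT2[OF h]) (auto intro!: DERIV_diff der f nr0 nr1)
    then obtain s where s: "0 < s" "s < h" and e1: "(f (x + h *\<^sub>R v + h *\<^sub>R u) - f (x + h *\<^sub>R u)) - (f (x + h *\<^sub>R v) - f x) =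
       h * (dd f u (x + h *\<^sub>R v + s *\<^sub>R u) - dd f u (x + s *\<^sub>R u))" by auto
    have "\<exists>t. 0 < t \<and> t < h \<and> dd f u (x + s *\<^sub>R u + h *\<^sub>R v) - dd f u (x + s *\<^sub>R u + 0 *\<^sub>R v) =
       (h - 0) * dd (dd f u) v (x + s *\<^sub>R u + t *\<^sub>R v)"
      by (rule MVT2[OF h]) (use s in \<open>auto intro!: der smooth_on_dd f nr\<close>)
    then obtain t where t: "0 < t" "t < h" "dd f u (x + s *\<^sub>R u + h *\<^sub>R v) - dd f u (x + s *\<^sub>R u) =
       h * dd (dd f u) v (x + s *\<^sub>R u + t *\<^sub>R v)" by auto
    have "f (x + h *\<^sub>R u + h *\<^sub>R v) - f (x + h *\<^sub>R u) - f (x + h *\<^sub>R v) + f x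
        = h * (dd f u (x + s *\<^sub>R u + h *\<^sub>R v) - dd f u (x + s *\<^sub>R u))"
      using e1 by (simp add: algebra_simps)
    then show ?thesis using s t by (intro exI[of _ s] exI[of _ t]) simp
  qed
  have inS: "x + s *\<^sub>R u + t *\<^sub>R v \<in> S" if "0 \<le> s" "s \<le> h" "0 \<le> t" "t \<le> h" for s t
    using near[OF that] r by (auto simp: d_def dist_commute subset_iff)
  have inS': "x + s *\<^sub>R v + t *\<^sub>R u \<in> S" if "0 \<le> s" "s \<le> h" "0 \<le> t" "t \<le> h" for s t
    using inS[of t s] that by (simp add: algebra_simps)
  obtain s t where st: "0 \<le> s" "s \<le> h" "0 \<le> t" "t \<le> h"
      "f (x + h *\<^sub>R u + h *\<^sub>R v) - f (x + h *\<^sub>R u) - f (x + h *\<^sub>R v) + f x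
        = h * h * dd (dd f u) v (x + s *\<^sub>R u + t *\<^sub>R v)" using mvt[of u v] inS by blast
  obtain s' t' where st': "0 \<le> s'" "s' \<le> h" "0 \<le> t'" "t' \<le> h"
      "f (x + h *\<^sub>R v + h *\<^sub>R u) - f (x + h *\<^sub>R v) - f (x + h *\<^sub>R u) + f x
        = h * h * dd (dd f v) u (x + s' *\<^sub>R v + t' *\<^sub>R u)" using mvt[of v u] inS' by blast
  have "h * h * dd (dd f u) v (x + s *\<^sub>R u + t *\<^sub>R v) = h * h * dd (dd f v) u (x + t' *\<^sub>R u + s' *\<^sub>R v)"
    using st(5) st'(5) by (simp add: algebra_simps)
  then have eq: "dd (dd f u) v (x + s *\<^sub>R u + t *\<^sub>R v) = dd (dd f v) u (x + t' *\<^sub>R u + s' *\<^sub>R v)"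
    using h by simp
  have c1: "dist (dd (dd f u) v (x + s *\<^sub>R u + t *\<^sub>R v)) (dd (dd f u) v x) < e"
    using near[OF st(1-4)] by (intro d) (simp add: d_def)
  have c2: "dist (dd (dd f v) u (x + t' *\<^sub>R u + s' *\<^sub>R v)) (dd (dd f v) u x) < e"
    using near[OF st'(3,4,1,2)] by (intro d) (simp add: d_def)
  have "dist (dd (dd f u) v x) (dd (dd f v) u x) < e + e"
    by (rule dist_triangle_less_add[OF c1[unfolded eq dist_commute[of _ "dd (dd f u) v x"]] c2[unfolded dist_commute[of _ "dd (dd f v) u x"]]])
  then show False by (simp add: dist_real_def e_def)
qed

lemma symmetric_dd:
  fixes f :: "'a::euclidean_space \<Rightarrow> 'b::euclidean_space"
  assumes f: "smooth_on S f" "open S" "x \<in> S"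
  shows "dd (dd f u) v x = dd (dd f v) u x"
proof (rule euclidean_eqI)
  fix b :: 'b
  have in1: "dd (\<lambda>x. g x \<bullet> b) w y = dd g w y \<bullet> b" if "smooth_on S g" "y \<in> S" for g w y
    by (rule dd_eqI) (use that in \<open>auto intro!: derivative_eq_intros smooth_on_has_derivative\<close>)
  have sm: "smooth_on S (\<lambda>x. f x \<bullet> b)"
    by (intro smooth_on_inner f smooth_on_const)
  have "dd (dd f u) v x \<bullet> b = dd (dd (\<lambda>x. f x \<bullet> b) u) v x" for u v
  proof -
    have "dd (dd (\<lambda>x. f x \<bullet> b) u) v x = dd (\<lambda>y. dd f u y \<bullet> b) v x"
      by (rule dd_cong[OF f(2,3)]) (simp add: in1[OF f(1)])
    then show ?thesis using f by (simp add: in1 smooth_on_dd)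
  qed
  then show "dd (dd f u) v x \<bullet> b = dd (dd f v) u x \<bullet> b"
    using symmetric_dd_real[OF sm f(2,3), of u v] by simp
qed

section \<open>Quaternions and left translation\<close>

unbundle cross3_syntax

lemma vector_4 [simp]:
  "(vector [a,b,c,d] :: 'a::zero^4) $ 1 = a" "(vector [a,b,c,d] :: 'a^4) $ 2 = b"
  "(vector [a,b,c,d] :: 'a^4) $ 3 = c" "(vector [a,b,c,d] :: 'a^4) $ 4 = d"
  unfolding vector_def by simp_all

text \<open>Vectors of \<open>\<real>\<^sup>3\<close> stand for imaginary quaternions; \<open>imv\<close> is the left inverse of \<open>imq\<close> and forgets
the real part.\<close>

definition imq :: "real^3 \<Rightarrow> quat" where "imq a = vector [0, a$1, a$2, a$3]"
definition imv :: "quat \<Rightarrow> real^3" where "imv q = vector [q$2, q$3, q$4]"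
definition qconj :: "quat \<Rightarrow> quat" where "qconj a = vector [a$1, - a$2, - a$3, - a$4]"

lemma qmul_nth [simp]:
  "(a \<odot> b) $ 1 = a$1 * b$1 - a$2 * b$2 - a$3 * b$3 - a$4 * b$4"
  "(a \<odot> b) $ 2 = a$1 * b$2 + a$2 * b$1 + a$3 * b$4 - a$4 * b$3"
  "(a \<odot> b) $ 3 = a$1 * b$3 - a$2 * b$4 + a$3 * b$1 + a$4 * b$2"
  "(a \<odot> b) $ 4 = a$1 * b$4 + a$2 * b$3 - a$3 * b$2 + a$4 * b$1"
  by (simp_all add: qmul_def)

lemma imq_nth [simp]: "imq a $ 1 = 0" "imq a $ 2 = a $ 1" "imq a $ 3 = a $ 2" "imq a $ 4 = a $ 3"
  by (simp_all add: imq_def)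

lemma imv_nth [simp]: "imv a $ 1 = a $ 2" "imv a $ 2 = a $ 3" "imv a $ 3 = a $ 4"
  by (simp_all add: imv_def)

lemma qconj_nth [simp]: "qconj a $ 1 = a $ 1" "qconj a $ 2 = - a $ 2" "qconj a $ 3 = - a $ 3" "qconj a $ 4 = - a $ 4"
  by (simp_all add: qconj_def)

lemma inner_4: "(x::quat) \<bullet> y = x$1 * y$1 + x$2 * y$2 + x$3 * y$3 + x$4 * y$4"
  by (simp add: inner_vec_def sum_4)

lemma inner_3: "(x::real^3) \<bullet> y = x$1 * y$1 + x$2 * y$2 + x$3 * y$3"
  by (simp add: inner_vec_def sum_3)

lemmas quat_simps = vec_eq_iff forall_4 forall_3 algebra_simps

lemma qmul_assoc: "a \<odot> b \<odot> c = a \<odot> (b \<odot> c)"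
  by (simp add: quat_simps)

lemma bounded_bilinear_qmul: "bounded_bilinear (\<odot>)"
  by (rule bilinear_conv_bounded_bilinear[THEN iffD1])
    (auto simp: bilinear_def quat_simps intro!: linearI)

lemma bounded_linear_qconj: "bounded_linear qconj"
  by (rule linear_conv_bounded_linear[THEN iffD1]) (auto simp: quat_simps intro!: linearI)

lemma bounded_bilinear_cross3: "bounded_bilinear cross3"
  using bilinear_cross bilinear_conv_bounded_bilinear by blast

lemma qconj_mul: "qconj a \<odot> a = (norm a)\<^sup>2 *\<^sub>R vector [1, 0, 0, 0]"
  by (simp add: quat_simps inner_4 power2_norm_eq_inner)

lemma qmul_one: "vector [1, 0, 0, 0] \<odot> a = a" "a \<odot> vector [1, 0, 0, 0] = a"
  by (simp_all add: quat_simps)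

lemma mul_qconj: "a \<odot> qconj a = (norm a)\<^sup>2 *\<^sub>R vector [1, 0, 0, 0]"
  by (simp add: quat_simps inner_4 power2_norm_eq_inner)

lemma qmul_cancel: "norm p = 1 \<Longrightarrow> qconj p \<odot> (p \<odot> a) = a" "norm p = 1 \<Longrightarrow> p \<odot> (qconj p \<odot> a) = a"
  by (simp_all add: qmul_assoc[symmetric] qconj_mul mul_qconj qmul_one)

lemma qinv_unit: "norm p = 1 \<Longrightarrow> qinv p = qconj p"
  by (simp add: qinv_def qconj_def)

lemma imq_mul_imq: "imq a \<odot> imq b = imq (a \<times> b) - (a \<bullet> b) *\<^sub>R vector [1, 0, 0, 0]"
  by (simp add: quat_simps inner_3 cross3_def)

lemma imv_imq [simp]: "imv (imq a) = a" by (simp add: quat_simps)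

lemma imq_imv: "q $ 1 = 0 \<Longrightarrow> imq (imv q) = q" by (simp add: quat_simps)

lemma inner_qmul: "(p \<odot> a) \<bullet> (p \<odot> b) = (norm p)\<^sup>2 * (a \<bullet> b)"
  unfolding power2_norm_eq_inner inner_4 qmul_nth by algebra

lemma inner_imq: "imq a \<bullet> imq b = a \<bullet> b"
  by (simp add: inner_4 inner_3)

type_synonym r33 = "(real^3) \<times> (real^3)"

text \<open>Left translation of a tangent vector to the identity, and back. Both maps are bilinear in the
base point and the vector, even off \<open>S3S3\<close>; this is what makes them easy to differentiate.\<close>

definition triv :: "quat \<times> quat \<Rightarrow> quat \<times> quat \<Rightarrow> r33" where
  "triv z w = (imv (qconj (fst z) \<odot> fst w), imv (qconj (snd z) \<odot> snd w))"

definition untriv :: "quat \<times> quat \<Rightarrow> r33 \<Rightarrow> quat \<times> quat" where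
  "untriv z a = (fst z \<odot> imq (fst a), snd z \<odot> imq (snd a))"

text \<open>The metric, the almost complex structure and the Lie bracket of \<open>S3S3\<close> in left
trivialisation.\<close>

definition nkG :: "r33 \<Rightarrow> r33 \<Rightarrow> real" where
  "nkG a b = 4/3 * (fst a \<bullet> fst b + snd a \<bullet> snd b - (fst a \<bullet> snd b + snd a \<bullet> fst b) / 2)"

definition nkj :: "r33 \<Rightarrow> r33" where
  "nkj a = (1 / sqrt 3) *\<^sub>R (2 *\<^sub>R snd a - fst a, snd a - 2 *\<^sub>R fst a)"

definition bracket :: "r33 \<Rightarrow> r33 \<Rightarrow> r33" where
  "bracket a b = (2 *\<^sub>R (fst a \<times> fst b), 2 *\<^sub>R (snd a \<times> snd b))"

lemma bounded_bilinear_triv: "bounded_bilinear triv"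
  unfolding triv_def bilinear_conv_bounded_bilinear[symmetric] bilinear_def
  by (auto simp: quat_simps intro!: linearI)

lemma bounded_bilinear_untriv: "bounded_bilinear untriv"
  unfolding untriv_def bilinear_conv_bounded_bilinear[symmetric] bilinear_def
  by (auto simp: quat_simps intro!: linearI)

lemma bounded_bilinear_nkG: "bounded_bilinear nkG"
  unfolding nkG_def bilinear_conv_bounded_bilinear[symmetric] bilinear_def
  by (auto simp: inner_simps field_simps intro!: linearI)

lemma bounded_linear_nkj: "bounded_linear nkj"
  unfolding nkj_def linear_conv_bounded_linear[symmetric]
  by (auto simp: algebra_simps intro!: linearI)

lemma triv_untriv: "z \<in> S3S3 \<Longrightarrow> triv z (untriv z a) = a"
  by (auto simp: S3S3_def triv_def untriv_def qmul_cancel)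

lemma tangent_iff: "tangent_S3S3 z = range (untriv z)"
proof -
  have "\<exists>a. w = untriv z a" if w: "w \<in> tangent_S3S3 z" for w
  proof -
    obtain \<alpha> \<beta> where "w = (fst z \<odot> \<alpha>, snd z \<odot> \<beta>)" "\<alpha>$1 = 0" "\<beta>$1 = 0"
      using w by (cases z) (auto simp: tangent_S3S3_def)
    then have "w = untriv z (imv \<alpha>, imv \<beta>)" by (simp add: untriv_def imq_imv)
    then show ?thesis by blast
  qed
  moreover have "untriv z a \<in> tangent_S3S3 z" for a
    by (auto simp: tangent_S3S3_def untriv_def split: prod.splits intro!: exI[of _ "imq _"])
  ultimately show ?thesis by blast
qed

lemma untriv_triv: "z \<in> S3S3 \<Longrightarrow> w \<in> tangent_S3S3 z \<Longrightarrow> untriv z (triv z w) = w"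
  by (auto simp: tangent_iff triv_untriv)

lemma nk_J_untriv: "z \<in> S3S3 \<Longrightarrow> nk_J z (untriv z a) = untriv z (nkj a)"
  by (auto simp: S3S3_def nk_J_def untriv_def qinv_unit qmul_assoc qmul_cancel nkj_def quat_simps
      add_divide_distrib diff_divide_distrib)

lemma nk_P_untriv: "z \<in> S3S3 \<Longrightarrow> nk_P z (untriv z a) = untriv z (snd a, fst a)"
  by (auto simp: S3S3_def nk_P_def untriv_def qinv_unit qmul_assoc qmul_cancel)

lemma inner_untriv: "z \<in> S3S3 \<Longrightarrow> untriv z a \<bullet> untriv z b = fst a \<bullet> fst b + snd a \<bullet> snd b"
  by (auto simp: S3S3_def untriv_def inner_qmul inner_imq)

lemma nk_metric_untriv: "z \<in> S3S3 \<Longrightarrow> nk_metric z (untriv z a) (untriv z b) = nkG a b"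
  by (simp add: nk_metric_def nk_J_untriv inner_untriv nkG_def nkj_def inner_simps field_simps inner_commute)

lemma nk_metric_tangent:
  "z \<in> S3S3 \<Longrightarrow> v \<in> tangent_S3S3 z \<Longrightarrow> w \<in> tangent_S3S3 z \<Longrightarrow> nk_metric z v w = nkG (triv z v) (triv z w)"
  by (auto simp: tangent_iff triv_untriv nk_metric_untriv)

lemma nkG_commute: "nkG a b = nkG b a" by (simp add: nkG_def inner_commute)

lemma nkG_self_pos: "a \<noteq> 0 \<Longrightarrow> nkG a a > 0"
proof -
  assume "a \<noteq> 0"
  then have "fst a \<bullet> fst a > 0 \<or> snd a \<bullet> snd a > 0" by (simp add: prod_eq_iff)
  moreover have "nkG a a = 2/3 * (fst a \<bullet> fst a + snd a \<bullet> snd a + (fst a - snd a) \<bullet> (fst a - snd a))"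
    by (simp add: nkG_def inner_simps inner_commute algebra_simps)
  moreover have "(fst a - snd a) \<bullet> (fst a - snd a) \<ge> 0" "fst a \<bullet> fst a \<ge> 0" "snd a \<bullet> snd a \<ge> 0" by simp_all
  moreover have "g > 0" if "x > 0 \<or> y > 0" "g = 2/3 * (x + y + w)" "w \<ge> 0" "x \<ge> 0" "y \<ge> 0" for x y w g :: real
    using that by auto
  ultimately show ?thesis by blast
qed

lemma nkG_nkj: "nkG (nkj a) (nkj b) = nkG a b"
  by (simp add: nkG_def nkj_def inner_simps field_simps inner_commute)

text \<open>The real parts of \<open>\<alpha> \<odot> \<beta>\<close> and \<open>\<beta> \<odot> \<alpha>\<close> agree, so only the commutator survives.\<close>

lemma untriv_untriv_antisym:
  "untriv (untriv z a) b - untriv (untriv z b) a = untriv z (bracket a b)"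
  by (simp add: untriv_def bracket_def qmul_assoc imq_mul_imq prod_eq_iff cross3_def inner_3 quat_simps)

section \<open>The Levi-Civita connection of the nearly Kaehler metric\<close>

lemma differentiable_bilinear:
  assumes "bounded_bilinear h" "f differentiable (at x)" "g differentiable (at x)"
  shows "(\<lambda>x. h (f x) (g x)) differentiable (at x)"
  using bounded_bilinear.FDERIV[OF assms(1)] assms(2,3) unfolding differentiable_def by blast

lemma dd_bilinear:
  assumes "bounded_bilinear h" "f differentiable (at x)" "g differentiable (at x)"
  shows "dd (\<lambda>x. h (f x) (g x)) v x = h (f x) (dd g v x) + h (dd f v x) (g x)"
  by (rule dd_eqI[OF bounded_bilinear.FDERIV[OF assms(1) has_derivative_dd has_derivative_dd]]) (fact assms)+

lemma differentiable_linear_comp: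
  assumes "bounded_linear h" "f differentiable (at x)"
  shows "(\<lambda>x. h (f x)) differentiable (at x)"
  using bounded_linear.has_derivative[OF assms(1)] assms(2) unfolding differentiable_def by blast

text \<open>Suppose that \<open>L\<close> maps the tangent spaces to a fixed Euclidean space such that the metric becomes
a constant form \<open>G\<close> and the bracket of fields becomes \<open>D\<^sub>X Y - D\<^sub>Y X + B X Y\<close>. In the Koszul formula
all derivatives except \<open>D\<^sub>X Y\<close> then cancel, and what remains is the algebraic Koszul formula for
\<open>B\<close>, solved by \<open>Q\<close>. This applies both to the left trivialisation of \<open>S3S3\<close> and to the coframes
on a chart domain below. The predicate \<open>F\<close> collects the fields for which the hypotheses hold; it
may be weaker than smoothness.\<close>

lemma levi_civita_trivialized:
  fixes L :: "'a::euclidean_space \<Rightarrow> 'a \<Rightarrow> 'b::euclidean_space"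
  assumes G: "bounded_bilinear G" "\<And>a b. G a b = G b a" "\<And>a. a \<noteq> 0 \<Longrightarrow> G a a > (0::real)"
    and Q: "\<And>a b c. 2 * G (Q a b) c = G (B a b) c - G (B a c) b - G (B b c) a"
    and near: "\<And>Z. vector_field_near N T z Z \<Longrightarrow> F Z"
    and ext: "\<And>b. \<exists>Z. vector_field_near N T z Z \<and> L z (Z z) = b"
    and L: "linear (L z)" "bij_betw (L z) (T z) UNIV"
    and g: "\<And>w w'. w \<in> T z \<Longrightarrow> w' \<in> T z \<Longrightarrow> g z w w' = G (L z w) (L z w')"
    and FT: "\<And>X. F X \<Longrightarrow> X z \<in> T z"
    and FL: "\<And>X. F X \<Longrightarrow> (\<lambda>y. L y (X y)) differentiable (at z)"
    and Fg: "\<And>X Y Z. F X \<Longrightarrow> F Y \<Longrightarrow> F Z \<Longrightarrow>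
       dd (\<lambda>y. g y (Y y) (Z y)) (X z) z = dd (\<lambda>y. G (L y (Y y)) (L y (Z y))) (X z) z"
    and Flie: "\<And>X Y. F X \<Longrightarrow> F Y \<Longrightarrow> lie_bracket X Y z \<in> T z"
    and FB: "\<And>X Y. F X \<Longrightarrow> F Y \<Longrightarrow> L z (lie_bracket X Y z) =
       dd (\<lambda>y. L y (Y y)) (X z) z - dd (\<lambda>y. L y (X y)) (Y z) z + B (L z (X z)) (L z (Y z))"
    and XY: "F X" "F Y"
  shows "levi_civita N T g X Y z \<in> T z"
    and "L z (levi_civita N T g X Y z) = dd (\<lambda>y. L y (Y y)) (X z) z + Q (L z (X z)) (L z (Y z))"
proof -
  interpret G: bounded_bilinear G by fact
  let ?w = "dd (\<lambda>y. L y (Y y)) (X z) z + Q (L z (X z)) (L z (Y z))"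
  have k: "koszul g X Y Z z = 2 * G ?w (L z (Z z))" if "F Z" for Z
  proof -
    have d: "deriv_along X' (\<lambda>y. g y (Y' y) (Z' y)) z
       = G (L z (Y' z)) (dd (\<lambda>y. L y (Z' y)) (X' z) z) + G (dd (\<lambda>y. L y (Y' y)) (X' z) z) (L z (Z' z))"
      if "F X'" "F Y'" "F Z'" for X' Y' Z'
      unfolding deriv_along_def Fg[OF that] by (rule dd_bilinear[OF G(1) FL FL]) (fact that)+
    have b: "g z (lie_bracket X' Y' z) (Z' z) = G (dd (\<lambda>y. L y (Y' y)) (X' z) z
        - dd (\<lambda>y. L y (X' y)) (Y' z) z + B (L z (X' z)) (L z (Y' z))) (L z (Z' z))"
      if "F X'" "F Y'" "F Z'" for X' Y' Z'
      using that by (simp only: g Flie FT FB)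
    show ?thesis
      unfolding koszul_def d[OF XY that] d[OF XY(2) that XY(1)] d[OF that XY] b[OF XY that]
        b[OF XY(1) that XY(2)] b[OF XY(2) that XY(1)]
      using Q[of "L z (X z)" "L z (Y z)" "L z (Z z)"]
      by (simp add: G.add_left G.diff_left G.add_right G.diff_right G(2))
  qed
  have "?w \<in> L z ` T z" using L(2) unfolding bij_betw_def by simp
  then obtain w where w: "w \<in> T z" "L z w = ?w" by (rule imageE) simp
  have ex: "2 * g z w (Z z) = koszul g X Y Z z" if "vector_field_near N T z Z" for Z
    using near[OF that] by (simp add: k g w FT)
  have uni: "w' = w" if w': "w' \<in> T z" "\<And>Z. vector_field_near N T z Z \<Longrightarrow> 2 * g z w' (Z z) = koszul g X Y Z z" for w'
  proof -
    obtain Z where Z: "vector_field_near N T z Z" "L z (Z z) = L z w' - L z w" using ext by blast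
    have "G (L z w') (L z (Z z)) = G (L z w) (L z (Z z))"
      using w'(2)[OF Z(1)] ex[OF Z(1)] w w' near[OF Z(1)] by (simp add: g FT)
    then have "G (L z w' - L z w) (L z w' - L z w) = 0" by (simp add: Z(2) G.diff_left)
    then have "L z w' = L z w" using G(3)[of "L z w' - L z w"] by fastforce
    then show ?thesis using L(2) w w' by (auto simp: bij_betw_def inj_on_def)
  qed
  have "levi_civita N T g X Y z = w"
    unfolding levi_civita_def using w ex uni by (intro the_equality) blast+
  then show "levi_civita N T g X Y z \<in> T z" "L z (levi_civita N T g X Y z) = ?w" using w by simp_all
qed

lemma inner_tangent: "p \<bullet> (p \<odot> imq a) = 0"
proof -
  have "p \<bullet> (p \<odot> imq a) = (p \<odot> vector [1,0,0,0]) \<bullet> (p \<odot> imq a)" by (simp add: qmul_one)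
  also have "\<dots> = 0" unfolding inner_qmul by (simp add: inner_4)
  finally show ?thesis .
qed

text \<open>Projecting a tangent line radially to the sphere gives a curve with that tangent.\<close>

lemma sphere_curve:
  fixes p U :: quat
  assumes "norm p = 1" "p \<bullet> U = 0"
  obtains c where "c 0 = p" "\<And>t. norm (c t) = 1" "(c has_derivative (\<lambda>t. t *\<^sub>R U)) (at (0::real))"
proof
  let ?c = "\<lambda>t::real. (1 / sqrt (1 + t\<^sup>2 * (U \<bullet> U))) *\<^sub>R (p + t *\<^sub>R U)"
  have pos: "1 + t\<^sup>2 * (U \<bullet> U) > 0" for t :: real
    by (smt (verit) inner_ge_zero mult_nonneg_nonneg zero_le_power2)
  show "?c 0 = p" by simp
  show "norm (?c t) = 1" for t
  proof -
    have "(norm (p + t *\<^sub>R U))\<^sup>2 = 1 + t\<^sup>2 * (U \<bullet> U)"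
      using assms unfolding power2_norm_eq_inner norm_eq_1
      by (simp add: inner_simps inner_commute[of U p] power2_eq_square)
    then have "norm (p + t *\<^sub>R U) = sqrt (1 + t\<^sup>2 * (U \<bullet> U))" by (metis norm_ge_zero real_sqrt_unique)
    then show ?thesis using pos[of t] by simp
  qed
  show "(?c has_derivative (\<lambda>t. t *\<^sub>R U)) (at 0)"
    by (auto intro!: derivative_eq_intros)
qed

text \<open>Tangential derivatives depend only on the values on \<open>S3S3\<close>: compare along a curve in
\<open>S3S3\<close>. This replaces expressions by simpler ones that agree with them on \<open>S3S3\<close> only.\<close>

lemma dd_tangent_cong:
  assumes z: "z \<in> S3S3" "v \<in> tangent_S3S3 z" and U: "open U" "z \<in> U"
    and h: "h1 differentiable (at z)" "h2 differentiable (at z)" "\<And>y. y \<in> U \<Longrightarrow> y \<in> S3S3 \<Longrightarrow> h1 y = h2 y"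
  shows "dd h1 v z = dd h2 v z"
proof -
  obtain p q where pq: "z = (p, q)" by (cases z)
  obtain a where a: "v = untriv z a" using z by (auto simp: tangent_iff)
  have n: "norm p = 1" "norm q = 1" using z by (auto simp: S3S3_def pq)
  obtain c where c: "c 0 = p" "\<And>t. norm (c t) = 1" "(c has_derivative (\<lambda>t. t *\<^sub>R fst v)) (at (0::real))"
    using sphere_curve[of p "fst v"] n by (auto simp: a untriv_def pq inner_tangent)
  obtain d where d: "d 0 = q" "\<And>t. norm (d t) = 1" "(d has_derivative (\<lambda>t. t *\<^sub>R snd v)) (at (0::real))"
    using sphere_curve[of q "snd v"] n by (auto simp: a untriv_def pq inner_tangent)
  let ?c = "\<lambda>t. (c t, d t)"
  have dc: "(?c has_derivative (\<lambda>t. t *\<^sub>R v)) (at 0)"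
    using has_derivative_Pair[OF c(3) d(3)] by (simp add: scaleR_prod_def)
  have c0: "?c 0 = z" by (simp add: c d pq)
  have *: "((\<lambda>t. h (?c t)) has_derivative (\<lambda>t. dd h (t *\<^sub>R v) z)) (at 0)" if "h differentiable (at z)" for h :: "_ \<Rightarrow> 'a"
    using has_derivative_compose[OF dc, of h "\<lambda>v. dd h v z"] has_derivative_dd[OF that] by (simp add: c0)
  have "isCont ?c 0" using dc has_derivative_continuous by blast
  then have "(?c \<longlongrightarrow> z) (at 0)" unfolding isCont_def c0 .
  then have "\<forall>\<^sub>F t in at 0. ?c t \<in> U" using U by (rule topological_tendstoD)
  then have "\<forall>\<^sub>F t in at 0. h1 (?c t) = h2 (?c t)"
    by eventually_elim (use h(3) in \<open>simp add: S3S3_def c d\<close>)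
  moreover have "h1 (?c 0) = h2 (?c 0)" using h(3)[of z] U z c0 by simp
  ultimately have "((\<lambda>t. h2 (?c t)) has_derivative (\<lambda>t. dd h1 (t *\<^sub>R v) z)) (at 0)"
    using has_derivative_transform_eventually[OF *[OF h(1)]] by simp
  from has_derivative_unique[OF this *[OF h(2)]] have "dd h1 (1 *\<^sub>R v) z = dd h2 (1 *\<^sub>R v) z"
    by metis
  then show ?thesis by simp
qed

lemma differentiable_nk_metric:
  assumes z: "z \<in> S3S3" and Y: "Y differentiable (at z)" "Z differentiable (at z)"
  shows "(\<lambda>y. nk_metric y (Y y) (Z y)) differentiable (at z)"
proof -
  have n: "fst z \<bullet> fst z = 1" "snd z \<bullet> snd z = 1" using z by (auto simp: S3S3_def norm_eq_1)
  have id: "(\<lambda>y. y) differentiable (at z)" by (simp add: differentiable_ident)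
  have fs: "(\<lambda>y. fst (f y)) differentiable (at z)" "(\<lambda>y. snd (f y)) differentiable (at z)"
    if "f differentiable (at z)" for f :: "_ \<Rightarrow> quat \<times> quat"
    using that by (auto intro: differentiable_linear_comp bounded_linear_fst bounded_linear_snd)
  have qinv: "(\<lambda>y. qinv (f y)) differentiable (at z)" if f: "f differentiable (at z)" "f z \<bullet> f z = 1" for f :: "_ \<Rightarrow> quat"
  proof -
    have "qinv a = (inverse (a \<bullet> a)) *\<^sub>R qconj a" for a
      by (simp add: qinv_def qconj_def power2_norm_eq_inner divide_inverse)
    moreover have "(\<lambda>y. inverse (f y \<bullet> f y)) differentiable (at z)"
      using f by (intro differentiable_inverse differentiable_bilinear[OF bounded_bilinear_inner]) auto
    ultimately show ?thesis
      by (simp only:) (intro differentiable_bilinear[OF bounded_bilinear_scaleR]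
          differentiable_linear_comp[OF bounded_linear_qconj] f)
  qed
  have J: "(\<lambda>y. nk_J y (Y y)) differentiable (at z)" if Y: "Y differentiable (at z)" for Y
  proof -
    let ?a = "\<lambda>y. 2 *\<^sub>R (fst y \<odot> qinv (snd y) \<odot> snd (Y y)) - fst (Y y)"
    let ?b = "\<lambda>y. - (2 *\<^sub>R (snd y \<odot> qinv (fst y) \<odot> fst (Y y))) + snd (Y y)"
    have "?a differentiable (at z)" "?b differentiable (at z)"
      by (intro differentiable_diff differentiable_add differentiable_minus
          differentiable_bilinear[OF bounded_bilinear_scaleR differentiable_const]
          differentiable_bilinear[OF bounded_bilinear_qmul] qinv fs id Y n)+
    then have "(\<lambda>y. (1 / sqrt 3) *\<^sub>R (?a y, ?b y)) differentiable (at z)"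
      by (intro differentiable_bilinear[OF bounded_bilinear_scaleR differentiable_const])
        (auto simp: differentiable_def intro: has_derivative_Pair)
    then show ?thesis by (simp add: nk_J_def case_prod_unfold)
  qed
  have "(\<lambda>y. Y y \<bullet> Z y + nk_J y (Y y) \<bullet> nk_J y (Z y)) differentiable (at z)"
    by (intro differentiable_add differentiable_bilinear[OF bounded_bilinear_inner] J Y)
  then have "(\<lambda>y. (1/2) *\<^sub>R (Y y \<bullet> Z y + nk_J y (Y y) \<bullet> nk_J y (Z y))) differentiable (at z)"
    by (intro differentiable_bilinear[OF bounded_bilinear_scaleR differentiable_const])
  then show ?thesis by (simp add: nk_metric_def)
qed

text \<open>The solution of the algebraic Koszul formula for \<open>nkG\<close> and \<open>bracket\<close>: the Levi-Civita
connection on left-invariant fields.\<close>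

definition nkQ :: "r33 \<Rightarrow> r33 \<Rightarrow> r33" where
  "nkQ a b = (let k = snd a \<times> fst b - fst a \<times> snd b
     in (fst a \<times> fst b + (1/3) *\<^sub>R k, snd a \<times> snd b - (1/3) *\<^sub>R k))"

lemma nkQ_koszul: "2 * nkG (nkQ a b) c = nkG (bracket a b) c - nkG (bracket a c) b - nkG (bracket b c) a"
  unfolding nkG_def nkQ_def bracket_def Let_def inner_3 cross3_def
  by (simp add: field_simps)

text \<open>What the Koszul formula at \<open>z\<close> needs of a vector field.\<close>

definition near_tangent :: "quat \<times> quat \<Rightarrow> (quat \<times> quat \<Rightarrow> quat \<times> quat) \<Rightarrow> bool" where
  "near_tangent z X \<longleftrightarrow> X differentiable (at z) \<and>
     (\<exists>U. open U \<and> z \<in> U \<and> (\<forall>y\<in>U \<inter> S3S3. X y \<in> tangent_S3S3 y))"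

lemma near_tangentI: "vector_field_near S3S3 tangent_S3S3 z X \<Longrightarrow> near_tangent z X"
  unfolding vector_field_near_def near_tangent_def by (blast intro: smooth_on_differentiable)

lemma differentiable_triv:
  assumes "X differentiable (at z)" shows "(\<lambda>y. triv y (X y)) differentiable (at z)"
  by (rule differentiable_bilinear[OF bounded_bilinear_triv differentiable_ident assms])

lemma dd_tangent_field:
  assumes z: "z \<in> S3S3" and X: "v \<in> tangent_S3S3 z" "near_tangent z Y"
  shows "dd Y v z = untriv z (dd (\<lambda>y. triv y (Y y)) v z) + untriv v (triv z (Y z))"
proof -
  obtain U where U: "Y differentiable (at z)" "open U" "z \<in> U" "\<And>y. y \<in> U \<Longrightarrow> y \<in> S3S3 \<Longrightarrow> Y y \<in> tangent_S3S3 y"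
    using X(2) unfolding near_tangent_def by blast
  have "dd Y v z = dd (\<lambda>y. untriv y (triv y (Y y))) v z"
    by (rule dd_tangent_cong[OF z X(1) U(2,3)])
      (simp_all add: U untriv_triv differentiable_triv
        differentiable_bilinear[OF bounded_bilinear_untriv differentiable_ident])
  also have "\<dots> = untriv z (dd (\<lambda>y. triv y (Y y)) v z) + untriv (dd (\<lambda>y. y) v z) (triv z (Y z))"
    by (rule dd_bilinear[OF bounded_bilinear_untriv differentiable_ident differentiable_triv[OF U(1)]])
  also have "dd (\<lambda>y. y) v z = v" by (rule dd_eqI[OF has_derivative_ident])
  finally show ?thesis .
qed

lemma lie_bracket_S3S3:
  assumes z: "z \<in> S3S3" and X: "near_tangent z X" and Y: "near_tangent z Y"
  shows "lie_bracket X Y z = untriv z (dd (\<lambda>y. triv y (Y y)) (X z) z - dd (\<lambda>y. triv y (X y)) (Y z) z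
     + bracket (triv z (X z)) (triv z (Y z)))"
proof -
  interpret u: bounded_bilinear untriv by (rule bounded_bilinear_untriv)
  have t: "X z \<in> tangent_S3S3 z" "Y z \<in> tangent_S3S3 z"
    using X Y z unfolding near_tangent_def by blast+
  have "untriv (X z) (triv z (Y z)) - untriv (Y z) (triv z (X z)) = untriv z (bracket (triv z (X z)) (triv z (Y z)))"
    using untriv_untriv_antisym[of z "triv z (X z)" "triv z (Y z)"] by (simp add: untriv_triv z t)
  then show ?thesis
    unfolding lie_bracket_def deriv_along_def dd_tangent_field[OF z t(1) Y] dd_tangent_field[OF z t(2) X]
    by (simp add: u.add_right u.diff_right algebra_simps)
qed

theorem levi_civita_S3S3:
  assumes z: "z \<in> S3S3" and XY: "near_tangent z X" "near_tangent z Y"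
  shows "levi_civita S3S3 tangent_S3S3 nk_metric X Y z \<in> tangent_S3S3 z"
    and "triv z (levi_civita S3S3 tangent_S3S3 nk_metric X Y z)
      = dd (\<lambda>y. triv y (Y y)) (X z) z + nkQ (triv z (X z)) (triv z (Y z))"
proof -
  interpret t: bounded_bilinear triv by (rule bounded_bilinear_triv)
  interpret u: bounded_bilinear untriv by (rule bounded_bilinear_untriv)
  have FT: "X z \<in> tangent_S3S3 z" if "near_tangent z X" for X
    using that z unfolding near_tangent_def by blast
  have ext: "\<exists>Z. vector_field_near S3S3 tangent_S3S3 z Z \<and> triv z (Z z) = b" for b
  proof (intro exI conjI)
    show "vector_field_near S3S3 tangent_S3S3 z (\<lambda>y. untriv y b)"
      unfolding vector_field_near_def
      by (rule exI[of _ UNIV]) (auto simp: tangent_iff intro!: smooth_on_linear bounded_linear.linear u.bounded_linear_left)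
    show "triv z (untriv z b) = b" using z by (rule triv_untriv)
  qed
  have bij: "bij_betw (triv z) (tangent_S3S3 z) UNIV"
    by (rule bij_betw_byWitness[where f' = "untriv z"]) (auto simp: z triv_untriv untriv_triv tangent_iff)
  have Fg: "dd (\<lambda>y. nk_metric y (Y y) (Z y)) (X z) z = dd (\<lambda>y. nkG (triv y (Y y)) (triv y (Z y))) (X z) z"
    if F: "near_tangent z X" "near_tangent z Y" "near_tangent z Z" for X Y Z
  proof -
    obtain U1 where U1: "Y differentiable (at z)" "open U1" "z \<in> U1" "\<And>y. y \<in> U1 \<Longrightarrow> y \<in> S3S3 \<Longrightarrow> Y y \<in> tangent_S3S3 y"
      using F(2) unfolding near_tangent_def by blast
    obtain U2 where U2: "Z differentiable (at z)" "open U2" "z \<in> U2" "\<And>y. y \<in> U2 \<Longrightarrow> y \<in> S3S3 \<Longrightarrow> Z y \<in> tangent_S3S3 y"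
      using F(3) unfolding near_tangent_def by blast
    show ?thesis
      by (rule dd_tangent_cong[OF z FT[OF F(1)], of "U1 \<inter> U2"])
        (use U1 U2 in \<open>auto simp: nk_metric_tangent intro!: differentiable_nk_metric z
          differentiable_bilinear[OF bounded_bilinear_nkG] differentiable_triv\<close>)
  qed
  have d: "(\<lambda>y. triv y (X y)) differentiable (at z)" if "near_tangent z X" for X
    using that unfolding near_tangent_def by (blast intro: differentiable_triv)
  have l: "lie_bracket X Y z \<in> tangent_S3S3 z"
     "triv z (lie_bracket X Y z) = dd (\<lambda>y. triv y (Y y)) (X z) z - dd (\<lambda>y. triv y (X y)) (Y z) z
     + bracket (triv z (X z)) (triv z (Y z))" if "near_tangent z X" "near_tangent z Y" for X Y
    unfolding lie_bracket_S3S3[OF z that] by (auto simp: triv_untriv z tangent_iff)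
  note * = levi_civita_trivialized[where N = S3S3 and T = tangent_S3S3 and g = nk_metric and z = z
      and F = "near_tangent z" and L = triv and G = nkG and B = bracket and Q = nkQ and X = X and Y = Y,
      OF bounded_bilinear_nkG nkG_commute nkG_self_pos nkQ_koszul]
  show "levi_civita S3S3 tangent_S3S3 nk_metric X Y z \<in> tangent_S3S3 z"
    by (rule *(1)) (assumption | rule near_tangentI ext bounded_linear.linear t.bounded_linear_right bij
        nk_metric_tangent z FT d Fg l XY)+
  show "triv z (levi_civita S3S3 tangent_S3S3 nk_metric X Y z)
      = dd (\<lambda>y. triv y (Y y)) (X z) z + nkQ (triv z (X z)) (triv z (Y z))"
    by (rule *(2)) (assumption | rule near_tangentI ext bounded_linear.linear t.bounded_linear_right bij
        nk_metric_tangent z FT d Fg l XY)+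
qed

section \<open>Tensors and metrics on domains of Euclidean space\<close>

text \<open>A smooth family of linear maps; the point is the last argument, so that \<open>e w\<close> is the map
obtained by inserting the constant field \<open>w\<close>.\<close>

definition smooth_tensor :: "'a::euclidean_space set \<Rightarrow> ('a \<Rightarrow> 'a \<Rightarrow> 'b::euclidean_space) \<Rightarrow> bool" where
  "smooth_tensor U e \<longleftrightarrow> open U \<and> (\<forall>w. smooth_on U (e w)) \<and> (\<forall>y\<in>U. linear (\<lambda>w. e w y))"

lemma tensor_expand:
  assumes "smooth_tensor U e" "y \<in> U"
  shows "e w y = (\<Sum>b\<in>Basis. (w \<bullet> b) *\<^sub>R e b y)"
proof -
  have lin: "linear (\<lambda>w. e w y)" using assms by (simp add: smooth_tensor_def)
  have "e (\<Sum>b\<in>Basis. (w \<bullet> b) *\<^sub>R b) y = (\<Sum>b\<in>Basis. e ((w \<bullet> b) *\<^sub>R b) y)"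
    by (rule linear_sum[OF lin])
  also have "\<dots> = (\<Sum>b\<in>Basis. (w \<bullet> b) *\<^sub>R e b y)"
    by (rule sum.cong[OF refl linear_scale[OF lin]])
  finally show ?thesis by (simp add: euclidean_representation)
qed

lemma tensor_has_derivative:
  assumes e: "smooth_tensor U e" and z: "z \<in> U" and Y: "Y differentiable (at z)"
  shows "((\<lambda>y. e (Y y) y) has_derivative (\<lambda>v. e (dd Y v z) z + dd (e (Y z)) v z)) (at z)"
proof -
  have U: "open U" using e by (simp add: smooth_tensor_def)
  have db: "(e b has_derivative (\<lambda>v. dd (e b) v z)) (at z)" for b
    using e z by (intro smooth_on_has_derivative) (auto simp: smooth_tensor_def)
  have s: "((\<lambda>y. \<Sum>b\<in>Basis. (X y \<bullet> b) *\<^sub>R e b y) has_derivative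
     (\<lambda>v. \<Sum>b\<in>Basis. (X z \<bullet> b) *\<^sub>R dd (e b) v z + (dd X v z \<bullet> b) *\<^sub>R e b z)) (at z)"
    if "X differentiable (at z)" for X
    by (intro has_derivative_sum has_derivative_scaleR db has_derivative_inner_left has_derivative_dd that)
  have eq: "(\<Sum>b\<in>Basis. (X y \<bullet> b) *\<^sub>R e b y) = e (X y) y" if "y \<in> U" for y X
    using tensor_expand[OF e that, of "X y"] by simp
  have t: "((\<lambda>y. e (X y) y) has_derivative
     (\<lambda>v. \<Sum>b\<in>Basis. (X z \<bullet> b) *\<^sub>R dd (e b) v z + (dd X v z \<bullet> b) *\<^sub>R e b z)) (at z)"
    if "X differentiable (at z)" for X
    by (rule has_derivative_transform_within_open[OF s[OF that] U z]) (rule eq)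
  have c: "dd (e (Y z)) v z = (\<Sum>b\<in>Basis. (Y z \<bullet> b) *\<^sub>R dd (e b) v z)" for v
    using dd_eqI[OF t[of "\<lambda>_. Y z"], of v] by (simp add: frechet_derivative_const)
  have "(\<Sum>b\<in>Basis. (Y z \<bullet> b) *\<^sub>R dd (e b) v z + (dd Y v z \<bullet> b) *\<^sub>R e b z) =
    e (dd Y v z) z + dd (e (Y z)) v z" for v
    unfolding c sum.distrib by (subst tensor_expand[OF e z, of "dd Y v z"]) (rule add.commute)
  then show ?thesis using t[OF Y] by simp
qed

lemma smooth_on_tensor:
  assumes e: "smooth_tensor U e" and Y: "smooth_on U Y"
  shows "smooth_on U (\<lambda>y. e (Y y) y)"
proof -
  have U: "open U" and s: "\<And>b. smooth_on U (e b)" using e by (auto simp: smooth_tensor_def)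
  have "smooth_on U (\<lambda>y. \<Sum>b\<in>Basis. (Y y \<bullet> b) *\<^sub>R e b y)"
    by (intro smooth_on_sum smooth_on_scaleR smooth_on_inner Y smooth_on_const U s)
  then show ?thesis by (rule smooth_on_cong) (simp_all add: U tensor_expand[OF e, symmetric])
qed

lemma smooth_tensor_dd:
  assumes "smooth_on U f" "open U" shows "smooth_tensor U (dd f)"
  unfolding smooth_tensor_def
  using assms by (auto intro!: smooth_on_dd dd_linear smooth_on_differentiable)

definition smooth_metric :: "(real^3) set \<Rightarrow> (real^3) metric \<Rightarrow> bool" where
  "smooth_metric D g \<longleftrightarrow> open D \<and> (\<forall>v w. smooth_on D (\<lambda>y. g y v w)) \<and>
     (\<forall>y\<in>D. (\<forall>v. linear (g y v)) \<and> (\<forall>v w. g y v w = g y w v) \<and> (\<forall>v. v \<noteq> 0 \<longrightarrow> g y v v > 0))"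

lemma smooth_metric_tensor:
  assumes g: "smooth_metric D g" and X: "smooth_on D X"
  shows "smooth_tensor D (\<lambda>w y. g y (X y) w)" "smooth_tensor D (\<lambda>w y. g y w (X y))"
proof -
  have D: "open D" and sm: "\<And>v w. smooth_on D (\<lambda>y. g y v w)" and lin: "\<And>y v. y \<in> D \<Longrightarrow> linear (g y v)"
    and sym: "\<And>y v w. y \<in> D \<Longrightarrow> g y v w = g y w v"
    using g unfolding smooth_metric_def by blast+
  have lin': "linear (\<lambda>v. g y v w)" if "y \<in> D" for y w
  proof -
    have "(\<lambda>v. g y v w) = g y w" by (rule ext) (rule sym[OF that])
    then show ?thesis using lin[OF that, of w] by simp
  qed
  have t1: "smooth_tensor D (\<lambda>w y. g y v w)" "smooth_tensor D (\<lambda>v y. g y v w)" for v w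
    by (simp_all add: smooth_tensor_def D sm lin lin')
  show "smooth_tensor D (\<lambda>w y. g y (X y) w)"
    unfolding smooth_tensor_def using D lin smooth_on_tensor[OF t1(2) X] by simp
  show "smooth_tensor D (\<lambda>w y. g y w (X y))"
    unfolding smooth_tensor_def using D lin' smooth_on_tensor[OF t1(1) X] by simp
qed

lemma smooth_on_metric:
  assumes "smooth_metric D g" "smooth_on D X" "smooth_on D Y"
  shows "smooth_on D (\<lambda>y. g y (X y) (Y y))"
  by (rule smooth_on_tensor[OF smooth_metric_tensor(1)]) fact+

lemma metric_has_derivative:
  assumes g: "smooth_metric D g" and z: "z \<in> D" and Y: "Y differentiable (at z)" "X differentiable (at z)"
  shows "((\<lambda>y. g y (X y) (Y y)) has_derivative
     (\<lambda>v. g z (dd X v z) (Y z) + g z (X z) (dd Y v z) + dd (\<lambda>y. g y (X z) (Y z)) v z)) (at z)"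
proof -
  have D: "open D" and sm: "\<And>v w. smooth_on D (\<lambda>y. g y v w)" and lin: "\<And>y v. y \<in> D \<Longrightarrow> linear (g y v)"
    and sym: "\<And>y v w. y \<in> D \<Longrightarrow> g y v w = g y w v"
    using g unfolding smooth_metric_def by blast+
  have X: "((\<lambda>y. g y (X y) w) has_derivative (\<lambda>v. g z (dd X v z) w + dd (\<lambda>y. g y (X z) w) v z)) (at z)" for w
    by (rule tensor_has_derivative[OF smooth_metric_tensor(2)[OF g smooth_on_const] z Y(2)])
  have rep: "(\<Sum>b\<in>Basis. (Y y \<bullet> b) *\<^sub>R g y (X y) b) = g y (X y) (Y y)" if "y \<in> D" for y Y X
    using linear_sum[OF lin[OF that], of "X y" "\<lambda>b. (Y y \<bullet> b) *\<^sub>R b" Basis]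
    by (simp only: linear_scale[OF lin[OF that]] euclidean_representation)
  have rep': "(\<Sum>b\<in>Basis. (v \<bullet> b) *\<^sub>R g z x b) = g z x v" for v x
    using rep[OF z, of "\<lambda>_. v" "\<lambda>_. x"] by simp
  have s: "((\<lambda>y. g y (X y) (Y y)) has_derivative
     (\<lambda>v. \<Sum>b\<in>Basis. (Y z \<bullet> b) *\<^sub>R (g z (dd X v z) b + dd (\<lambda>y. g y (X z) b) v z) + (dd Y v z \<bullet> b) *\<^sub>R g z (X z) b)) (at z)"
    by (rule has_derivative_transform_within_open[OF _ D z rep])
      (intro has_derivative_sum has_derivative_scaleR X has_derivative_inner_left has_derivative_dd Y)
  have d: "dd (\<lambda>y. g y (X z) (Y z)) v z = (\<Sum>b\<in>Basis. (Y z \<bullet> b) *\<^sub>R dd (\<lambda>y. g y (X z) b) v z)" for v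
  proof (rule dd_eqI[OF has_derivative_transform_within_open[OF _ D z rep[of _ "\<lambda>_. Y z" "\<lambda>_. X z"]]])
    show "((\<lambda>y. \<Sum>b\<in>Basis. (Y z \<bullet> b) *\<^sub>R g y (X z) b) has_derivative
       (\<lambda>v. \<Sum>b\<in>Basis. (Y z \<bullet> b) *\<^sub>R dd (\<lambda>y. g y (X z) b) v z)) (at z)"
      by (intro has_derivative_sum has_derivative_scaleR_right smooth_on_has_derivative[OF sm z])
  qed
  have "(\<Sum>b\<in>Basis. (Y z \<bullet> b) *\<^sub>R (g z (dd X v z) b + dd (\<lambda>y. g y (X z) b) v z) + (dd Y v z \<bullet> b) *\<^sub>R g z (X z) b)
    = g z (dd X v z) (Y z) + g z (X z) (dd Y v z) + dd (\<lambda>y. g y (X z) (Y z)) v z" for v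
    unfolding d scaleR_add_right sum.distrib rep' by simp
  with s show ?thesis by simp
qed

text \<open>The terms that contain derivatives of \<open>Z\<close> cancel, so it suffices to test the Levi-Civita
connection on constant fields.\<close>

lemma koszul_tensorial:
  assumes g: "smooth_metric D g" and z: "z \<in> D"
    and X: "X differentiable (at z)" and Y: "Y differentiable (at z)" and Z: "Z differentiable (at z)"
  shows "koszul g X Y Z z = koszul g X Y (\<lambda>_. Z z) z"
proof -
  have lin: "\<And>v. linear (g z v)" and sym: "\<And>v w. g z v w = g z w v"
    using g z unfolding smooth_metric_def by blast+
  have c: "(\<lambda>_. Z z) differentiable (at z)" by simp
  have d0: "dd (\<lambda>_. Z z) v z = 0" for v by (simp add: frechet_derivative_const)
  note m = dd_eqI[OF metric_has_derivative[OF g z]]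
  have "koszul g X Y Z z - koszul g X Y (\<lambda>_. Z z) z
     = g z (Y z) (dd Z (X z) z) + g z (dd Z (Y z) z) (X z)
     - (g z (lie_bracket X Z z) (Y z) - g z (lie_bracket X (\<lambda>_. Z z) z) (Y z))
     - (g z (lie_bracket Y Z z) (X z) - g z (lie_bracket Y (\<lambda>_. Z z) z) (X z))"
    unfolding koszul_def deriv_along_def m[OF Z Y] m[OF X Z] m[OF Y X] m[OF c Y] m[OF X c] d0
    by (simp add: linear_0[OF lin] sym[of 0])
  also have "\<dots> = 0"
    unfolding lie_bracket_def deriv_along_def d0 sym[of _ "Y z"] sym[of _ "X z"] linear_diff[OF lin]
    by (simp add: linear_0[OF lin])
  finally show ?thesis by simp
qed

lemma koszul_linear:
  assumes g: "smooth_metric D g" and z: "z \<in> D"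
    and X: "X differentiable (at z)" and Y: "Y differentiable (at z)"
  shows "linear (\<lambda>w. koszul g X Y (\<lambda>_. w) z)"
proof -
  have lin: "\<And>v. linear (g z v)" and sym: "\<And>v w. g z v w = g z w v"
    and D: "open D" and ling: "\<And>y v. y \<in> D \<Longrightarrow> linear (g y v)" and sm: "\<And>v w. smooth_on D (\<lambda>y. g y v w)"
    using g z unfolding smooth_metric_def by blast+
  have c: "(\<lambda>_. w) differentiable (at z)" for w :: "real^3" by simp
  have d0: "dd (\<lambda>_. w) v z = 0" for v and w :: "real^3" by (simp add: frechet_derivative_const)
  note m = dd_eqI[OF metric_has_derivative[OF g z]]
  have "linear (\<lambda>w. dd (\<lambda>y. g y x w) v z)" for x v
  proof (rule linearI)
    fix a b :: "real^3" and r :: real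
    have da: "((\<lambda>y. g y x a) has_derivative (\<lambda>v. dd (\<lambda>y. g y x a) v z)) (at z)" for a
      by (rule smooth_on_has_derivative[OF sm z])
    show "dd (\<lambda>y. g y x (a + b)) v z = dd (\<lambda>y. g y x a) v z + dd (\<lambda>y. g y x b) v z"
      by (rule dd_eqI[OF has_derivative_transform_within_open[OF has_derivative_add[OF da da] D z]])
        (simp add: linear_add[OF ling])
    show "dd (\<lambda>y. g y x (r *\<^sub>R a)) v z = r *\<^sub>R dd (\<lambda>y. g y x a) v z"
      by (rule dd_eqI[OF has_derivative_transform_within_open[OF has_derivative_scaleR_right[OF da] D z]])
        (simp add: linear_scale[OF ling])
  qed
  note l1 = this
  have dsym: "dd (\<lambda>y. g y w x) v z = dd (\<lambda>y. g y x w) v z" for w x v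
    by (rule dd_cong[OF D z]) (use g in \<open>auto simp: smooth_metric_def\<close>)
  have lx: "linear (\<lambda>w. dd X w z)" "linear (\<lambda>w. dd Y w z)" and lm: "linear (\<lambda>w. dd (\<lambda>y. g y (X z) (Y z)) w z)"
    by (auto intro: dd_linear X Y smooth_on_differentiable[OF sm z])
  have "koszul g X Y (\<lambda>_. w) z =
     g z (dd Y (X z) z) w + dd (\<lambda>y. g y (Y z) w) (X z) z
     + (g z (dd X (Y z) z) w + dd (\<lambda>y. g y (X z) w) (Y z) z)
     - dd (\<lambda>y. g y (X z) (Y z)) w z + g z (lie_bracket X Y z) w" for w
    unfolding koszul_def lie_bracket_def[of _ "\<lambda>_. w"] deriv_along_def m[OF c Y] m[OF X c] m[OF Y X] d0 dsym[of w]
      sym[of w] sym[of "0 - _"] linear_diff[OF lin] linear_0[OF lin] sym[of "dd _ w z"]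
    by (simp add: sym[of 0] linear_0[OF lin] sym[of "X z" "dd Y w z"] sym[of "Y z" "dd X w z"])
  then show ?thesis
    by (simp only:) (intro linear_compose_add linear_compose_sub lin l1 lm)
qed

lemma vector_3_nth: "(vector [a,b,c] :: 'a::zero^3) $ 1 = a" "(vector [a,b,c] :: 'a^3) $ 2 = b" "(vector [a,b,c] :: 'a^3) $ 3 = c"
  unfolding vector_def by simp_all

text \<open>The solution of three linear equations with coefficient rows \<open>r\<close>, \<open>s\<close>, \<open>t\<close>, written with cross
products so that its smooth dependence on all data is evident.\<close>

definition cramer :: "real^3 \<Rightarrow> real^3 \<Rightarrow> real^3 \<Rightarrow> real \<Rightarrow> real \<Rightarrow> real \<Rightarrow> real^3" where
  "cramer r s t a b c = inverse (r \<bullet> (s \<times> t)) *\<^sub>R (a *\<^sub>R (s \<times> t) + b *\<^sub>R (t \<times> r) + c *\<^sub>R (r \<times> s))"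

lemma cramer_inner:
  assumes "r \<bullet> (s \<times> t) \<noteq> 0"
  shows "r \<bullet> cramer r s t a b c = a" "s \<bullet> cramer r s t a b c = b" "t \<bullet> cramer r s t a b c = c"
proof -
  have "s \<bullet> (t \<times> r) = r \<bullet> (s \<times> t)" "t \<bullet> (r \<times> s) = r \<bullet> (s \<times> t)"
    by (simp_all add: cross3_simps)
  then show "r \<bullet> cramer r s t a b c = a" "s \<bullet> cramer r s t a b c = b" "t \<bullet> cramer r s t a b c = c"
    using assms by (simp_all add: cramer_def inner_add_right dot_cross_self)
qed

lemma triple_product_nonzero:
  fixes r s t :: "real^3"
  assumes "\<And>x. r \<bullet> x = 0 \<Longrightarrow> s \<bullet> x = 0 \<Longrightarrow> t \<bullet> x = 0 \<Longrightarrow> x = 0"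
  shows "r \<bullet> (s \<times> t) \<noteq> 0"
proof
  assume 0: "r \<bullet> (s \<times> t) = 0"
  let ?A = "vector [r, s, t] :: real^3^3"
  have "x = 0" if "?A *v x = 0" for x
  proof (rule assms)
    have "row i ?A \<bullet> x = 0" for i
      using that by (simp add: matrix_vector_mul_component row_def vec_eq_iff)
    then have "(?A $ i) \<bullet> x = 0" for i by (simp add: row_def vec_nth_inverse)
    from this[of 1] this[of 2] this[of 3] show "r \<bullet> x = 0" "s \<bullet> x = 0" "t \<bullet> x = 0"
      by (simp_all add: vector_3_nth)
  qed
  then have "invertible ?A"
    using matrix_left_invertible_ker invertible_left_inverse by blast
  then have "det ?A \<noteq> 0" by (simp add: invertible_det_nz)
  then show False using 0 by (simp add: dot_cross_det)
qed

lemma linear_axis_expand: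
  fixes f :: "real^3 \<Rightarrow> 'b::real_vector"
  assumes "linear f"
  shows "f w = (w$1) *\<^sub>R f (axis 1 1) + (w$2) *\<^sub>R f (axis 2 1) + (w$3) *\<^sub>R f (axis 3 1)"
proof -
  have "w = (w$1) *\<^sub>R axis 1 1 + (w$2) *\<^sub>R axis 2 1 + (w$3) *\<^sub>R axis 3 1"
    by (simp add: vec_eq_iff forall_3 axis_def)
  then have "f w = f ((w$1) *\<^sub>R axis 1 1 + (w$2) *\<^sub>R axis 2 1 + (w$3) *\<^sub>R axis 3 1)" by simp
  then show ?thesis by (simp add: linear_add[OF assms] linear_scale[OF assms])
qed

lemma smooth_on_vector3:
  assumes "smooth_on S f" "smooth_on S g" "smooth_on S h" "open S"
  shows "smooth_on S (\<lambda>y. vector [f y, g y, h y] :: real^3)"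
proof -
  have "smooth_on S (\<lambda>y. f y *\<^sub>R axis 1 1 + g y *\<^sub>R axis 2 1 + h y *\<^sub>R axis 3 (1::real) :: real^3)"
    by (intro smooth_on_add smooth_on_scaleR smooth_on_const assms)
  moreover have "f y *\<^sub>R axis 1 1 + g y *\<^sub>R axis 2 1 + h y *\<^sub>R axis 3 (1::real) = (vector [f y, g y, h y] :: real^3)" for y
    by (simp add: vec_eq_iff forall_3 axis_def vector_3_nth)
  ultimately show ?thesis by simp
qed

lemma smooth_on_koszul:
  assumes g: "smooth_metric D g" and X: "smooth_on D X" and Y: "smooth_on D Y" and Z: "smooth_on D Z"
  shows "smooth_on D (koszul g X Y Z)"
proof -
  have D: "open D" using g by (simp add: smooth_metric_def)
  have d: "smooth_on D (\<lambda>z. deriv_along X f z)" if "smooth_on D X" "smooth_on D f" for X and f :: "_ \<Rightarrow> 'a::euclidean_space"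
    unfolding deriv_along_def by (rule smooth_on_tensor[OF smooth_tensor_dd[OF that(2) D] that(1)])
  have l: "smooth_on D (lie_bracket X Y)" if "smooth_on D X" "smooth_on D Y" for X Y
    using smooth_on_diff[OF d[OF that] d[OF that(2,1)] D] unfolding lie_bracket_def[abs_def] .
  show ?thesis
    unfolding koszul_def[abs_def]
    by (intro smooth_on_add smooth_on_diff d smooth_on_metric[OF g] X Y Z l D)
qed

text \<open>By tensoriality the connection is determined by three linear equations with smooth coefficients,
whose matrix is the Gram matrix of the metric.\<close>

theorem levi_civita_smooth:
  assumes g: "smooth_metric D g" and X: "smooth_on D X" and Y: "smooth_on D Y"
  shows "smooth_on D (levi_civita D (\<lambda>_. UNIV) g X Y)"
    and "z \<in> D \<Longrightarrow> 2 * g z (levi_civita D (\<lambda>_. UNIV) g X Y z) w = koszul g X Y (\<lambda>_. w) z"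
proof -
  have D: "open D" and sm: "\<And>v w. smooth_on D (\<lambda>y. g y v w)" and lin: "\<And>y v. y \<in> D \<Longrightarrow> linear (g y v)"
    and sym: "\<And>y v w. y \<in> D \<Longrightarrow> g y v w = g y w v" and pos: "\<And>y v. y \<in> D \<Longrightarrow> v \<noteq> 0 \<Longrightarrow> g y v v > 0"
    using g unfolding smooth_metric_def by blast+
  define r where "r i y = (vector [g y (axis i 1) (axis 1 1), g y (axis i 1) (axis 2 1), g y (axis i 1) (axis 3 1)] :: real^3)" for i y
  have r_inner: "r i y \<bullet> w = g y (axis i 1) w" if "y \<in> D" for i y w
    unfolding linear_axis_expand[OF lin[OF that], of "axis i 1" w]
    by (simp add: r_def inner_3 vector_3_nth mult.commute)
  have det: "r 1 y \<bullet> (r 2 y \<times> r 3 y) \<noteq> 0" if y: "y \<in> D" for y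
  proof (rule triple_product_nonzero)
    fix x assume "r 1 y \<bullet> x = 0" "r 2 y \<bullet> x = 0" "r 3 y \<bullet> x = 0"
    then have "g y x x = 0"
      unfolding linear_axis_expand[OF lin[OF y], of x x] by (simp add: r_inner[OF y] sym[OF y, of x])
    then show "x = 0" using pos[OF y, of x] by auto
  qed
  define k where "k i y = koszul g X Y (\<lambda>_. axis i 1) y / 2" for i y
  define W where "W y = cramer (r 1 y) (r 2 y) (r 3 y) (k 1 y) (k 2 y) (k 3 y)" for y
  have Xd: "X differentiable (at z)" "Y differentiable (at z)" if "z \<in> D" for z
    using X Y that by (auto intro: smooth_on_differentiable)
  have k: "2 * g z (W z) v = koszul g X Y (\<lambda>_. v) z" if z: "z \<in> D" for z v
  proof -
    have "g z (W z) (axis i 1) = r i z \<bullet> W z" for i by (simp add: r_inner z sym[of z "W z"])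
    then have k': "koszul g X Y (\<lambda>_. axis i 1) z = 2 * g z (W z) (axis i 1)" for i
      using exhaust_3[of i] cramer_inner[OF det[OF z]] by (auto simp: W_def k_def)
    show ?thesis
      unfolding linear_axis_expand[OF koszul_linear[OF g z Xd[OF z]], of v] linear_axis_expand[OF lin[OF z], of "W z" v]
      by (simp add: k' algebra_simps)
  qed
  have nearD: "Z differentiable (at z)" if "vector_field_near D (\<lambda>_. UNIV) z Z" for Z z
    using that unfolding vector_field_near_def by (blast intro: smooth_on_differentiable)
  have near_const: "vector_field_near D (\<lambda>_. UNIV) z (\<lambda>_. v)" for z v
    unfolding vector_field_near_def by (rule exI[of _ UNIV]) (simp add: smooth_on_const)
  have lc: "levi_civita D (\<lambda>_. UNIV) g X Y z = W z" if z: "z \<in> D" for z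
    unfolding levi_civita_def
  proof (rule the_equality)
    show "W z \<in> UNIV \<and> (\<forall>Z. vector_field_near D (\<lambda>_. UNIV) z Z \<longrightarrow> 2 * g z (W z) (Z z) = koszul g X Y Z z)"
    proof (intro conjI allI impI UNIV_I)
      fix Z assume "vector_field_near D (\<lambda>_. UNIV) z Z"
      from koszul_tensorial[OF g z Xd[OF z] nearD[OF this]]
      show "2 * g z (W z) (Z z) = koszul g X Y Z z" by (simp only: k[OF z])
    qed
    fix w' assume w': "w' \<in> UNIV \<and> (\<forall>Z. vector_field_near D (\<lambda>_. UNIV) z Z \<longrightarrow> 2 * g z w' (Z z) = koszul g X Y Z z)"
    have "2 * g z w' v = koszul g X Y (\<lambda>_. v) z" for v
      using w'[THEN conjunct2, rule_format, OF near_const[of z v]] .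
    then have "2 * g z w' v = 2 * g z (W z) v" for v by (simp only: k[OF z])
    then have "g z v w' = g z v (W z)" for v by (simp add: sym[OF z, of v])
    then have "g z (w' - W z) (w' - W z) = 0"
      by (simp add: linear_diff[OF lin[OF z]])
    then show "w' = W z" using pos[OF z, of "w' - W z"] by fastforce
  qed
  have sk: "smooth_on D (k i)" for i
    using smooth_on_scaleR[OF smooth_on_const[of _ "1/2"] smooth_on_koszul[OF g X Y smooth_on_const] D, of "axis i 1"]
    unfolding k_def[abs_def] by simp
  have sr: "smooth_on D (r i)" for i
    unfolding r_def[abs_def] by (intro smooth_on_vector3 sm D)
  note cr = smooth_on_bilinear[OF bounded_bilinear_cross3]
  have "smooth_on D W"
    unfolding W_def[abs_def] cramer_def
    by (intro smooth_on_scaleR smooth_on_inverse smooth_on_inner smooth_on_add cr sr sk D det)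
  then show "smooth_on D (levi_civita D (\<lambda>_. UNIV) g X Y)"
    by (rule smooth_on_cong[OF _ D]) (simp add: lc)
  show "z \<in> D \<Longrightarrow> 2 * g z (levi_civita D (\<lambda>_. UNIV) g X Y z) w = koszul g X Y (\<lambda>_. w) z"
    by (simp add: lc k)
qed

lemma smooth_on_curvature:
  assumes g: "smooth_metric D g"
  shows "smooth_on D (curvature D (\<lambda>_. UNIV) g (\<lambda>_. u) (\<lambda>_. v) (\<lambda>_. w))"
proof -
  have D: "open D" using g by (simp add: smooth_metric_def)
  have l: "lie_bracket (\<lambda>_. u) (\<lambda>_. v) = (\<lambda>_. 0)"
    by (rule ext) (simp add: lie_bracket_def deriv_along_def frechet_derivative_const)
  show ?thesis
    unfolding curvature_def[abs_def] l
    by (intro smooth_on_diff levi_civita_smooth(1)[OF g] smooth_on_const D)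
qed

lemma gram_positive:
  assumes g: "smooth_metric D g" and z: "z \<in> D" and uv: "u \<noteq> v" "independent {u, v}"
  shows "g z u u * g z v v - (g z u v)\<^sup>2 > 0"
proof -
  have lin: "\<And>v. linear (g z v)" and sym: "\<And>v w. g z v w = g z w v" and pos: "\<And>v. v \<noteq> 0 \<Longrightarrow> g z v v > 0"
    using g z unfolding smooth_metric_def by blast+
  have "v \<noteq> 0" using uv(2) dependent_zero[of "{u, v}"] by auto
  then have v: "g z v v > 0" by (rule pos)
  let ?x = "g z v v *\<^sub>R u - g z u v *\<^sub>R v"
  have "?x \<noteq> 0"
  proof
    assume "?x = 0"
    then have "g z v v *\<^sub>R u = g z u v *\<^sub>R v" by simp
    then have "(1 / g z v v) *\<^sub>R (g z v v *\<^sub>R u) = (1 / g z v v) *\<^sub>R (g z u v *\<^sub>R v)" by (rule arg_cong)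
    then have "u = (g z u v / g z v v) *\<^sub>R v" using v by simp
    then have "u \<in> span {v}" unfolding span_singleton by (rule range_eqI)
    then show False using uv by (simp add: independent_insert)
  qed
  then have pos_x: "g z ?x ?x > 0" by (rule pos)
  have lin': "linear (\<lambda>w. g z w x)" for x
  proof -
    have "(\<lambda>w. g z w x) = g z x" by (rule ext) (rule sym)
    then show ?thesis using lin by simp
  qed
  have "g z ?x ?x = g z v v * (g z u u * g z v v - (g z u v)\<^sup>2)"
    by (simp add: linear_diff[OF lin] linear_scale[OF lin] linear_diff[OF lin'] linear_scale[OF lin'] sym[of v u]
        power2_eq_square algebra_simps)
  then show ?thesis using v pos_x by (simp add: zero_less_mult_iff)
qed

text \<open>Needed to pass from the dense set on which frames with constant angles exist to all points.\<close>

lemma continuous_on_sectional_curvature: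
  assumes g: "smooth_metric D g" and uv: "u \<noteq> v" "independent {u, v}"
  shows "continuous_on D (\<lambda>z. sectional_curvature D g z u v)"
proof -
  have c: "continuous_on D (\<lambda>z. g z (X z) (Y z))" if "smooth_on D X" "smooth_on D Y" for X Y
    by (rule smooth_on_continuous[OF smooth_on_metric[OF g that]])
  show ?thesis
    unfolding sectional_curvature_def
    using gram_positive[OF g _ uv]
    by (intro continuous_intros c smooth_on_curvature[OF g] smooth_on_const) fastforce
qed

section \<open>Coframes with constant structure\<close>

text \<open>The equation for \<open>de\<close> says that the bracket of fields, read through \<open>e\<close>, is
\<open>D\<^sub>X Y - D\<^sub>Y X + c X \<times> Y\<close>, and the cross product is skew for the inner product.\<close>

lemma levi_civita_coframe:
  fixes e :: "real^3 \<Rightarrow> real^3 \<Rightarrow> real^3"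
  assumes e: "smooth_tensor U e" and z: "z \<in> U" and inj: "inj (\<lambda>w. e w z)"
    and g: "\<And>y v w. y \<in> U \<Longrightarrow> g y v w = e v y \<bullet> e w y"
    and de: "\<And>v w. dd (e w) v z - dd (e v) w z = - c *\<^sub>R (e v z \<times> e w z)"
    and X: "X differentiable (at z)" and Y: "Y differentiable (at z)"
  shows "e (levi_civita D (\<lambda>_. UNIV) g X Y z) z = dd (\<lambda>y. e (Y y) y) (X z) z + (c/2) *\<^sub>R (e (X z) z \<times> e (Y z) z)"
proof -
  have U: "open U" and lin: "linear (\<lambda>w. e w z)" using e z by (auto simp: smooth_tensor_def)
  have surj: "surj (\<lambda>w. e w z)" using lin inj by (simp add: linear_injective_imp_surjective)
  have bij: "bij_betw (\<lambda>w. e w z) UNIV UNIV" using inj surj by (simp add: bij_betw_def)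
  have near: "Z differentiable (at z)" if "vector_field_near D (\<lambda>_. UNIV) z Z" for Z
    using that unfolding vector_field_near_def by (blast intro: smooth_on_differentiable)
  have ext: "\<exists>Z. vector_field_near D (\<lambda>_. UNIV) z Z \<and> e (Z z) z = b" for b
  proof -
    obtain w where "b = e w z" using surj by (rule surjE)
    moreover have "vector_field_near D (\<lambda>_. UNIV) z (\<lambda>_. w)"
      unfolding vector_field_near_def by (rule exI[of _ UNIV]) (simp add: smooth_on_const)
    ultimately show ?thesis by blast
  qed
  have d: "(\<lambda>y. e (X y) y) differentiable (at z)" if "X differentiable (at z)" for X
    using tensor_has_derivative[OF e z that] unfolding differentiable_def by blast
  have dv: "dd (\<lambda>y. e (X y) y) v z = e (dd X v z) z + dd (e (X z)) v z" if "X differentiable (at z)" for X v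
    by (rule dd_eqI[OF tensor_has_derivative[OF e z that]])
  have Fg: "dd (\<lambda>y. g y (Y y) (Z y)) (X z) z = dd (\<lambda>y. e (Y y) y \<bullet> e (Z y) y) (X z) z" for X Y Z
    by (rule dd_cong[OF U z]) (rule g)
  have FB: "e (lie_bracket X Y z) z = dd (\<lambda>y. e (Y y) y) (X z) z - dd (\<lambda>y. e (X y) y) (Y z) z
      + c *\<^sub>R (e (X z) z \<times> e (Y z) z)" if "X differentiable (at z)" "Y differentiable (at z)" for X Y
    unfolding dv[OF that(1)] dv[OF that(2)] lie_bracket_def deriv_along_def linear_diff[OF lin]
    using de[of "Y z" "X z"] by (simp add: algebra_simps)
  have Q: "2 * (((c/2) *\<^sub>R (a \<times> b)) \<bullet> w) = (c *\<^sub>R (a \<times> b)) \<bullet> w - (c *\<^sub>R (a \<times> w)) \<bullet> b - (c *\<^sub>R (b \<times> w)) \<bullet> a" for a b w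
    by (simp add: cross3_simps add_divide_distrib diff_divide_distrib)
  note * = levi_civita_trivialized[where N = D and T = "\<lambda>_. UNIV" and g = g and z = z
      and F = "\<lambda>X. X differentiable (at z)" and L = "\<lambda>y w. e w y" and G = "(\<bullet>)" and B = "\<lambda>a b. c *\<^sub>R (a \<times> b)"
      and Q = "\<lambda>a b. (c/2) *\<^sub>R (a \<times> b)" and X = X and Y = Y]
  show ?thesis
    by (rule *(2)[OF bounded_bilinear_inner inner_commute inner_gt_zero_iff[THEN iffD2] Q])
      (assumption | rule near ext lin bij g[OF z] UNIV_I d Fg FB X Y)+
qed

text \<open>Read through \<open>e\<close>, the covariant derivative is \<open>D\<^sub>X + m X \<times>\<close> with \<open>m = c/2\<close>. Its curvature has a
part \<open>- 2 m\<^sup>2\<close> from \<open>de\<close> and a part \<open>m\<^sup>2\<close> from the Jacobi identity, which leaves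
\<open>R(X, Y) = - m\<^sup>2 (X \<times> Y) \<times>\<close>.\<close>

theorem sectional_curvature_coframe:
  assumes gD: "smooth_metric D g" and e: "smooth_tensor U e" and z: "z \<in> U" and UD: "U \<subseteq> D"
    and g: "\<And>y v w. y \<in> U \<Longrightarrow> g y v w = e v y \<bullet> e w y"
    and de: "\<And>y v w. y \<in> U \<Longrightarrow> dd (e w) v y - dd (e v) w y = - c *\<^sub>R (e v y \<times> e w y)"
    and uv: "u \<noteq> v" "independent {u, v}"
  shows "sectional_curvature D g z u v = c\<^sup>2 / 4"
proof -
  have U: "open U" and lin: "\<And>y. y \<in> U \<Longrightarrow> linear (\<lambda>w. e w y)" and sm: "\<And>w. smooth_on U (e w)"
    using e by (auto simp: smooth_tensor_def)
  have inj: "inj (\<lambda>w. e w y)" if "y \<in> U" for y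
  proof (rule linear_injective_0[OF lin[OF that], THEN iffD2], intro allI impI)
    fix w assume "e w y = 0"
    then have "g y w w = 0" by (simp add: g that)
    then show "w = 0" using gD that UD unfolding smooth_metric_def by (metis less_irrefl subsetD)
  qed
  define m where "m = c / 2"
  let ?LC = "levi_civita D (\<lambda>_. UNIV) g"
  have LC: "e (?LC X Y y) y = dd (\<lambda>y. e (Y y) y) (X y) y + m *\<^sub>R (e (X y) y \<times> e (Y y) y)"
    if "y \<in> U" "X differentiable (at y)" "Y differentiable (at y)" for X Y y
    unfolding m_def by (rule levi_civita_coframe[OF e that(1) inj[OF that(1)] g de[OF that(1)] that(2,3)])
  have c: "(\<lambda>_. w) differentiable (at y)" for w y :: "real^3" by simp
  let ?W1 = "?LC (\<lambda>_. v) (\<lambda>_. v)" and ?W2 = "?LC (\<lambda>_. u) (\<lambda>_. v)"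
  have e1: "e (?W1 y) y = dd (e v) v y" if "y \<in> U" for y
    unfolding LC[OF that c c] by simp
  have e2: "e (?W2 y) y = dd (e v) u y + m *\<^sub>R (e u y \<times> e v y)" if "y \<in> U" for y
    unfolding LC[OF that c c] by simp
  have W: "?W1 differentiable (at z)" "?W2 differentiable (at z)"
    using levi_civita_smooth(1)[OF gD smooth_on_const smooth_on_const] z UD
    by (auto intro: smooth_on_differentiable)
  have dW1: "dd (\<lambda>y. e (?W1 y) y) u z = dd (dd (e v) v) u z"
    by (rule dd_cong[OF U z e1])
  have de': "(e w has_derivative (\<lambda>x. dd (e w) x z)) (at z)" "(dd (e w) a has_derivative (\<lambda>x. dd (dd (e w) a) x z)) (at z)" for w a
    by (auto intro: smooth_on_has_derivative smooth_on_dd sm z)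
  have "dd (\<lambda>y. e (?W2 y) y) v z = dd (\<lambda>y. dd (e v) u y + m *\<^sub>R (e u y \<times> e v y)) v z"
    by (rule dd_cong[OF U z e2])
  also have "\<dots> = dd (dd (e v) u) v z + m *\<^sub>R (e u z \<times> dd (e v) v z + dd (e u) v z \<times> e v z)"
    by (rule dd_eqI) (intro has_derivative_add has_derivative_scaleR_right
        bounded_bilinear.FDERIV[OF bounded_bilinear_cross3] de')
  finally have dW2: "dd (\<lambda>y. e (?W2 y) y) v z = \<dots>" .
  have lie: "lie_bracket (\<lambda>_. u) (\<lambda>_. v) = (\<lambda>_. 0)"
    by (rule ext) (simp add: lie_bracket_def deriv_along_def frechet_derivative_const)
  have e3: "e (?LC (\<lambda>_. 0) (\<lambda>_. v) z) z = 0"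
    unfolding LC[OF z c c] using linear_0[OF lin[OF z]] linear_0[OF dd_linear[OF smooth_on_differentiable[OF sm z]]] by simp
  have sym: "dd (dd (e v) v) u z = dd (dd (e v) u) v z" by (rule symmetric_dd[OF sm U z])
  have dec: "dd (e v) u z = dd (e u) v z - (2 * m) *\<^sub>R (e u z \<times> e v z)"
    using de[OF z, of v u] by (simp add: m_def algebra_simps)
  let ?R = "curvature D (\<lambda>_. UNIV) g (\<lambda>_. u) (\<lambda>_. v) (\<lambda>_. v) z"
  have "e ?R z = - m\<^sup>2 *\<^sub>R ((e u z \<times> e v z) \<times> e v z)"
    unfolding curvature_def lie linear_diff[OF lin[OF z]] e3 LC[OF z c W(1)] LC[OF z c W(2)] dW1 dW2
      e1[OF z] e2[OF z] sym dec
    by (simp add: cross3_simps power2_eq_square)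
  then have "g z ?R u = m\<^sup>2 * ((e u z \<times> e v z) \<bullet> (e u z \<times> e v z))"
    by (simp add: g z) (simp add: cross3_simps)
  moreover have "(e u z \<times> e v z) \<bullet> (e u z \<times> e v z) = g z u u * g z v v - (g z u v)\<^sup>2"
    by (simp add: g z) (simp add: cross3_simps power2_eq_square)
  ultimately show ?thesis
    using gram_positive[OF gD _ uv, of z] z UD by (auto simp: sectional_curvature_def m_def power_divide)
qed

section \<open>Algebra of the structure numbers\<close>

lemma sign_triple:
  fixes m1 m2 m3 :: real
  assumes "m1 * m2 = m3" "m2 * m3 = m1" "m3 * m1 = m2"
  shows "m1 = 0 \<and> m2 = 0 \<and> m3 = 0 \<or> (m1 = 1 \<or> m1 = -1) \<and> (m2 = 1 \<or> m2 = -1) \<and> (m3 = 1 \<or> m3 = -1)"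
proof (cases "m1 = 0")
  case True then show ?thesis using assms by auto
next
  case False
  then have "m2 \<noteq> 0" "m3 \<noteq> 0" using assms by auto
  have "m1 * (m2 * m2) = m1 * 1" "m2 * (m3 * m3) = m2 * 1" "m3 * (m1 * m1) = m3 * 1"
    using assms by (simp_all add: mult.assoc[symmetric]) (simp_all add: mult.commute)
  then have "m2 * m2 = 1" "m3 * m3 = 1" "m1 * m1 = 1"
    using False \<open>m2 \<noteq> 0\<close> \<open>m3 \<noteq> 0\<close> mult_left_cancel by blast+
  then show ?thesis by (simp add: square_eq_1_iff)
qed

text \<open>The case of the next lemma in which two connection numbers vanish. If the third does not, two of
the weight points lie on the coordinate axes and all structure numbers vanish. If it does, the
three ratios \<open>a\<^sub>i/b\<^sub>i\<close> would be pairwise negatives of each other, which is impossible.\<close>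

lemma two_translations_vanish:
  fixes a1 a2 a3 b1 b2 b3 c1 c2 c3 x3 :: real
  assumes d: "a1 * b2 \<noteq> a2 * b1" "a2 * b3 \<noteq> a3 * b2" "a1 * b3 \<noteq> a3 * b1"
    and a: "2 * a1 * a2 = a3 * c3" "a2 * x3 + 2 * a2 * a3 = a1 * c1" "a1 * x3 + 2 * a3 * a1 = a2 * c2"
    and b: "2 * b1 * b2 = b3 * c3" "b2 * x3 + 2 * b2 * b3 = b1 * c1" "b1 * x3 + 2 * b3 * b1 = b2 * c2"
    and x: "c3 * x3 = 0"
  shows "c1 = 0 \<and> c2 = 0 \<and> c3 = 0"
proof (cases "x3 = 0")
  case False
  then have c3: "c3 = 0" using x by simp
  then have "a1 = 0 \<or> a2 = 0" "b1 = 0 \<or> b2 = 0" using a b by auto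
  then consider "a1 = 0" "b2 = 0" | "a2 = 0" "b1 = 0" using d(1) by auto
  then show ?thesis
  proof cases
    case 1
    then have "b1 \<noteq> 0" "a2 \<noteq> 0" using d(1) by auto
    then show ?thesis using 1 a(3) b(2) c3 by simp
  next
    case 2
    then have "a1 \<noteq> 0" "b2 \<noteq> 0" using d(1) by auto
    then show ?thesis using 2 a(2) b(3) c3 by simp
  qed
next
  case True
  note a = a[unfolded True mult_zero_right add_0] and b = b[unfolded True mult_zero_right add_0]
  have nz: "a1 \<noteq> 0" "a2 \<noteq> 0" "a3 \<noteq> 0" "b1 \<noteq> 0" "b2 \<noteq> 0" "b3 \<noteq> 0"
    using a b d by auto
  have e: "a1 * a2 * b3 = b1 * b2 * a3" "a2 * a3 * b1 = b2 * b3 * a1" "a3 * a1 * b2 = b3 * b1 * a2"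
  proof -
    have "2 * (a1 * a2 * b3) = 2 * (b1 * b2 * a3)" using a(1) b(1) by algebra
    moreover have "2 * (a2 * a3 * b1) = 2 * (b2 * b3 * a1)" using a(2) b(2) by algebra
    moreover have "2 * (a3 * a1 * b2) = 2 * (b3 * b1 * a2)" using a(3) b(3) by algebra
    ultimately show "a1 * a2 * b3 = b1 * b2 * a3" "a2 * a3 * b1 = b2 * b3 * a1" "a3 * a1 * b2 = b3 * b1 * a2"
      by simp_all
  qed
  \<comment> \<open>multiply two of the relations \<open>e\<close> and cancel\<close>
  have sq: "(a1 * b3)\<^sup>2 * (a2 * b2) = (a3 * b1)\<^sup>2 * (a2 * b2)" "(a1 * b2)\<^sup>2 * (a3 * b3) = (a2 * b1)\<^sup>2 * (a3 * b3)"
    "(a2 * b3)\<^sup>2 * (a1 * b1) = (a3 * b2)\<^sup>2 * (a1 * b1)"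
    using e by algebra+
  then have "(a1 * b3)\<^sup>2 = (a3 * b1)\<^sup>2" "(a1 * b2)\<^sup>2 = (a2 * b1)\<^sup>2" "(a2 * b3)\<^sup>2 = (a3 * b2)\<^sup>2"
    using nz by simp_all
  then have "a1 * b3 = - (a3 * b1)" "a1 * b2 = - (a2 * b1)" "a2 * b3 = - (a3 * b2)"
    using d unfolding power2_eq_iff by blast+
  then have "2 * (a1 * b3) * (a2 * b2) = 0" by algebra
  then show ?thesis using nz by simp
qed

text \<open>Here \<open>x\<close> are the connection numbers, \<open>c\<close> the structure numbers. If no \<open>x\<^sub>i\<close> vanishes, the quadratic
equations give \<open>c\<^sub>i\<close> in terms of \<open>x\<close>, and the linear ones become
\<open>(1 + 2 A\<^sub>i) (1 + 2 A\<^sub>j) = 1 + 2 A\<^sub>k\<close> for \<open>A\<^sub>i = a\<^sub>i/x\<^sub>i\<close>, and likewise for \<open>B\<^sub>i = b\<^sub>i/x\<^sub>i\<close>. Since the weight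
points are pairwise independent, all \<open>A\<^sub>i\<close> and \<open>B\<^sub>i\<close> are then \<open>0\<close> or \<open>-1\<close>, so the normalisation of
the weights gives \<open>x\<^sub>i\<^sup>2 = 3/4\<close>.\<close>

lemma constant_angle_structure:
  fixes a1 a2 a3 b1 b2 b3 c1 c2 c3 x1 x2 x3 :: real
  assumes d: "a1 * b2 \<noteq> a2 * b1" "a2 * b3 \<noteq> a3 * b2" "a1 * b3 \<noteq> a3 * b1"
    and n: "a1\<^sup>2 + b1\<^sup>2 - a1 * b1 = 3/4" "a2\<^sup>2 + b2\<^sup>2 - a2 * b2 = 3/4" "a3\<^sup>2 + b3\<^sup>2 - a3 * b3 = 3/4"
    and a: "a2 * x1 + a1 * x2 + 2 * a1 * a2 = a3 * c3" "a3 * x2 + a2 * x3 + 2 * a2 * a3 = a1 * c1"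
      "a1 * x3 + a3 * x1 + 2 * a3 * a1 = a2 * c2"
    and b: "b2 * x1 + b1 * x2 + 2 * b1 * b2 = b3 * c3" "b3 * x2 + b2 * x3 + 2 * b2 * b3 = b1 * c1"
      "b1 * x3 + b3 * x1 + 2 * b3 * b1 = b2 * c2"
    and x: "c3 * x3 = x1 * x2" "c1 * x1 = x2 * x3" "c2 * x2 = x3 * x1"
  shows "c1 = c3 \<and> c2 = c3 \<and> (c3\<^sup>2 = 0 \<or> c3\<^sup>2 = 3/4)"
proof (cases "x1 = 0 \<or> x2 = 0 \<or> x3 = 0")
  case True
  then consider "x1 = 0" "x2 = 0" | "x2 = 0" "x3 = 0" | "x3 = 0" "x1 = 0" using x by auto
  then have "c1 = 0 \<and> c2 = 0 \<and> c3 = 0"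
  proof cases
    case 1
    show ?thesis by (rule two_translations_vanish[of a1 b2 a2 b1 b3 a3 c3 x3]) (use d a b x 1 in auto)
  next
    case 2
    have "c2 = 0 \<and> c3 = 0 \<and> c1 = 0"
      by (rule two_translations_vanish[of a2 b3 a3 b2 b1 a1 c1 x1]) (use d a b x 2 in auto)
    then show ?thesis by simp
  next
    case 3
    have "c3 = 0 \<and> c1 = 0 \<and> c2 = 0"
      by (rule two_translations_vanish[of a3 b1 a1 b3 b2 a2 c2 x2]) (use d a b x 3 in auto)
    then show ?thesis by simp
  qed
  then show ?thesis by simp
next
  case False
  then have nz: "x1 \<noteq> 0" "x2 \<noteq> 0" "x3 \<noteq> 0" by auto
  have c: "c3 = x1 * x2 / x3" "c1 = x2 * x3 / x1" "c2 = x3 * x1 / x2"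
    using x nz by (simp_all add: field_simps)
  have m: "(1 + 2 * (p / x1)) * (1 + 2 * (q / x2)) = 1 + 2 * (r / x3)"
    if "q * x1 + p * x2 + 2 * p * q = r * (x1 * x2 / x3)" "x1 \<noteq> 0" "x2 \<noteq> 0" "x3 \<noteq> 0" for p q r x1 x2 x3 :: real
  proof -
    have "(1 + 2 * (p / x1)) * (1 + 2 * (q / x2)) = 1 + 2 * (q * x1 + p * x2 + 2 * p * q) / (x1 * x2)"
      using that(2-4) by (simp add: field_simps)
    also have "\<dots> = 1 + 2 * (r / x3)" unfolding that(1) using that(2-4) by simp
    finally show ?thesis .
  qed
  define A1 A2 A3 B1 B2 B3 where "A1 = a1 / x1" "A2 = a2 / x2" "A3 = a3 / x3" "B1 = b1 / x1" "B2 = b2 / x2" "B3 = b3 / x3"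
  note AB = this
  have vals: "p1 / x1 = -1/2 \<and> p2 / x2 = -1/2 \<and> p3 / x3 = -1/2 \<or>
      (p1 / x1 = 0 \<or> p1 / x1 = -1) \<and> (p2 / x2 = 0 \<or> p2 / x2 = -1) \<and> (p3 / x3 = 0 \<or> p3 / x3 = -1)"
    if "p2 * x1 + p1 * x2 + 2 * p1 * p2 = p3 * c3" "p3 * x2 + p2 * x3 + 2 * p2 * p3 = p1 * c1"
      "p1 * x3 + p3 * x1 + 2 * p3 * p1 = p2 * c2" for p1 p2 p3
    using sign_triple[OF m[OF that(1)[unfolded c] nz] m[OF that(2)[unfolded c] nz(2,3,1)]
        m[OF that(3)[unfolded c] nz(3,1,2)]] by auto
  note A = vals[OF a, folded AB] and B = vals[OF b, folded AB]
  have ab: "a1 = x1 * A1" "a2 = x2 * A2" "a3 = x3 * A3" "b1 = x1 * B1" "b2 = x2 * B2" "b3 = x3 * B3"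
    using nz by (simp_all add: AB)
  have D: "A1 * B2 \<noteq> A2 * B1" "A2 * B3 \<noteq> A3 * B2" "A1 * B3 \<noteq> A3 * B1"
    using d unfolding ab by (auto simp: mult_ac)
  have "A1\<^sup>2 + B1\<^sup>2 - A1 * B1 = 1 \<and> A2\<^sup>2 + B2\<^sup>2 - A2 * B2 = 1 \<and> A3\<^sup>2 + B3\<^sup>2 - A3 * B3 = 1"
    using A B D by (elim disjE conjE) simp_all
  moreover have "a1\<^sup>2 + b1\<^sup>2 - a1 * b1 = x1\<^sup>2 * (A1\<^sup>2 + B1\<^sup>2 - A1 * B1)"
    "a2\<^sup>2 + b2\<^sup>2 - a2 * b2 = x2\<^sup>2 * (A2\<^sup>2 + B2\<^sup>2 - A2 * B2)"
    "a3\<^sup>2 + b3\<^sup>2 - a3 * b3 = x3\<^sup>2 * (A3\<^sup>2 + B3\<^sup>2 - A3 * B3)"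
    unfolding ab by algebra+
  ultimately have x2: "x1\<^sup>2 = 3/4" "x2\<^sup>2 = 3/4" "x3\<^sup>2 = 3/4" using n by simp_all
  have "c1 = c3" "c2 = c3"
    unfolding c using nz x2 by (simp_all add: divide_simps) (simp_all add: power2_eq_square[symmetric] mult.assoc mult.left_commute mult.commute)
  moreover have "c3\<^sup>2 = 3/4" unfolding c by (simp add: power_divide power_mult_distrib x2)
  ultimately show ?thesis by simp
qed

text \<open>The data of a frame with constant angles at one point: the weights \<open>a\<close>, \<open>b\<close>, the connection numbers
\<open>\<Gamma> i j k = \<langle>D\<^sub>i v\<^sub>j, v\<^sub>k\<rangle>\<close>, the structure numbers \<open>C\<close> with \<open>[E\<^sub>i, E\<^sub>j] = \<Sum> C i j k E\<^sub>k\<close>, and the triple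
products \<open>T\<close> of \<open>v\<close>. The last two assumptions are the two halves of the Maurer-Cartan equation.\<close>

locale structure_numbers =
  fixes a b :: "3 \<Rightarrow> real" and \<Gamma> C T :: "3 \<Rightarrow> 3 \<Rightarrow> 3 \<Rightarrow> real"
  assumes \<Gamma>_skew: "\<Gamma> i j k = - \<Gamma> i k j"
    and T_skew: "T i j k = - T j i k" "T i j k = - T i k j"
    and T_unit: "(T 1 2 3)\<^sup>2 = 1"
    and mc_a: "a j * \<Gamma> i j k - a i * \<Gamma> j i k + 2 * a i * a j * T i j k = a k * C i j k"
    and mc_b: "b j * \<Gamma> i j k - b i * \<Gamma> j i k + 2 * b i * b j * T i j k = b k * C i j k"
begin

text \<open>Up to the factor \<open>2 / sqrt 3\<close>, this is the inner product of \<open>J E\<^sub>k\<close> with the covariant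
derivative of \<open>E\<^sub>j\<close> along \<open>E\<^sub>i\<close>.\<close>

definition sff :: "3 \<Rightarrow> 3 \<Rightarrow> 3 \<Rightarrow> real" where
  "sff i j k = \<Gamma> i j k * (a j * b k - b j * a k)
     + T i j k * (a i * a j * b k - b i * b j * a k + (b i * a j - a i * b j) * (a k + b k) / 3)"

text \<open>A symmetric cubic expression, proportional to the sine of the sum of the angles.\<close>

definition defect :: "3 \<Rightarrow> 3 \<Rightarrow> 3 \<Rightarrow> real" where
  "defect i j k = a i * a j * b k + a i * b j * a k + b i * a j * a k - b i * b j * a k - b i * a j * b k - a i * b j * b k"

lemma \<Gamma>_diag: "\<Gamma> i j j = 0" using \<Gamma>_skew[of i j j] by simp
lemma T_diag: "T i i k = 0" "T i j j = 0" using T_skew(1)[of i i k] T_skew(2)[of i j j] by simp_all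
lemma T_diag': "T i j i = 0" using T_skew(1)[of i j i] T_diag(2) by simp

lemma T_cyclic: "T 2 3 1 = T 1 2 3" "T 3 1 2 = T 1 2 3"
  using T_skew(1)[of 2 3 1] T_skew(2)[of 3 2 1] T_skew(1)[of 3 1 2] T_skew(2)[of 1 3 2] by auto

text \<open>Eliminates the structure number from the two halves of the Maurer-Cartan equation.\<close>

lemma mc_ab: "\<Gamma> i j k * (a j * b k - b j * a k) - \<Gamma> j i k * (a i * b k - b i * a k)
    + 2 * T i j k * (a i * a j * b k - b i * b j * a k) = 0"
  using mc_a[of j i k] mc_b[of j i k] by algebra

text \<open>In the sum of the three cyclic instances of \<open>mc_ab\<close> every connection number occurs twice, with
opposite signs.\<close>

lemma defect_zero: "defect 1 2 3 = 0"
proof -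
  have "2 * T 1 2 3 * defect 1 2 3 = 0"
    using mc_ab[of 1 2 3] mc_ab[of 2 3 1] mc_ab[of 3 1 2] \<Gamma>_skew[of 2 1 3] \<Gamma>_skew[of 3 2 1] \<Gamma>_skew[of 1 3 2] T_cyclic
    unfolding defect_def by algebra
  then show ?thesis using T_unit by auto
qed

lemma T_defect: "T i j k * defect i j k = 0"
proof -
  have "defect p q r = defect q p r" "defect p q r = defect p r q" for p q r unfolding defect_def by algebra+
  then have "defect 1 3 2 = 0" "defect 2 1 3 = 0" "defect 2 3 1 = 0" "defect 3 1 2 = 0" "defect 3 2 1 = 0" using defect_zero by metis+
  with defect_zero show ?thesis
    using exhaust_3[of i] exhaust_3[of j] exhaust_3[of k] by (elim disjE) (simp_all add: T_diag T_diag')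
qed

text \<open>Symmetry in the first two indices is torsion-freeness; symmetry in the last two expresses that
the covariant derivative of \<open>J\<close> does not contribute, which is the vanishing of \<open>defect\<close>.\<close>

lemma sff_symmetric: "sff i j k = sff j i k" "sff i j k = sff i k j"
proof -
  show "sff i j k = sff j i k" using mc_ab[of i j k] T_skew(1)[of i j k] unfolding sff_def by algebra
  show "sff i j k = sff i k j" using T_defect[of i j k] T_skew(2)[of i j k] \<Gamma>_skew[of i j k] unfolding sff_def defect_def by algebra
qed

lemma sff_diag: "sff i j j = 0" by (simp add: sff_def \<Gamma>_diag T_diag)

text \<open>Components with a repeated index vanish by symmetry, because \<open>\<Gamma>\<close> and \<open>T\<close> are skew in the last two
indices. The remaining one can be computed with the proportional pair in the last two places,
where \<open>\<Gamma>\<close> drops out and the rest is a multiple of \<open>defect\<close>.\<close>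

lemma sff_zero:
  assumes "p \<noteq> q" "a p * b q = b p * a q"
  shows "sff i j k = 0"
proof -
  have z: "sff r p q = 0" for r
    using T_defect[of r p q] assms(2) unfolding sff_def defect_def by algebra
  have perm: "sff 1 3 2 = sff 1 2 3" "sff 2 1 3 = sff 1 2 3" "sff 2 3 1 = sff 1 2 3" "sff 3 1 2 = sff 1 2 3" "sff 3 2 1 = sff 1 2 3"
    using sff_symmetric(1)[of 1 2 3] sff_symmetric(2)[of 1 2 3] sff_symmetric(1)[of 1 3 2] sff_symmetric(2)[of 2 1 3]
      sff_symmetric(1)[of 2 3 1] by linarith+
  have "sff 1 2 3 = 0"
    using exhaust_3[of p] exhaust_3[of q] assms(1) z[of 1] z[of 2] z[of 3]
    by (elim disjE) (simp_all add: perm)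
  moreover have "sff i j i = 0" "sff i i j = 0" for i j
    using sff_diag[of j i] sff_symmetric(1)[of j i i] sff_symmetric(2)[of i j i] by linarith+
  ultimately show ?thesis
    using exhaust_3[of i] exhaust_3[of j] exhaust_3[of k] by (elim disjE) (simp_all add: sff_diag perm)
qed

lemma diagonal_zero:
  assumes "i \<noteq> j" "a i * b j \<noteq> b i * a j"
  shows "\<Gamma> j i j = 0" "C i j j = 0"
proof -
  have "a i * \<Gamma> j i j + a j * C i j j = 0" "b i * \<Gamma> j i j + b j * C i j j = 0"
    using mc_a[of j i j] mc_b[of j i j] by (simp_all add: \<Gamma>_diag T_diag)
  then have "\<Gamma> j i j * (a i * b j - b i * a j) = 0" "C i j j * (a i * b j - b i * a j) = 0" by algebra+
  then show "\<Gamma> j i j = 0" "C i j j = 0" using assms by auto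
qed

lemma structure_constant:
  assumes d: "\<And>i j. i \<noteq> j \<Longrightarrow> a i * b j \<noteq> b i * a j"
    and n: "\<And>i. (a i)\<^sup>2 + (b i)\<^sup>2 - a i * b i = 3/4"
    and f: "\<Gamma> 3 1 2 * C 1 2 3 = \<Gamma> 1 2 3 * \<Gamma> 2 3 1" "\<Gamma> 1 2 3 * C 2 3 1 = \<Gamma> 2 3 1 * \<Gamma> 3 1 2"
      "\<Gamma> 2 3 1 * C 3 1 2 = \<Gamma> 3 1 2 * \<Gamma> 1 2 3"
  shows "C 2 3 1 = C 1 2 3" "C 3 1 2 = C 1 2 3" "(C 1 2 3)\<^sup>2 = 0 \<or> (C 1 2 3)\<^sup>2 = 3/4"
proof -
  \<comment> \<open>the orientation of \<open>v\<close> can be absorbed into the signs of the weights\<close>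
  define s where "s = T 1 2 3"
  have ss: "s * s = 1" using T_unit by (simp add: s_def power2_eq_square)
  have T: "T 1 2 3 = s" "T 2 3 1 = s" "T 3 1 2 = s" by (simp_all add: s_def T_cyclic)
  have "C 2 3 1 = C 1 2 3 \<and> C 3 1 2 = C 1 2 3 \<and> ((C 1 2 3)\<^sup>2 = 0 \<or> (C 1 2 3)\<^sup>2 = 3/4)"
  proof (rule constant_angle_structure[of "s * a 1" "s * b 2" "s * a 2" "s * b 1" "s * b 3" "s * a 3"
        "\<Gamma> 1 2 3" "\<Gamma> 2 3 1" "C 1 2 3" "\<Gamma> 3 1 2" "C 2 3 1" "C 3 1 2"])
    have "s * p * (s * q) = p * q" for p q using ss by algebra
    then show "s * a 1 * (s * b 2) \<noteq> s * a 2 * (s * b 1)" "s * a 2 * (s * b 3) \<noteq> s * a 3 * (s * b 2)"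
      "s * a 1 * (s * b 3) \<noteq> s * a 3 * (s * b 1)"
      using d[of 1 2] d[of 2 3] d[of 1 3] by (simp_all only: mult.commute[of "b _" "a _"]) auto
    have "(s * a i)\<^sup>2 + (s * b i)\<^sup>2 - s * a i * (s * b i) = 3/4" for i
      using n[of i] ss by algebra
    then show "(s * a 1)\<^sup>2 + (s * b 1)\<^sup>2 - s * a 1 * (s * b 1) = 3/4" "(s * a 2)\<^sup>2 + (s * b 2)\<^sup>2 - s * a 2 * (s * b 2) = 3/4"
      "(s * a 3)\<^sup>2 + (s * b 3)\<^sup>2 - s * a 3 * (s * b 3) = 3/4" by blast+
    show "s * a 2 * \<Gamma> 1 2 3 + s * a 1 * \<Gamma> 2 3 1 + 2 * (s * a 1) * (s * a 2) = s * a 3 * C 1 2 3"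
      using mc_a[of 2 1 3] \<Gamma>_skew[of 2 1 3] T ss by algebra
    show "s * a 3 * \<Gamma> 2 3 1 + s * a 2 * \<Gamma> 3 1 2 + 2 * (s * a 2) * (s * a 3) = s * a 1 * C 2 3 1"
      using mc_a[of 3 2 1] \<Gamma>_skew[of 3 2 1] T ss by algebra
    show "s * a 1 * \<Gamma> 3 1 2 + s * a 3 * \<Gamma> 1 2 3 + 2 * (s * a 3) * (s * a 1) = s * a 2 * C 3 1 2"
      using mc_a[of 1 3 2] \<Gamma>_skew[of 1 3 2] T ss by algebra
    show "s * b 2 * \<Gamma> 1 2 3 + s * b 1 * \<Gamma> 2 3 1 + 2 * (s * b 1) * (s * b 2) = s * b 3 * C 1 2 3"
      using mc_b[of 2 1 3] \<Gamma>_skew[of 2 1 3] T ss by algebra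
    show "s * b 3 * \<Gamma> 2 3 1 + s * b 2 * \<Gamma> 3 1 2 + 2 * (s * b 2) * (s * b 3) = s * b 1 * C 2 3 1"
      using mc_b[of 3 2 1] \<Gamma>_skew[of 3 2 1] T ss by algebra
    show "s * b 1 * \<Gamma> 3 1 2 + s * b 3 * \<Gamma> 1 2 3 + 2 * (s * b 3) * (s * b 1) = s * b 2 * C 3 1 2"
      using mc_b[of 1 3 2] \<Gamma>_skew[of 1 3 2] T ss by algebra
  qed (use f in \<open>simp_all add: mult.commute\<close>)
  then show "C 2 3 1 = C 1 2 3" "C 3 1 2 = C 1 2 3" "(C 1 2 3)\<^sup>2 = 0 \<or> (C 1 2 3)\<^sup>2 = 3/4" by blast+
qed

end

section \<open>Lagrangian patches\<close>

lemma qconj_mul_real: "(qconj p \<odot> x) $ 1 = p \<bullet> x"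
  by (simp add: inner_4)

locale lagrangian_patch =
  fixes D :: "(real^3) set" and F :: "real^3 \<Rightarrow> quat \<times> quat"
  assumes D: "open D" and smooth_F: "smooth_on D F"
    and F_S3S3: "\<And>u. u \<in> D \<Longrightarrow> F u \<in> S3S3"
    and inj_dF: "\<And>u. u \<in> D \<Longrightarrow> inj (\<lambda>w. dd F w u)"
    and lagr: "\<And>u v w. u \<in> D \<Longrightarrow> nk_metric (F u) (nk_J (F u) (dd F v u)) (dd F w u) = 0"
begin

definition \<omega> :: "real^3 \<Rightarrow> real^3 \<Rightarrow> r33" where
  "\<omega> w u = triv (F u) (dd F w u)"

lemma smooth_\<omega>: "smooth_tensor D \<omega>"
proof -
  interpret t: bounded_bilinear triv by (rule bounded_bilinear_triv)
  have "smooth_on D (\<omega> w)" for w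
    unfolding \<omega>_def[abs_def] by (intro smooth_on_bilinear[OF bounded_bilinear_triv] smooth_F smooth_on_dd D)
  moreover have "linear (\<lambda>w. \<omega> w u)" if "u \<in> D" for u
    unfolding \<omega>_def
    using linear_compose[OF dd_linear[OF smooth_on_differentiable[OF smooth_F that]]
        bounded_linear.linear[OF t.bounded_linear_right[of "F u"]]] by (simp add: o_def)
  ultimately show ?thesis by (simp add: smooth_tensor_def D)
qed

lemma dF_eq:
  assumes u: "u \<in> D" shows "dd F w u = untriv (F u) (\<omega> w u)"
proof -
  have dF: "(F has_derivative (\<lambda>w. dd F w u)) (at u)" by (rule smooth_on_has_derivative[OF smooth_F u])
  have perp: "h (F u) \<bullet> h (dd F w u) = 0"
    if h: "bounded_linear h" "\<And>y. y \<in> D \<Longrightarrow> h (F y) \<bullet> h (F y) = 1" for h :: "quat \<times> quat \<Rightarrow> quat"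
  proof -
    have dh: "((\<lambda>y. h (F y)) has_derivative (\<lambda>w. h (dd F w u))) (at u)"
      by (rule bounded_linear.has_derivative[OF h(1) dF])
    have "((\<lambda>y. h (F y) \<bullet> h (F y)) has_derivative (\<lambda>w. h (F u) \<bullet> h (dd F w u) + h (dd F w u) \<bullet> h (F u))) (at u)"
      by (rule has_derivative_inner[OF dh dh])
    moreover have "((\<lambda>y. h (F y) \<bullet> h (F y)) has_derivative (\<lambda>w. 0)) (at u)"
      by (rule has_derivative_transform_within_open[OF has_derivative_const[of 1] D u]) (simp add: h)
    ultimately have "(\<lambda>w. h (F u) \<bullet> h (dd F w u) + h (dd F w u) \<bullet> h (F u)) = (\<lambda>w. 0)"
      by (rule has_derivative_unique)
    then have "h (F u) \<bullet> h (dd F w u) + h (dd F w u) \<bullet> h (F u) = 0" by meson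
    then show ?thesis by (simp add: inner_commute)
  qed
  have n: "fst (F y) \<bullet> fst (F y) = 1" "snd (F y) \<bullet> snd (F y) = 1" if "y \<in> D" for y
    using F_S3S3[OF that] by (auto simp: S3S3_def norm_eq_1)
  have "fst (F u) \<bullet> fst (dd F w u) = 0" "snd (F u) \<bullet> snd (dd F w u) = 0"
    by (rule perp[OF bounded_linear_fst n(1)], simp, rule perp[OF bounded_linear_snd n(2)], simp)
  moreover have "imq (imv (qconj p \<odot> x)) = qconj p \<odot> x" if "p \<bullet> x = 0" for p x :: quat
    by (rule imq_imv) (simp only: qconj_mul_real that)
  ultimately show ?thesis
    using F_S3S3[OF u] by (auto simp: \<omega>_def triv_def untriv_def qmul_cancel S3S3_def prod_eq_iff)
qed

text \<open>The symmetry of the second derivatives of \<open>F\<close>, left-translated.\<close>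

lemma maurer_cartan:
  assumes u: "u \<in> D"
  shows "dd (\<omega> w) v u - dd (\<omega> v) w u + bracket (\<omega> v u) (\<omega> w u) = 0"
proof -
  interpret t: bounded_bilinear untriv by (rule bounded_bilinear_untriv)
  have d: "dd (dd F w) v u = untriv (F u) (dd (\<omega> w) v u) + untriv (untriv (F u) (\<omega> v u)) (\<omega> w u)" for v w
  proof -
    have "\<omega> w differentiable (at u)"
      using smooth_\<omega> u by (auto simp: smooth_tensor_def intro: smooth_on_differentiable)
    then have "dd (\<lambda>y. untriv (F y) (\<omega> w y)) v u = untriv (F u) (dd (\<omega> w) v u) + untriv (dd F v u) (\<omega> w u)"
      by (rule dd_bilinear[OF bounded_bilinear_untriv smooth_on_differentiable[OF smooth_F u]])
    moreover have "dd (dd F w) v u = dd (\<lambda>y. untriv (F y) (\<omega> w y)) v u"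
      by (rule dd_cong[OF D u]) (rule dF_eq)
    ultimately show ?thesis by (simp add: dF_eq[OF u])
  qed
  have "untriv (F u) (dd (\<omega> w) v u - dd (\<omega> v) w u + bracket (\<omega> v u) (\<omega> w u)) = dd (dd F w) v u - dd (dd F v) w u"
    unfolding d by (simp add: t.add_right t.diff_right flip: untriv_untriv_antisym)
  also have "\<dots> = 0" using symmetric_dd[OF smooth_F D u] by simp
  finally have "triv (F u) (untriv (F u) (dd (\<omega> w) v u - dd (\<omega> v) w u + bracket (\<omega> v u) (\<omega> w u))) = triv (F u) 0"
    by simp
  then show ?thesis
    by (simp add: triv_untriv F_S3S3 u bounded_bilinear.zero_right[OF bounded_bilinear_triv])
qed

lemma induced_metric_eq: "u \<in> D \<Longrightarrow> induced_metric F u v w = nkG (\<omega> v u) (\<omega> w u)"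
  by (simp add: induced_metric_def differential_def dF_eq nk_metric_untriv F_S3S3)

lemma lagrangian_\<omega>: "u \<in> D \<Longrightarrow> nkG (nkj (\<omega> v u)) (\<omega> w u) = 0"
  using lagr[of u v w] by (simp add: dF_eq nk_metric_untriv nk_J_untriv F_S3S3)

lemma inj_\<omega>: assumes u: "u \<in> D" shows "inj (\<lambda>w. \<omega> w u)"
  using inj_dF[OF u] unfolding inj_on_def dF_eq[OF u] by metis

lemma smooth_metric_induced: "smooth_metric D (induced_metric F)"
proof -
  interpret nkG: bounded_bilinear nkG by (rule bounded_bilinear_nkG)
  have sm: "smooth_on D (\<omega> w)" for w using smooth_\<omega> by (simp add: smooth_tensor_def)
  have lin: "linear (\<lambda>w. \<omega> w u)" if "u \<in> D" for u using smooth_\<omega> that by (simp add: smooth_tensor_def)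
  have "smooth_on D (\<lambda>y. induced_metric F y v w)" for v w
    by (rule smooth_on_cong[OF smooth_on_bilinear[OF bounded_bilinear_nkG sm sm D] D]) (simp add: induced_metric_eq)
  moreover have "linear (induced_metric F u v)" if "u \<in> D" for u v
    using linear_compose[OF lin[OF that] bounded_linear.linear[OF nkG.bounded_linear_right]]
    by (simp add: o_def induced_metric_eq[OF that, abs_def])
  moreover have "induced_metric F u v v > 0" if "u \<in> D" "v \<noteq> 0" for u v
  proof -
    have "\<omega> v u \<noteq> 0"
      using inj_\<omega>[OF that(1)] that(2) linear_0[OF lin[OF that(1)]] by (metis injD)
    then show ?thesis by (simp add: induced_metric_eq that nkG_self_pos)
  qed
  ultimately show ?thesis
    by (simp add: smooth_metric_def D induced_metric_eq nkG_commute)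
qed

text \<open>By dimension: the image of \<open>\<omega>\<close> and its image under \<open>J\<close> are orthogonal and three-dimensional, so
together they span \<open>\<real>\<^sup>3 \<times> \<real>\<^sup>3\<close>. The right-hand side is a closed condition on the point.\<close>

lemma tangent_iff_normal:
  assumes u: "u \<in> D"
  shows "W \<in> range (\<lambda>w. \<omega> w u) \<longleftrightarrow> (\<forall>t. nkG W (nkj (\<omega> t u)) = 0)"
proof
  assume "W \<in> range (\<lambda>w. \<omega> w u)"
  then show "\<forall>t. nkG W (nkj (\<omega> t u)) = 0" using lagrangian_\<omega>[OF u] by (auto simp: nkG_commute)
next
  assume W: "\<forall>t. nkG W (nkj (\<omega> t u)) = 0"
  interpret nkG: bounded_bilinear nkG by (rule bounded_bilinear_nkG)
  interpret nkj: bounded_linear nkj by (rule bounded_linear_nkj)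
  have lin: "linear (\<lambda>w. \<omega> w u)" using smooth_\<omega> u by (simp add: smooth_tensor_def)
  have l0: "nkG (\<omega> a u) (nkj (\<omega> b u)) = 0" for a b
    by (subst nkG_commute) (rule lagrangian_\<omega>[OF u])
  let ?\<Phi> = "\<lambda>x :: r33. \<omega> (fst x) u + nkj (\<omega> (snd x) u)"
  have lin\<Phi>: "linear ?\<Phi>"
    by (rule linearI) (simp_all add: linear_add[OF lin] linear_scale[OF lin] nkj.add nkj.scaleR scaleR_add_right)
  have "inj ?\<Phi>"
  proof (rule linear_injective_0[OF lin\<Phi>, THEN iffD2], intro allI impI)
    fix x assume 0: "?\<Phi> x = 0"
    have "nkG (?\<Phi> x) (\<omega> (fst x) u) = nkG (\<omega> (fst x) u) (\<omega> (fst x) u)"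
      by (simp add: nkG.add_left lagrangian_\<omega>[OF u])
    moreover have "nkG (?\<Phi> x) (nkj (\<omega> (snd x) u)) = nkG (\<omega> (snd x) u) (\<omega> (snd x) u)"
      by (simp add: nkG.add_left nkG_nkj l0)
    ultimately have "nkG (\<omega> (fst x) u) (\<omega> (fst x) u) = 0" "nkG (\<omega> (snd x) u) (\<omega> (snd x) u) = 0"
      by (simp_all add: 0 nkG.zero_left)
    then have "\<omega> (fst x) u = 0" "\<omega> (snd x) u = 0"
      using nkG_self_pos by (metis less_irrefl)+
    then have "fst x = 0" "snd x = 0"
      using inj_\<omega>[OF u] lin linear_injective_0 by blast+
    then show "x = 0" by (simp add: prod_eq_iff)
  qed
  then have "surj ?\<Phi>" using lin\<Phi> by (simp add: linear_injective_imp_surjective)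
  then obtain x where x: "W = ?\<Phi> x" by (rule surjE)
  have "nkG W (nkj (\<omega> (snd x) u)) = nkG (\<omega> (snd x) u) (\<omega> (snd x) u)"
    unfolding x by (simp add: nkG.add_left nkG_nkj l0)
  then have "\<omega> (snd x) u = 0" using W nkG_self_pos by (metis less_irrefl)
  then have "W = \<omega> (fst x) u" by (simp add: x nkj.zero)
  then show "W \<in> range (\<lambda>w. \<omega> w u)" by blast
qed

end

text \<open>Each of the two vector components of the hypothesis is a linear relation between \<open>\<alpha>\<close> and \<open>\<beta>\<close>; by
the double angle formulas these are, up to constants, the relation claimed times \<open>cos \<theta> - sqrt 3 sin \<theta>\<close> and
\<open>cos \<theta> + sqrt 3 sin \<theta>\<close>. These two factors do not vanish simultaneously.\<close>

lemma nkP_eigenvector: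
  fixes \<theta> :: real and \<alpha> \<beta> :: "real^3"
  assumes "(\<beta>, \<alpha>) = cos (2 * \<theta>) *\<^sub>R (\<alpha>, \<beta>) + sin (2 * \<theta>) *\<^sub>R nkj (\<alpha>, \<beta>)"
  shows "cos (\<theta> - pi/6) *\<^sub>R \<alpha> = cos (\<theta> + pi/6) *\<^sub>R \<beta>"
proof -
  define c s r where "c = cos \<theta>" "s = sin \<theta>" "r = sqrt 3"
  have r: "r * r = 3" "r \<noteq> 0" by (simp_all add: c_s_r_def)
  have cs: "c * c + s * s = 1"
    using sin_cos_squared_add2[of \<theta>] by (simp add: c_s_r_def power2_eq_square)
  have ab: "2 * cos (\<theta> + pi/6) = r * c - s" "2 * cos (\<theta> - pi/6) = r * c + s"
    by (simp_all add: c_s_r_def cos_add cos_diff cos_30 sin_30)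
  have c2: "cos (2 * \<theta>) = c * c - s * s" "sin (2 * \<theta>) = 2 * s * c"
    by (simp_all add: c_s_r_def cos_double sin_double power2_eq_square)
  define t where "t = 1 / r"
  have t: "r * t = 1" using r by (simp add: t_def)
  have "(r * c + s) * \<alpha> $ i = (r * c - s) * \<beta> $ i" for i
  proof -
    have e1: "r * \<beta> $ i = r * (c * c - s * s) * \<alpha> $ i + 2 * s * c * (2 * \<beta> $ i - \<alpha> $ i)"
    proof -
      have "\<beta> $ i = (c * c - s * s) * \<alpha> $ i + 2 * s * c * (t * (2 * \<beta> $ i - \<alpha> $ i))"
        using assms unfolding c2 by (simp add: nkj_def t_def c_s_r_def(3) vec_eq_iff)
      then show ?thesis using t by algebra
    qed
    have e2: "r * \<alpha> $ i = r * (c * c - s * s) * \<beta> $ i + 2 * s * c * (\<beta> $ i - 2 * \<alpha> $ i)"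
    proof -
      have "\<alpha> $ i = (c * c - s * s) * \<beta> $ i + 2 * s * c * (t * (\<beta> $ i - 2 * \<alpha> $ i))"
        using assms unfolding c2 by (simp add: nkj_def t_def c_s_r_def(3) vec_eq_iff)
      then show ?thesis using t by algebra
    qed
    let ?X = "(r * c + s) * \<alpha> $ i - (r * c - s) * \<beta> $ i"
    have "(c - r * s) * ?X = 0" using e1 r(1) cs by algebra
    moreover have "(c + r * s) * ?X = 0" using e2 r(1) cs by algebra
    ultimately have "c * ?X = 0" "r * s * ?X = 0" by algebra+
    then show ?thesis using cs r by auto
  qed
  then have "2 * cos (\<theta> - pi/6) * \<alpha> $ i = 2 * cos (\<theta> + pi/6) * \<beta> $ i" for i unfolding ab .
  then show ?thesis by (simp add: vec_eq_iff mult.assoc)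
qed

lemma cos_norm: "(cos (\<theta> + pi/6))\<^sup>2 + (cos (\<theta> - pi/6))\<^sup>2 - cos (\<theta> + pi/6) * cos (\<theta> - pi/6) = 3/4"
proof -
  define c s r where "c = cos \<theta>" "s = sin \<theta>" "r = sqrt 3"
  have r: "r * r = 3" by (simp_all add: c_s_r_def)
  have cs: "c * c + s * s = 1"
    using sin_cos_squared_add2[of \<theta>] by (simp add: c_s_r_def power2_eq_square)
  have ab: "cos (\<theta> + pi/6) = (r * c - s) / 2" "cos (\<theta> - pi/6) = (r * c + s) / 2"
    by (simp_all add: c_s_r_def cos_add cos_diff cos_30 sin_30)
  have "((r * c - s) / 2)\<^sup>2 + ((r * c + s) / 2)\<^sup>2 - ((r * c - s) / 2) * ((r * c + s) / 2) = (r * r * (c * c) + 3 * (s * s)) / 4"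
    by (simp add: power2_eq_square field_simps)
  also have "r * r * (c * c) + 3 * (s * s) = 3" unfolding r using cs by linarith
  finally show ?thesis unfolding ab .
qed

section \<open>Frames with constant angles\<close>

lemma sum_delta_3:
  fixes j :: 3
  shows "(\<Sum>l\<in>UNIV. f l * (if l = j then 1 else (0::real))) = f j"
    "(\<Sum>l\<in>UNIV. (axis j 1 $ l * p l) *\<^sub>R (w l :: 'a::real_vector)) = p j *\<^sub>R w j"
    "(\<Sum>l\<in>UNIV. axis j 1 $ l * p l * q l) = p j * (q j :: real)"
  using exhaust_3[of j] by (auto simp: sum_3 axis_def)

text \<open>A Lagrangian patch with an orthonormal frame on \<open>U\<close> such that the halves of \<open>\<omega> (E i)\<close> are
proportional with constant weights. The weights are normalised so that the vectors \<open>v i\<close> below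
become unit vectors.\<close>

locale angle_frame = lagrangian_patch +
  fixes U :: "(real^3) set" and E :: "3 \<Rightarrow> real^3 \<Rightarrow> real^3" and a b :: "3 \<Rightarrow> real"
  assumes U: "open U" "U \<subseteq> D"
    and smooth_E: "smooth_on U (E i)"
    and E_on: "u \<in> U \<Longrightarrow> induced_metric F u (E i u) (E j u) = (if i = j then 1 else 0)"
    and norm_ab: "(a i)\<^sup>2 + (b i)\<^sup>2 - a i * b i = 3/4"
    and E_ab: "u \<in> U \<Longrightarrow> b i *\<^sub>R fst (\<omega> (E i u) u) = a i *\<^sub>R snd (\<omega> (E i u) u)"
begin

lemma UD: "u \<in> U \<Longrightarrow> u \<in> D" using U by blast

text \<open>The common direction of the two halves of \<open>\<omega> (E i)\<close>, written without division so that it is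
smooth and defined also when one of the weights vanishes.\<close>

definition v :: "3 \<Rightarrow> real^3 \<Rightarrow> real^3" where
  "v i u = (4/3) *\<^sub>R ((a i - b i / 2) *\<^sub>R fst (\<omega> (E i u) u) + (b i - a i / 2) *\<^sub>R snd (\<omega> (E i u) u))"

definition e :: "real^3 \<Rightarrow> real^3 \<Rightarrow> real^3" where
  "e w u = (\<chi> i. nkG (\<omega> w u) (\<omega> (E i u) u))"

lemma smooth_tensor_\<omega>: "smooth_tensor U \<omega>"
  using smooth_\<omega> U unfolding smooth_tensor_def by (auto intro: smooth_on_subset)

lemma smooth_\<omega>_E: "smooth_on U (\<lambda>u. \<omega> (E i u) u)"
  by (rule smooth_on_tensor[OF smooth_tensor_\<omega> smooth_E])

lemma smooth_v: "smooth_on U (v i)"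
  unfolding v_def[abs_def]
  by (intro smooth_on_scaleR smooth_on_const smooth_on_add smooth_on_linear_comp[OF bounded_linear_fst]
      smooth_on_linear_comp[OF bounded_linear_snd] smooth_\<omega>_E U)

lemma \<omega>_E:
  assumes u: "u \<in> U" shows "\<omega> (E i u) u = (a i *\<^sub>R v i u, b i *\<^sub>R v i u)"
proof -
  define x y where "x = fst (\<omega> (E i u) u)" "y = snd (\<omega> (E i u) u)"
  have *: "b i * x $ k = a i * y $ k" for k
    using arg_cong[OF E_ab[OF u, of i], of "\<lambda>w. w $ k"] by (simp add: x_y_def)
  have v: "v i u $ k = 4/3 * ((a i - b i / 2) * x $ k + (b i - a i / 2) * y $ k)" for k
    by (simp add: v_def x_y_def)
  have "3 * (a i * v i u $ k) = 3 * x $ k" "3 * (b i * v i u $ k) = 3 * y $ k" for k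
  proof -
    have "3 * (a i * v i u $ k) = 4 * (((a i)\<^sup>2 - a i * b i / 2) * x $ k + (b i - a i / 2) * (a i * y $ k))"
      unfolding v by (simp add: power2_eq_square field_simps)
    also have "\<dots> = 4 * ((a i)\<^sup>2 + (b i)\<^sup>2 - a i * b i) * x $ k"
      unfolding *[symmetric] by (simp add: power2_eq_square field_simps)
    finally show "3 * (a i * v i u $ k) = 3 * x $ k" by (simp add: norm_ab)
    have "3 * (b i * v i u $ k) = 4 * ((a i - b i / 2) * (b i * x $ k) + ((b i)\<^sup>2 - a i * b i / 2) * y $ k)"
      unfolding v by (simp add: power2_eq_square field_simps)
    also have "\<dots> = 4 * ((a i)\<^sup>2 + (b i)\<^sup>2 - a i * b i) * y $ k"
      unfolding * by (simp add: power2_eq_square field_simps)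
    finally show "3 * (b i * v i u $ k) = 3 * y $ k" by (simp add: norm_ab)
  qed
  then have "x = a i *\<^sub>R v i u" "y = b i *\<^sub>R v i u" by (simp_all add: vec_eq_iff)
  then show ?thesis by (simp add: x_y_def prod_eq_iff)
qed

text \<open>Orthogonality of \<open>E\<^sub>i\<close> to \<open>E\<^sub>j\<close> and to \<open>J E\<^sub>j\<close> says that \<open>\<langle>v\<^sub>i, v\<^sub>j\<rangle>\<close> times the real part and times the
imaginary part of a Hermitian product of the weight points vanishes. This product is not zero.\<close>

lemma v_orthonormal:
  assumes u: "u \<in> U" shows "v i u \<bullet> v j u = (if i = j then 1 else 0)"
proof -
  have 1: "(v i u \<bullet> v j u) * (4/3 * (a i * a j + b i * b j - (a i * b j + b i * a j) / 2)) = (if i = j then 1 else 0)"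
    using E_on[OF u, of i j] by (simp add: induced_metric_eq[OF UD[OF u]] \<omega>_E[OF u] nkG_def field_simps)
  have 2: "(v i u \<bullet> v j u) * (b i * a j - a i * b j) = 0"
  proof -
    have "nkG (nkj (\<omega> (E i u) u)) (\<omega> (E j u) u) = (v i u \<bullet> v j u) * (b i * a j - a i * b j) * (2 / sqrt 3)"
    proof -
      have s3: "sqrt 3 * (sqrt 3 * x) = 3 * x" for x :: real by (simp flip: mult.assoc)
      show ?thesis by (simp add: \<omega>_E[OF u] nkG_def nkj_def inner_simps field_simps s3)
    qed
    then show ?thesis using lagrangian_\<omega>[OF UD[OF u]] by simp
  qed
  show ?thesis
  proof (cases "i = j")
    case True
    have "(v i u \<bullet> v i u) * (4/3 * ((a i)\<^sup>2 + (b i)\<^sup>2 - a i * b i)) = 1"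
      using 1 unfolding True by (simp add: power2_eq_square mult.commute)
    then show ?thesis unfolding norm_ab True by simp
  next
    case False
    have "v i u \<bullet> v j u = 0"
    proof (rule ccontr)
      assume "v i u \<bullet> v j u \<noteq> 0"
      then have "b i * a j - a i * b j = 0" "2 * (a i * a j + b i * b j) = a i * b j + b i * a j"
        using 1 2 False by auto
      then have "4 * (((a i)\<^sup>2 + (b i)\<^sup>2 - a i * b i) * ((a j)\<^sup>2 + (b j)\<^sup>2 - a j * b j)) = 0" by algebra
      then show False by (simp add: norm_ab)
    qed
    then show ?thesis using False by simp
  qed
qed

lemma E_expand:
  assumes u: "u \<in> U" shows "w = (\<Sum>i\<in>UNIV. (e w u $ i) *\<^sub>R E i u)"
proof -
  interpret nkG: bounded_bilinear nkG by (rule bounded_bilinear_nkG)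
  have lin: "linear (\<lambda>w. \<omega> w u)" using smooth_\<omega> UD[OF u] by (simp add: smooth_tensor_def)
  let ?f = "\<lambda>x::real^3. \<Sum>i\<in>UNIV. (x $ i) *\<^sub>R E i u"
  have linf: "linear ?f"
    by (rule linearI) (simp_all add: scaleR_add_left sum.distrib scaleR_sum_right)
  have ef: "e (?f x) u = x" for x
  proof -
    have "nkG (\<omega> (?f x) u) (\<omega> (E j u) u) = (\<Sum>i\<in>UNIV. x $ i * nkG (\<omega> (E i u) u) (\<omega> (E j u) u))" for j
      by (simp only: linear_sum[OF lin] linear_scale[OF lin] nkG.sum_left nkG.scaleR_left real_scaleR_def)
    moreover have "(\<Sum>i\<in>UNIV. x $ i * nkG (\<omega> (E i u) u) (\<omega> (E j u) u)) = x $ j" for j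
      unfolding induced_metric_eq[OF UD[OF u], symmetric] E_on[OF u] by (rule sum_delta_3)
    ultimately have "nkG (\<omega> (?f x) u) (\<omega> (E j u) u) = x $ j" for j by simp
    then show ?thesis by (simp only: e_def vec_eq_iff vec_lambda_beta) blast
  qed
  have "inj ?f" by (rule inj_on_inverseI[of _ "\<lambda>w. e w u"]) (rule ef)
  then have "surj ?f" using linf by (simp add: linear_injective_imp_surjective)
  then obtain x where "w = ?f x" by (rule surjE)
  then show ?thesis using ef[of x] by simp
qed

lemma e_E: "u \<in> U \<Longrightarrow> e (E i u) u = axis i 1"
  using E_on[of u i] by (simp add: e_def vec_eq_iff axis_def induced_metric_eq UD)

lemma smooth_tensor_e: "smooth_tensor U e"
proof -
  interpret nkG: bounded_bilinear nkG by (rule bounded_bilinear_nkG)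
  have lin: "linear (\<lambda>w. \<omega> w u)" if "u \<in> U" for u using smooth_tensor_\<omega> that by (simp add: smooth_tensor_def)
  have "smooth_on U (\<lambda>u. \<Sum>i\<in>UNIV. nkG (\<omega> w u) (\<omega> (E i u) u) *\<^sub>R axis i (1::real))" for w
    using smooth_tensor_\<omega> unfolding smooth_tensor_def
    by (intro smooth_on_sum smooth_on_scaleR smooth_on_const smooth_on_bilinear[OF bounded_bilinear_nkG] smooth_\<omega>_E U) auto
  moreover have "(\<Sum>i\<in>UNIV. nkG (\<omega> w u) (\<omega> (E i u) u) *\<^sub>R axis i (1::real)) = e w u" for w u
    by (simp add: e_def vec_eq_iff axis_def forall_3 sum_3)
  moreover have "linear (\<lambda>w. e w u)" if "u \<in> U" for u
    by (rule linearI) (simp_all add: e_def vec_eq_iff linear_add[OF lin[OF that]] linear_scale[OF lin[OF that]]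
        nkG.add_left nkG.scaleR_left)
  ultimately show ?thesis by (simp add: smooth_tensor_def U)
qed

lemma \<omega>_expand:
  assumes u: "u \<in> U"
  shows "\<omega> w u = (\<Sum>i\<in>UNIV. (e w u $ i) *\<^sub>R (a i *\<^sub>R v i u, b i *\<^sub>R v i u))"
proof -
  have lin: "linear (\<lambda>w. \<omega> w u)" using smooth_\<omega> UD[OF u] by (simp add: smooth_tensor_def)
  show ?thesis
    by (subst E_expand[OF u, of w]) (simp only: linear_sum[OF lin] linear_scale[OF lin] \<omega>_E[OF u])
qed

lemma induced_metric_e:
  assumes u: "u \<in> U" shows "induced_metric F u w x = e w u \<bullet> e x u"
proof -
  interpret nkG: bounded_bilinear nkG by (rule bounded_bilinear_nkG)
  have lin: "linear (\<lambda>w. \<omega> w u)" using smooth_\<omega> UD[OF u] by (simp add: smooth_tensor_def)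
  have "nkG (\<omega> w u) (\<omega> x u) = (\<Sum>i\<in>UNIV. e x u $ i * e w u $ i)"
    by (subst (1) E_expand[OF u, of x])
      (simp add: linear_sum[OF lin] linear_scale[OF lin] nkG.sum_right nkG.scaleR_right e_def)
  then show ?thesis by (simp add: induced_metric_eq[OF UD[OF u]] inner_vec_def mult.commute)
qed

definition \<Gamma> :: "real^3 \<Rightarrow> 3 \<Rightarrow> 3 \<Rightarrow> 3 \<Rightarrow> real" where
  "\<Gamma> u i j k = dd (v j) (E i u) u \<bullet> v k u"

definition C :: "real^3 \<Rightarrow> 3 \<Rightarrow> 3 \<Rightarrow> 3 \<Rightarrow> real" where
  "C u i j k = - (dd (e (E j u)) (E i u) u - dd (e (E i u)) (E j u) u) $ k"

definition T :: "real^3 \<Rightarrow> 3 \<Rightarrow> 3 \<Rightarrow> 3 \<Rightarrow> real" where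
  "T u i j k = (v i u \<times> v j u) \<bullet> v k u"

lemma dv: "u \<in> U \<Longrightarrow> (v i has_derivative (\<lambda>w. dd (v i) w u)) (at u)"
  by (rule smooth_on_has_derivative[OF smooth_v])

lemma de: "u \<in> U \<Longrightarrow> (e w has_derivative (\<lambda>x. dd (e w) x u)) (at u)"
  using smooth_tensor_e by (intro smooth_on_has_derivative) (auto simp: smooth_tensor_def)

lemma \<Gamma>_skew:
  assumes u: "u \<in> U" shows "dd (v j) w u \<bullet> v k u = - (dd (v k) w u \<bullet> v j u)"
proof -
  have "((\<lambda>y. v j y \<bullet> v k y) has_derivative (\<lambda>w. v j u \<bullet> dd (v k) w u + dd (v j) w u \<bullet> v k u)) (at u)"
    by (rule has_derivative_inner[OF dv dv]) fact+
  moreover have "((\<lambda>y. v j y \<bullet> v k y) has_derivative (\<lambda>w. 0)) (at u)"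
    by (rule has_derivative_transform_within_open[OF has_derivative_const[of "if j = k then 1 else 0"] U(1) u])
      (simp add: v_orthonormal)
  ultimately have "(\<lambda>w. v j u \<bullet> dd (v k) w u + dd (v j) w u \<bullet> v k u) = (\<lambda>w. 0)"
    by (rule has_derivative_unique)
  then have "v j u \<bullet> dd (v k) w u + dd (v j) w u \<bullet> v k u = 0" by meson
  then show ?thesis by (simp add: inner_commute)
qed

text \<open>One half of the Maurer-Cartan equation, evaluated on the frame and paired with \<open>v k\<close>.\<close>

lemma component_maurer_cartan:
  assumes u: "u \<in> U" and \<alpha>: "\<And>w y. y \<in> U \<Longrightarrow> \<alpha> w y = (\<Sum>l\<in>UNIV. (e w y $ l * p l) *\<^sub>R v l y)"
    and mc: "\<And>x w. dd (\<alpha> w) x u - dd (\<alpha> x) w u + 2 *\<^sub>R (\<alpha> x u \<times> \<alpha> w u) = 0"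
  shows "p j * \<Gamma> u i j k - p i * \<Gamma> u j i k + 2 * p i * p j * T u i j k = p k * C u i j k"
proof -
  have d: "dd (\<alpha> w) x u \<bullet> v k u = p k * dd (e w) x u $ k + (\<Sum>l\<in>UNIV. e w u $ l * p l * (dd (v l) x u \<bullet> v k u))" for w x
  proof -
    have nth: "((\<lambda>y. e w y $ l * p l) has_derivative (\<lambda>x. dd (e w) x u $ l * p l)) (at u)" for l
      by (intro has_derivative_mult_left bounded_linear.has_derivative[OF bounded_linear_vec_nth] de u)
    have "((\<lambda>y. \<Sum>l\<in>UNIV. (e w y $ l * p l) *\<^sub>R v l y) has_derivative
       (\<lambda>x. \<Sum>l\<in>UNIV. (e w u $ l * p l) *\<^sub>R dd (v l) x u + (dd (e w) x u $ l * p l) *\<^sub>R v l u)) (at u)"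
      by (intro has_derivative_sum has_derivative_scaleR nth dv u)
    then have "dd (\<lambda>y. \<Sum>l\<in>UNIV. (e w y $ l * p l) *\<^sub>R v l y) x u =
      (\<Sum>l\<in>UNIV. (e w u $ l * p l) *\<^sub>R dd (v l) x u + (dd (e w) x u $ l * p l) *\<^sub>R v l u)"
      by (rule dd_eqI)
    moreover have "dd (\<alpha> w) x u = dd (\<lambda>y. \<Sum>l\<in>UNIV. (e w y $ l * p l) *\<^sub>R v l y) x u"
      by (rule dd_cong[OF U(1) u \<alpha>])
    ultimately have "dd (\<alpha> w) x u \<bullet> v k u =
      (\<Sum>l\<in>UNIV. (e w u $ l * p l) * (dd (v l) x u \<bullet> v k u) + (dd (e w) x u $ l * p l) * (v l u \<bullet> v k u))"
      by (simp add: inner_sum_left inner_add_left)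
    also have "\<dots> = (\<Sum>l\<in>UNIV. (e w u $ l * p l) * (dd (v l) x u \<bullet> v k u)) + dd (e w) x u $ k * p k"
      unfolding sum.distrib v_orthonormal[OF u] sum_delta_3 ..
    finally show ?thesis by simp
  qed
  have \<alpha>E: "\<alpha> (E i u) u = p i *\<^sub>R v i u" for i
    unfolding \<alpha>[OF u] e_E[OF u] by (rule sum_delta_3)
  have s: "(\<Sum>l\<in>UNIV. e (E j u) u $ l * p l * (dd (v l) x u \<bullet> v k u)) = p j * (dd (v j) x u \<bullet> v k u)" for j x
    unfolding e_E[OF u] by (rule sum_delta_3)
  have "(dd (\<alpha> (E j u)) (E i u) u - dd (\<alpha> (E i u)) (E j u) u + 2 *\<^sub>R (\<alpha> (E i u) u \<times> \<alpha> (E j u) u)) \<bullet> v k u = 0"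
    unfolding mc by simp
  then show ?thesis
    unfolding inner_add_left inner_diff_left d \<alpha>E s
    by (simp add: \<Gamma>_def C_def T_def cross_mult_left cross_mult_right algebra_simps)
qed

lemma structure_numbers_at:
  assumes u: "u \<in> U" shows "structure_numbers a b (\<Gamma> u) (C u) (T u)"
proof
  have uD: "u \<in> D" using u by (rule UD)
  show "\<Gamma> u i j k = - \<Gamma> u i k j" for i j k
    unfolding \<Gamma>_def by (rule \<Gamma>_skew[OF u])
  show "T u i j k = - T u j i k" "T u i j k = - T u i k j" for i j k
    unfolding T_def by (simp_all add: cross3_simps)
  show "(T u 1 2 3)\<^sup>2 = 1"
  proof -
    let ?n = "v 1 u \<times> v 2 u"
    have o: "v 1 u \<bullet> v 2 u = 0" "v 1 u \<bullet> v 3 u = 0" "v 2 u \<bullet> v 3 u = 0" "v 1 u \<bullet> v 1 u = 1" "v 2 u \<bullet> v 2 u = 1" "v 3 u \<bullet> v 3 u = 1"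
      using v_orthonormal[OF u] by simp_all
    have "(?n \<bullet> v 3 u)\<^sup>2 = (v 1 u \<bullet> v 1 u) * (v 2 u \<bullet> v 2 u) * (v 3 u \<bullet> v 3 u)
        + 2 * (v 1 u \<bullet> v 2 u) * (v 1 u \<bullet> v 3 u) * (v 2 u \<bullet> v 3 u)
        - (v 1 u \<bullet> v 1 u) * (v 2 u \<bullet> v 3 u)\<^sup>2 - (v 2 u \<bullet> v 2 u) * (v 1 u \<bullet> v 3 u)\<^sup>2 - (v 3 u \<bullet> v 3 u) * (v 1 u \<bullet> v 2 u)\<^sup>2"
      by (simp add: cross3_simps power2_eq_square)
    then show ?thesis unfolding T_def o by simp
  qed
  have sm: "\<omega> w differentiable (at u)" for w
    using smooth_\<omega> uD by (auto simp: smooth_tensor_def intro: smooth_on_differentiable)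
  have df: "dd (\<lambda>y. fst (\<omega> w y)) x u = fst (dd (\<omega> w) x u)" "dd (\<lambda>y. snd (\<omega> w y)) x u = snd (dd (\<omega> w) x u)" for w x
    by (rule dd_eqI[OF bounded_linear.has_derivative[OF bounded_linear_fst has_derivative_dd[OF sm]]],
        rule dd_eqI[OF bounded_linear.has_derivative[OF bounded_linear_snd has_derivative_dd[OF sm]]])
  show "a j * \<Gamma> u i j k - a i * \<Gamma> u j i k + 2 * a i * a j * T u i j k = a k * C u i j k" for i j k
  proof (rule component_maurer_cartan[OF u, of "\<lambda>w y. fst (\<omega> w y)"])
    show "fst (\<omega> w y) = (\<Sum>l\<in>UNIV. (e w y $ l * a l) *\<^sub>R v l y)" if "y \<in> U" for w y
      unfolding \<omega>_expand[OF that] by (simp add: fst_sum)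
    show "dd (\<lambda>y. fst (\<omega> w y)) x u - dd (\<lambda>y. fst (\<omega> x y)) w u + 2 *\<^sub>R (fst (\<omega> x u) \<times> fst (\<omega> w u)) = 0" for x w
      unfolding df using arg_cong[OF maurer_cartan[OF uD, of w x], of fst] by (simp add: bracket_def)
  qed
  show "b j * \<Gamma> u i j k - b i * \<Gamma> u j i k + 2 * b i * b j * T u i j k = b k * C u i j k" for i j k
  proof (rule component_maurer_cartan[OF u, of "\<lambda>w y. snd (\<omega> w y)"])
    show "snd (\<omega> w y) = (\<Sum>l\<in>UNIV. (e w y $ l * b l) *\<^sub>R v l y)" if "y \<in> U" for w y
      unfolding \<omega>_expand[OF that] by (simp add: snd_sum)
    show "dd (\<lambda>y. snd (\<omega> w y)) x u - dd (\<lambda>y. snd (\<omega> x y)) w u + 2 *\<^sub>R (snd (\<omega> x u) \<times> snd (\<omega> w u)) = 0" for x w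
      unfolding df using arg_cong[OF maurer_cartan[OF uD, of w x], of snd] by (simp add: bracket_def)
  qed
qed

end

section \<open>Curvature and second fundamental form of a patch\<close>

lemma bounded_bilinear_nkQ: "bounded_bilinear nkQ"
  unfolding nkQ_def Let_def bilinear_conv_bounded_bilinear[symmetric] bilinear_def
  by (auto simp: cross3_def vec_eq_iff forall_3 vector_3_nth algebra_simps
      add_divide_distrib diff_divide_distrib intro!: linearI)

context angle_frame begin

lemma dv_expand:
  assumes u: "u \<in> U"
  shows "dd (v j) w u \<bullet> y = (\<Sum>i\<in>UNIV. e w u $ i * (dd (v j) (E i u) u \<bullet> y))"
proof -
  have lin: "linear (\<lambda>w. dd (v j) w u)" by (rule has_derivative_linear[OF dv[OF u]])
  show ?thesis
    by (subst (1) E_expand[OF u, of w]) (simp add: linear_sum[OF lin] linear_scale[OF lin] inner_sum_left)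
qed

lemma v_parseval:
  assumes u: "u \<in> U"
  shows "x \<bullet> y = (\<Sum>l\<in>UNIV. (x \<bullet> v l u) * (y \<bullet> v l u))"
proof -
  let ?A = "(\<chi> i. v i u) :: real^3^3"
  have "?A ** transpose ?A = mat 1"
    by (simp add: matrix_matrix_mult_def transpose_def mat_def vec_eq_iff v_orthonormal[OF u, unfolded inner_vec_def inner_real_def])
  then have "transpose ?A ** ?A = mat 1" by (simp add: matrix_left_right_inverse)
  then have "x \<bullet> y = x \<bullet> (transpose ?A *v (?A *v y))" by (simp add: matrix_vector_mul_assoc)
  also have "\<dots> = (?A *v x) \<bullet> (?A *v y)" by (simp add: dot_lmul_matrix[symmetric] vector_transpose_matrix flip: transpose_matrix_vector)
  also have "\<dots> = (\<Sum>l\<in>UNIV. (x \<bullet> v l u) * (y \<bullet> v l u))"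
    by (simp add: inner_vec_def matrix_vector_mult_def mult.commute)
  finally show ?thesis .
qed

text \<open>By \<open>diagonal_zero\<close> the form \<open>\<langle>D v\<^sub>i, v\<^sub>j\<rangle>\<close> is the multiple \<open>\<Gamma> k i j\<close> of \<open>e\<^sub>k\<close> on all of \<open>U\<close>. Its exterior
derivative is computed from this description and from the symmetry of the second derivatives of
\<open>v\<^sub>i\<close>; on \<open>E\<^sub>i\<close>, \<open>E\<^sub>j\<close> the derivative of the coefficient drops out.\<close>

lemma flatness:
  assumes u: "u \<in> U" and ijk: "i \<noteq> j" "j \<noteq> k" "i \<noteq> k"
    and d: "\<And>i j. i \<noteq> j \<Longrightarrow> a i * b j \<noteq> b i * a j"
  shows "\<Gamma> u k i j * C u i j k = \<Gamma> u i j k * \<Gamma> u j k i"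
proof -
  have third: "l = i \<or> l = j \<or> l = k" for l
    using ijk exhaust_3[of i] exhaust_3[of j] exhaust_3[of k] exhaust_3[of l] by auto
  have UNIV_ijk: "UNIV = {i, j, k}" using third by blast
  have sum_ijk: "(\<Sum>l\<in>UNIV. f l) = f i + f j + f k" for f :: "3 \<Rightarrow> real"
    unfolding UNIV_ijk using ijk by simp
  have diag: "\<Gamma> y p q p = 0" "\<Gamma> y p p q = 0" "\<Gamma> y p q q = 0" if "y \<in> U" "p \<noteq> q" for y p q
    using structure_numbers.diagonal_zero(1)[OF structure_numbers_at[OF that(1)], of q p] d[of q p] that(2)
      structure_numbers.\<Gamma>_skew[OF structure_numbers_at[OF that(1)], of p p q]
      structure_numbers.\<Gamma>_diag[OF structure_numbers_at[OF that(1)]] by auto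
  have conn: "dd (v i) w y \<bullet> v j y = \<Gamma> y k i j * e w y $ k" if "y \<in> U" for w y
    unfolding dv_expand[OF that, of i w] \<Gamma>_def[symmetric] sum_ijk
    using diag[OF that] ijk by simp
  have sv: "smooth_on U (dd (v i) w)" for i w by (rule smooth_on_dd[OF smooth_v])
  have d\<Gamma>: "((\<lambda>y. \<Gamma> y k i j) has_derivative (\<lambda>x. dd (\<lambda>y. \<Gamma> y k i j) x u)) (at u)"
    unfolding \<Gamma>_def
    by (intro smooth_on_has_derivative[OF _ u] smooth_on_inner smooth_v U
        smooth_on_tensor[OF smooth_tensor_dd[OF smooth_v U(1)] smooth_E])
  have eq: "dd (dd (v i) w) x u \<bullet> v j u + dd (v i) w u \<bullet> dd (v j) x u
     = \<Gamma> u k i j * dd (e w) x u $ k + dd (\<lambda>y. \<Gamma> y k i j) x u * e w u $ k" for w x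
  proof -
    have "((\<lambda>y. dd (v i) w y \<bullet> v j y) has_derivative
        (\<lambda>x. dd (v i) w u \<bullet> dd (v j) x u + dd (dd (v i) w) x u \<bullet> v j u)) (at u)"
      by (rule has_derivative_inner[OF smooth_on_has_derivative[OF sv u] dv[OF u]])
    moreover have "((\<lambda>y. \<Gamma> y k i j * e w y $ k) has_derivative
        (\<lambda>x. \<Gamma> u k i j * dd (e w) x u $ k + dd (\<lambda>y. \<Gamma> y k i j) x u * e w u $ k)) (at u)"
      by (rule has_derivative_mult[OF d\<Gamma> bounded_linear.has_derivative[OF bounded_linear_vec_nth de[OF u]]])
    then have "((\<lambda>y. dd (v i) w y \<bullet> v j y) has_derivative
        (\<lambda>x. \<Gamma> u k i j * dd (e w) x u $ k + dd (\<lambda>y. \<Gamma> y k i j) x u * e w u $ k)) (at u)"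
      by (rule has_derivative_transform_within_open[OF _ U(1) u]) (simp add: conn)
    ultimately have "(\<lambda>x. dd (v i) w u \<bullet> dd (v j) x u + dd (dd (v i) w) x u \<bullet> v j u)
      = (\<lambda>x. \<Gamma> u k i j * dd (e w) x u $ k + dd (\<lambda>y. \<Gamma> y k i j) x u * e w u $ k)"
      by (rule has_derivative_unique)
    from fun_cong[OF this, of x] show ?thesis by (simp add: add.commute)
  qed
  have sym: "dd (dd (v i) (E j u)) (E i u) u = dd (dd (v i) (E i u)) (E j u) u"
    by (rule symmetric_dd[OF smooth_v U(1) u])
  have p: "dd (v i) (E j u) u \<bullet> dd (v j) (E i u) u = \<Gamma> u j i k * \<Gamma> u i j k"
    "dd (v i) (E i u) u \<bullet> dd (v j) (E j u) u = 0"
    by (subst v_parseval[OF u], simp only: \<Gamma>_def[symmetric] sum_ijk, use diag[OF u] ijk in simp)+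
  have "e (E j u) u $ k = 0" "e (E i u) u $ k = 0" using ijk by (simp_all add: e_E[OF u] axis_def)
  then have "\<Gamma> u j i k * \<Gamma> u i j k = \<Gamma> u k i j * (dd (e (E j u)) (E i u) u $ k - dd (e (E i u)) (E j u) u $ k)"
    using eq[of "E j u" "E i u"] eq[of "E i u" "E j u"] p sym by (simp add: algebra_simps)
  then show ?thesis
    using structure_numbers.\<Gamma>_skew[OF structure_numbers_at[OF u], of j i k] by (simp add: C_def algebra_simps)
qed

lemma coframe_structure:
  assumes u: "u \<in> U" and d: "\<And>i j. i \<noteq> j \<Longrightarrow> a i * b j \<noteq> b i * a j"
  shows "dd (e w) x u - dd (e x) w u = - C u 1 2 3 *\<^sub>R (e x u \<times> e w u)"
    and "(C u 1 2 3)\<^sup>2 = 0 \<or> (C u 1 2 3)\<^sup>2 = 3/4"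
proof -
  interpret structure_numbers a b "\<Gamma> u" "C u" "T u" by (rule structure_numbers_at[OF u])
  have c: "C u 2 3 1 = C u 1 2 3" "C u 3 1 2 = C u 1 2 3" "(C u 1 2 3)\<^sup>2 = 0 \<or> (C u 1 2 3)\<^sup>2 = 3/4"
    by (rule structure_constant[OF d norm_ab flatness[OF u _ _ _ d] flatness[OF u _ _ _ d] flatness[OF u _ _ _ d]]; simp)+
  then show "(C u 1 2 3)\<^sup>2 = 0 \<or> (C u 1 2 3)\<^sup>2 = 3/4" by simp
  have Cskew: "C u i j k = - C u j i k" for i j k by (simp add: C_def)
  have Cz: "C u i j j = 0" if "i \<noteq> j" for i j using diagonal_zero(2)[OF that d[OF that]] .
  have Cz': "C u j i j = 0" if "i \<noteq> j" for i j using Cz[OF that] Cskew[of i j j] by simp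
  have Cd: "C u i i k = 0" for i k using Cskew[of i i k] by simp
  have Call: "C u i j k = C u 1 2 3 * (axis i 1 \<times> axis j 1) $ k" for i j k
    using exhaust_3[of i] exhaust_3[of j] exhaust_3[of k] c Cskew[of 2 1 3] Cskew[of 3 2 1] Cskew[of 1 3 2]
    by (elim disjE) (simp_all add: Cd Cz Cz' cross3_def axis_def vector_3_nth)
  let ?B = "\<lambda>x w. dd (e w) x u - dd (e x) w u"
  have l1: "linear (\<lambda>x. dd (e w) x u)" for w by (rule has_derivative_linear[OF de[OF u]])
  have l2: "linear (\<lambda>w. dd (e w) x u)" for x
  proof (rule linearI)
    have lin: "\<And>y. y \<in> U \<Longrightarrow> linear (\<lambda>w. e w y)" using smooth_tensor_e by (simp add: smooth_tensor_def)
    show "dd (e (w1 + w2)) x u = dd (e w1) x u + dd (e w2) x u" for w1 w2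
      by (rule dd_eqI[OF has_derivative_transform_within_open[OF has_derivative_add[OF de[OF u] de[OF u]] U(1) u]])
        (simp add: linear_add[OF lin])
    show "dd (e (r *\<^sub>R w1)) x u = r *\<^sub>R dd (e w1) x u" for r w1
      by (rule dd_eqI[OF has_derivative_transform_within_open[OF has_derivative_scaleR_right[OF de[OF u]] U(1) u]])
        (simp add: linear_scale[OF lin])
  qed
  have lB: "linear (\<lambda>x. ?B x w)" "linear (\<lambda>w. ?B x w)" for x w
    by (intro linear_compose_sub l1 l2)+
  have BE: "?B (E i u) (E j u) = - C u 1 2 3 *\<^sub>R (axis i 1 \<times> axis j 1)" for i j
  proof -
    have "?B (E i u) (E j u) $ k = - C u i j k" for k by (simp add: C_def)
    then show ?thesis unfolding vec_eq_iff Call[of i j] by simp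
  qed
  interpret cr: bounded_bilinear cross3 by (rule bounded_bilinear_cross3)
  have "?B x w = (\<Sum>i\<in>UNIV. \<Sum>j\<in>UNIV. (e x u $ i * e w u $ j) *\<^sub>R ?B (E i u) (E j u))"
  proof -
    have inner: "?B (E i u) w = (\<Sum>j\<in>UNIV. e w u $ j *\<^sub>R ?B (E i u) (E j u))" for i
    proof -
      have "?B (E i u) w = ?B (E i u) (\<Sum>j\<in>UNIV. e w u $ j *\<^sub>R E j u)"
        by (rule arg_cong[of _ _ "?B (E i u)"]) (rule E_expand[OF u])
      also have "\<dots> = (\<Sum>j\<in>UNIV. e w u $ j *\<^sub>R ?B (E i u) (E j u))"
        by (subst linear_sum[OF lB(2)]) (rule sum.cong[OF refl linear_scale[OF lB(2)]])
      finally show ?thesis .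
    qed
    have "?B x w = ?B (\<Sum>i\<in>UNIV. e x u $ i *\<^sub>R E i u) w"
      by (rule arg_cong[of _ _ "\<lambda>x. ?B x w"]) (rule E_expand[OF u])
    also have "\<dots> = (\<Sum>i\<in>UNIV. e x u $ i *\<^sub>R ?B (E i u) w)"
      by (subst linear_sum[OF lB(1)]) (rule sum.cong[OF refl linear_scale[OF lB(1)]])
    also have "\<dots> = (\<Sum>i\<in>UNIV. \<Sum>j\<in>UNIV. (e x u $ i * e w u $ j) *\<^sub>R ?B (E i u) (E j u))"
      unfolding inner scaleR_sum_right scaleR_scaleR ..
    finally show ?thesis .
  qed
  also have "\<dots> = - C u 1 2 3 *\<^sub>R ((\<Sum>i\<in>UNIV. (e x u $ i) *\<^sub>R axis i 1) \<times> (\<Sum>j\<in>UNIV. (e w u $ j) *\<^sub>R axis j 1))"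
  proof -
    have "(\<Sum>i\<in>UNIV. f i *\<^sub>R axis i 1) \<times> (\<Sum>j\<in>UNIV. h j *\<^sub>R axis j 1)
      = (\<Sum>i\<in>UNIV. \<Sum>j\<in>UNIV. (f i * h j) *\<^sub>R ((axis i 1 :: real^3) \<times> axis j 1))" for f h :: "3 \<Rightarrow> real"
      unfolding cr.sum_left cr.scaleR_left unfolding cr.sum_right cr.scaleR_right scaleR_sum_right scaleR_scaleR ..
    then show ?thesis unfolding BE by (simp only: scaleR_sum_right scaleR_scaleR mult.commute)
  qed
  moreover have "(\<Sum>i\<in>UNIV. (y $ i) *\<^sub>R axis i 1) = y" for y :: "real^3"
    by (simp add: vec_eq_iff sum_3 forall_3 axis_def)
  ultimately show "?B x w = - C u 1 2 3 *\<^sub>R (e x u \<times> e w u)" by (simp only:)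
qed

text \<open>The structure constant is continuous, as the quotient of a component of \<open>de\<close> by one of \<open>e \<times> e\<close>, and
it takes only three values.\<close>

lemma coframe_constant:
  assumes u: "u \<in> U" and d: "\<And>i j. i \<noteq> j \<Longrightarrow> a i * b j \<noteq> b i * a j"
  shows "\<exists>V c. open V \<and> u \<in> V \<and> V \<subseteq> U \<and> (c\<^sup>2 = 0 \<or> c\<^sup>2 = 3/4) \<and>
    (\<forall>y\<in>V. \<forall>x w. dd (e w) x y - dd (e x) w y = - c *\<^sub>R (e x y \<times> e w y))"
proof -
  define c where "c y = C y 1 2 3" for y
  \<comment> \<open>freezing the frame at \<open>u\<close> gives constant fields, to which \<open>de\<close> applies\<close>
  define n where "n y = (e (E 1 u) y \<times> e (E 2 u) y) $ 3" for y
  define m where "m y = - (dd (e (E 2 u)) (E 1 u) y - dd (e (E 1 u)) (E 2 u) y) $ 3" for y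
  have cn: "m y = c y * n y" if "y \<in> U" for y
    using coframe_structure(1)[OF that d, of "E 2 u" "E 1 u"] by (simp add: m_def n_def c_def)
  have se: "smooth_on U (e w)" for w using smooth_tensor_e by (simp add: smooth_tensor_def)
  have "continuous_on U n" "continuous_on U m"
    unfolding n_def m_def
    by (intro continuous_intros smooth_on_continuous smooth_on_bilinear[OF bounded_bilinear_cross3] smooth_on_dd se U)+
  then have nm: "isCont n u" "isCont m u" using U u continuous_on_eq_continuous_at by blast+
  have n1: "n u = 1" by (simp add: n_def e_E[OF u] cross_basis)
  have "((\<lambda>y. m y / n y) \<longlongrightarrow> m u / n u) (at u)"
    using nm n1 unfolding isCont_def by (intro tendsto_divide) auto
  then have "\<forall>\<^sub>F y in at u. dist (m y / n y) (m u / n u) < 1/2" by (rule tendstoD) simp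
  moreover have "\<forall>\<^sub>F y in at u. n y > 0"
    using nm(1) n1 unfolding isCont_def by (intro order_tendstoD(1)) auto
  moreover have "\<forall>\<^sub>F y in at u. y \<in> U" using U u eventually_at_topological by blast
  ultimately have "\<forall>\<^sub>F y in at u. y \<in> U \<and> \<bar>c y - c u\<bar> < 1/2"
    by eventually_elim (use cn n1 u in \<open>auto simp: dist_real_def\<close>)
  then obtain V where V: "open V" "u \<in> V" "\<And>y. y \<in> V \<Longrightarrow> y \<noteq> u \<Longrightarrow> y \<in> U \<and> \<bar>c y - c u\<bar> < 1/2"
    unfolding eventually_at_topological by blast
  have val: "c y = 0 \<or> c y = sqrt (3/4) \<or> c y = - sqrt (3/4)" if "y \<in> U" for y
  proof -
    have "(c y)\<^sup>2 = 0 \<or> (c y)\<^sup>2 = (sqrt (3/4))\<^sup>2" using coframe_structure(2)[OF that d] by (simp add: c_def)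
    then show ?thesis unfolding power2_eq_iff by auto
  qed
  \<comment> \<open>so that two different values of \<open>c\<close> are more than \<open>1/2\<close> apart\<close>
  have s: "sqrt (3/4) > 1/2" by (rule real_less_rsqrt) (simp add: power2_eq_square)
  have const: "y \<in> U \<and> c y = c u" if "y \<in> V" for y
  proof (cases "y = u")
    case True then show ?thesis using u by simp
  next
    case False
    then have yU: "y \<in> U" and less: "\<bar>c y - c u\<bar> < 1/2" using V(3)[OF that] by auto
    have "c y = c u" using val[OF yU] val[OF u] less s by (elim disjE) auto
    then show ?thesis using yU by simp
  qed
  show ?thesis
  proof (intro exI conjI ballI allI)
    show "open V" "u \<in> V" by fact+
    show "V \<subseteq> U" using const by blast
    show "(c u)\<^sup>2 = 0 \<or> (c u)\<^sup>2 = 3/4" using coframe_structure(2)[OF u d] by (simp add: c_def)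
    fix y x w assume "y \<in> V"
    then have "y \<in> U" "c y = c u" using const by blast+
    then show "dd (e w) x y - dd (e x) w y = - c u *\<^sub>R (e x y \<times> e w y)"
      using coframe_structure(1)[OF _ d, of y w x] by (simp add: c_def)
  qed
qed

lemma nkG_nkj_E:
  assumes u: "u \<in> U"
  shows "nkG W (nkj (\<omega> (E k u) u)) = 2 / sqrt 3 * ((fst W \<bullet> v k u) * b k - (snd W \<bullet> v k u) * a k)"
proof -
  have s3: "sqrt 3 * (sqrt 3 * x) = 3 * x" for x :: real by (simp flip: mult.assoc)
  show ?thesis by (simp add: \<omega>_E[OF u] nkG_def nkj_def inner_simps field_simps s3)
qed

text \<open>\<open>LY\<close> is a tangent field along the patch in left trivialisation. Expanded in the frame, the normal
component of its covariant derivative is a combination of the numbers \<open>sff\<close>: the derivatives of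
its coefficients only contribute tangent vectors.\<close>

lemma second_form_vanishes:
  assumes u: "u \<in> U" and pq: "p \<noteq> q" "a p * b q = b p * a q"
    and Y: "\<And>y. y \<in> U \<Longrightarrow> \<exists>\<eta>. LY y = \<omega> \<eta> y" and dY: "LY differentiable (at u)"
  shows "nkG (dd LY x u + nkQ (\<omega> x u) (LY u)) (nkj (\<omega> t u)) = 0"
proof -
  interpret S: structure_numbers a b "\<Gamma> u" "C u" "T u" by (rule structure_numbers_at[OF u])
  interpret nkG: bounded_bilinear nkG by (rule bounded_bilinear_nkG)
  interpret nkj: bounded_linear nkj by (rule bounded_linear_nkj)
  interpret nkQ: bounded_bilinear nkQ by (rule bounded_bilinear_nkQ)
  define s where "s i y = nkG (LY y) (\<omega> (E i y) y)" for i y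
  have LY: "LY y = (\<Sum>i\<in>UNIV. s i y *\<^sub>R (a i *\<^sub>R v i y, b i *\<^sub>R v i y))" if y: "y \<in> U" for y
  proof -
    obtain \<eta> where \<eta>: "LY y = \<omega> \<eta> y" using Y[OF y] by blast
    then have "s i y = e \<eta> y $ i" for i by (simp add: s_def e_def)
    then show ?thesis unfolding \<eta> by (simp only: \<omega>_expand[OF y, of \<eta>])
  qed
  have ds: "(s i has_derivative (\<lambda>x. dd (s i) x u)) (at u)" for i
    unfolding s_def[abs_def]
    by (intro has_derivative_dd differentiable_bilinear[OF bounded_bilinear_nkG] dY
        smooth_on_differentiable[OF smooth_\<omega>_E u])
  define X where "X i = e x u $ i" for i
  have dLY: "dd LY x u = (\<Sum>i\<in>UNIV. s i u *\<^sub>R (a i *\<^sub>R dd (v i) x u, b i *\<^sub>R dd (v i) x u)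
       + dd (s i) x u *\<^sub>R (a i *\<^sub>R v i u, b i *\<^sub>R v i u))"
    by (rule dd_eqI, rule has_derivative_transform_within_open[OF _ U(1) u LY[symmetric]])
      (intro has_derivative_sum has_derivative_scaleR has_derivative_Pair ds dv u has_derivative_scaleR_right)
  have Q: "nkQ (\<omega> x u) (LY u) = (\<Sum>i\<in>UNIV. \<Sum>j\<in>UNIV. (s i u * X j) *\<^sub>R nkQ (a j *\<^sub>R v j u, b j *\<^sub>R v j u) (a i *\<^sub>R v i u, b i *\<^sub>R v i u))"
    unfolding LY[OF u] \<omega>_expand[OF u, of x] X_def[symmetric] nkQ.sum_right nkQ.sum_left nkQ.scaleR_left nkQ.scaleR_right
    by (simp add: scaleR_sum_right)
  have Qv: "fst (nkQ (a j *\<^sub>R v j u, b j *\<^sub>R v j u) (a i *\<^sub>R v i u, b i *\<^sub>R v i u)) \<bullet> v k u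
       = T u j i k * (a j * a i + (b j * a i - a j * b i) / 3)"
    "snd (nkQ (a j *\<^sub>R v j u, b j *\<^sub>R v j u) (a i *\<^sub>R v i u, b i *\<^sub>R v i u)) \<bullet> v k u
       = T u j i k * (b j * b i - (b j * a i - a j * b i) / 3)" for i j k
    by (simp_all add: nkQ_def T_def cross_mult_left cross_mult_right inner_simps field_simps)
  have zero: "nkG (dd LY x u + nkQ (\<omega> x u) (LY u)) (nkj (\<omega> (E k u) u)) = 0" for k
  proof -
    let ?W = "dd LY x u + nkQ (\<omega> x u) (LY u)"
    have half: "p ?W \<bullet> v k u = m k * dd (s k) x u
       + (\<Sum>i\<in>UNIV. \<Sum>j\<in>UNIV. s i u * X j * (m i * \<Gamma> u j i k + t i j))"
      if p: "bounded_linear p" "\<And>i y. p (a i *\<^sub>R y, b i *\<^sub>R y) = m i *\<^sub>R y"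
        "\<And>i j. p (nkQ (a j *\<^sub>R v j u, b j *\<^sub>R v j u) (a i *\<^sub>R v i u, b i *\<^sub>R v i u)) \<bullet> v k u = t i j"
      for p :: "r33 \<Rightarrow> real^3" and m t
    proof -
      interpret p: bounded_linear p by fact
      have "p (dd LY x u) \<bullet> v k u = (\<Sum>i\<in>UNIV. s i u * (m i * (dd (v i) x u \<bullet> v k u)))
          + (\<Sum>i\<in>UNIV. dd (s i) x u * m i * (if i = k then 1 else 0))"
        unfolding dLY p.sum p.add p.scaleR p(2)
        by (simp add: inner_sum_left inner_add_left sum.distrib v_orthonormal[OF u] mult.assoc)
      also have "\<dots> = (\<Sum>i\<in>UNIV. \<Sum>j\<in>UNIV. s i u * X j * (m i * \<Gamma> u j i k)) + m k * dd (s k) x u"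
        unfolding sum_delta_3 dv_expand[OF u, of _ x] \<Gamma>_def[symmetric] X_def[symmetric]
        by (simp add: sum_distrib_left mult_ac)
      finally have 1: "p (dd LY x u) \<bullet> v k u = \<dots>" .
      have 2: "p (nkQ (\<omega> x u) (LY u)) \<bullet> v k u = (\<Sum>i\<in>UNIV. \<Sum>j\<in>UNIV. s i u * X j * t i j)"
        unfolding Q by (simp add: p.sum p.scaleR p(3) inner_sum_left)
      show ?thesis
        by (simp add: p.add inner_add_left 1 2 sum.distrib distrib_left)
    qed
    note f = half[OF bounded_linear_fst fst_conv Qv(1)] and g = half[OF bounded_linear_snd snd_conv Qv(2)]
    have "(fst ?W \<bullet> v k u) * b k - (snd ?W \<bullet> v k u) * a k = (\<Sum>i\<in>UNIV. \<Sum>j\<in>UNIV. s i u * X j * S.sff j i k)"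
    proof -
      define P R where "P i j = s i u * X j * (a i * \<Gamma> u j i k + T u j i k * (a j * a i + (b j * a i - a j * b i) / 3))"
        and "R i j = s i u * X j * (b i * \<Gamma> u j i k + T u j i k * (b j * b i - (b j * a i - a j * b i) / 3))" for i j
      have "(fst ?W \<bullet> v k u) * b k - (snd ?W \<bullet> v k u) * a k
        = (\<Sum>i\<in>UNIV. \<Sum>j\<in>UNIV. P i j) * b k - (\<Sum>i\<in>UNIV. \<Sum>j\<in>UNIV. R i j) * a k"
        unfolding f g P_def[symmetric] R_def[symmetric] by (simp add: distrib_right)
      also have "\<dots> = (\<Sum>i\<in>UNIV. \<Sum>j\<in>UNIV. P i j * b k - R i j * a k)"
        by (simp add: sum_distrib_right sum_subtractf)
      also have "\<dots> = (\<Sum>i\<in>UNIV. \<Sum>j\<in>UNIV. s i u * X j * S.sff j i k)"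
        by (intro sum.cong refl) (simp add: P_def R_def S.sff_def field_simps)
      finally show ?thesis .
    qed
    also have "\<dots> = 0" by (simp add: S.sff_zero[OF pq])
    finally show ?thesis by (simp add: nkG_nkj_E[OF u])
  qed
  have lin: "linear (\<lambda>w. \<omega> w u)" using smooth_\<omega> UD[OF u] by (simp add: smooth_tensor_def)
  show ?thesis
    by (subst E_expand[OF u, of t])
      (simp only: linear_sum[OF lin] linear_scale[OF lin] nkj.sum nkj.scaleR nkG.sum_right nkG.scaleR_right zero
        scaleR_zero_right sum.neutral_const)
qed

end

section \<open>Charts of a Lagrangian immersion\<close>

lemma dd_chain:
  assumes "f differentiable (at x)" "g differentiable (at (f x))"
  shows "dd (\<lambda>y. g (f y)) v x = dd g (dd f v x) (f x)"
  by (rule dd_eqI[OF has_derivative_compose[OF has_derivative_dd[OF assms(1)] has_derivative_dd[OF assms(2)]]])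

lemma frame_from_angles:
  assumes patch: "lagrangian_patch D F" and U: "open U" "U \<subseteq> D"
    and ang: "angle_functions F U E (\<lambda>i u. c i)"
  shows "angle_frame D F U E (\<lambda>i. cos (c i + pi/6)) (\<lambda>i. cos (c i - pi/6))"
proof -
  interpret lagrangian_patch D F by fact
  show ?thesis
  proof unfold_locales
    show "open U" "U \<subseteq> D" by fact+
    show "smooth_on U (E i)" for i using ang by (simp add: angle_functions_def orthonormal_frame_def)
    show "induced_metric F u (E i u) (E j u) = (if i = j then 1 else 0)" if "u \<in> U" for u i j
      using ang that by (simp add: angle_functions_def orthonormal_frame_def)
    show "(cos (c i + pi/6))\<^sup>2 + (cos (c i - pi/6))\<^sup>2 - cos (c i + pi/6) * cos (c i - pi/6) = 3/4" for i
      by (rule cos_norm)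
    show "cos (c i - pi/6) *\<^sub>R fst (\<omega> (E i u) u) = cos (c i + pi/6) *\<^sub>R snd (\<omega> (E i u) u)" if u: "u \<in> U" for i u
    proof (rule nkP_eigenvector)
      interpret t: bounded_bilinear untriv by (rule bounded_bilinear_untriv)
      have uD: "u \<in> D" using u U by blast
      let ?w = "\<omega> (E i u) u"
      have "nk_P (F u) (differential F u (E i u)) =
          cos (2 * c i) *\<^sub>R differential F u (E i u) + sin (2 * c i) *\<^sub>R nk_J (F u) (differential F u (E i u))"
        using ang u by (simp add: angle_functions_def)
      then have "untriv (F u) (snd ?w, fst ?w) = untriv (F u) (cos (2 * c i) *\<^sub>R ?w + sin (2 * c i) *\<^sub>R nkj ?w)"
        by (simp add: differential_def dF_eq uD nk_P_untriv nk_J_untriv F_S3S3 t.add_right t.scaleR_right)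
      then have "triv (F u) (untriv (F u) (snd ?w, fst ?w)) = triv (F u) (untriv (F u) (cos (2 * c i) *\<^sub>R ?w + sin (2 * c i) *\<^sub>R nkj ?w))"
        by (rule arg_cong)
      then show "(snd ?w, fst ?w) = cos (2 * c i) *\<^sub>R (fst ?w, snd ?w) + sin (2 * c i) *\<^sub>R nkj (fst ?w, snd ?w)"
        by (simp add: triv_untriv F_S3S3 uD)
    qed
  qed
qed

lemma angle_frame_subset:
  assumes "angle_frame D F U E a b" "open U'" "U' \<subseteq> U"
  shows "angle_frame D F U' E a b"
proof -
  interpret angle_frame D F U E a b by fact
  show ?thesis
    by unfold_locales (use assms(2,3) U smooth_E E_on norm_ab E_ab in \<open>auto intro: smooth_on_subset\<close>)
qed

text \<open>The structure equation is natural under pullback. It transports a coframe from the chart in which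
the frame is given to any other chart.\<close>

lemma pullback_coframe:
  fixes e :: "real^3 \<Rightarrow> real^3 \<Rightarrow> real^3" and \<tau> :: "real^3 \<Rightarrow> real^3"
  assumes e: "smooth_tensor V e" and \<tau>: "smooth_on S \<tau>" "open S" "\<tau> ` S \<subseteq> V"
    and de: "\<And>y v w. y \<in> V \<Longrightarrow> dd (e w) v y - dd (e v) w y = - c *\<^sub>R (e v y \<times> e w y)"
  shows "smooth_tensor S (\<lambda>w y. e (dd \<tau> w y) (\<tau> y))"
    and "y \<in> S \<Longrightarrow> dd (\<lambda>y. e (dd \<tau> w y) (\<tau> y)) v y - dd (\<lambda>y. e (dd \<tau> v y) (\<tau> y)) w y
       = - c *\<^sub>R (e (dd \<tau> v y) (\<tau> y) \<times> e (dd \<tau> w y) (\<tau> y))"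
proof -
  have V: "open V" and se: "\<And>w. smooth_on V (e w)" and lin: "\<And>y. y \<in> V \<Longrightarrow> linear (\<lambda>w. e w y)"
    using e by (auto simp: smooth_tensor_def)
  have \<tau>V: "\<tau> y \<in> V" if "y \<in> S" for y using \<tau>(3) that by blast
  have e\<tau>: "smooth_tensor S (\<lambda>w y. e w (\<tau> y))"
    by (simp add: smooth_tensor_def \<tau>(2) lin \<tau>V smooth_on_compose[OF se \<tau>(1,2) V \<tau>(3)])
  have "linear (\<lambda>w. e (dd \<tau> w y) (\<tau> y))" if "y \<in> S" for y
    using linear_compose[OF dd_linear[OF smooth_on_differentiable[OF \<tau>(1) that]] lin[OF \<tau>V[OF that]]]
    by (simp add: o_def)
  then show "smooth_tensor S (\<lambda>w y. e (dd \<tau> w y) (\<tau> y))"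
    by (simp add: smooth_tensor_def \<tau>(2) smooth_on_tensor[OF e\<tau> smooth_on_dd[OF \<tau>(1)]])
  assume y: "y \<in> S"
  have d: "dd (\<lambda>y. e (dd \<tau> w y) (\<tau> y)) v y = e (dd (dd \<tau> w) v y) (\<tau> y) + dd (e (dd \<tau> w y)) (dd \<tau> v y) (\<tau> y)" for v w
  proof -
    have "dd (\<lambda>y. e (dd \<tau> w y) (\<tau> y)) v y = e (dd (dd \<tau> w) v y) (\<tau> y) + dd (\<lambda>x. e (dd \<tau> w y) (\<tau> x)) v y"
      by (rule dd_eqI[OF tensor_has_derivative[OF e\<tau> y smooth_on_differentiable[OF smooth_on_dd[OF \<tau>(1)] y]]])
    also have "dd (\<lambda>x. e (dd \<tau> w y) (\<tau> x)) v y = dd (e (dd \<tau> w y)) (dd \<tau> v y) (\<tau> y)"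
      by (rule dd_chain[OF smooth_on_differentiable[OF \<tau>(1) y] smooth_on_differentiable[OF se \<tau>V[OF y]]])
    finally show ?thesis .
  qed
  show "dd (\<lambda>y. e (dd \<tau> w y) (\<tau> y)) v y - dd (\<lambda>y. e (dd \<tau> v y) (\<tau> y)) w y
       = - c *\<^sub>R (e (dd \<tau> v y) (\<tau> y) \<times> e (dd \<tau> w y) (\<tau> y))"
    unfolding d de[OF \<tau>V[OF y], symmetric] symmetric_dd[OF \<tau>(1,2) y, of w v] by simp
qed

locale lagrangian_immersion =
  fixes \<A> :: "(real^3, 'm::topological_space) atlas" and f :: "'m \<Rightarrow> quat \<times> quat"
  assumes atlas: "smooth_atlas \<A>" and imm: "immersion \<A> f" and lag: "lagrangian \<A> f"
begin

lemma chart: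
  assumes "(D, \<psi>) \<in> \<A>"
  shows "open D" "open (\<psi> ` D)" "\<exists>\<phi>. homeomorphism D (\<psi> ` D) \<psi> \<phi>" "inj_on \<psi> D" "continuous_on D \<psi>"
proof -
  show "open D" "open (\<psi> ` D)" and h: "\<exists>\<phi>. homeomorphism D (\<psi> ` D) \<psi> \<phi>"
    using atlas assms unfolding smooth_atlas_def by fast+
  then obtain \<phi> where \<phi>: "homeomorphism D (\<psi> ` D) \<psi> \<phi>" by blast
  show "inj_on \<psi> D" using homeomorphism_apply1[OF \<phi>] by (rule inj_on_inverseI)
  show "continuous_on D \<psi>" using \<phi> by (rule homeomorphism_cont1)
qed

lemma chart_cover: obtains D \<psi> u where "(D, \<psi>) \<in> \<A>" "u \<in> D" "\<psi> u = x"
proof -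
  have "x \<in> (\<Union>(D, \<psi>)\<in>\<A>. \<psi> ` D)" using atlas unfolding smooth_atlas_def by blast
  then show thesis using that by blast
qed

lemma chart_preimage_open:
  assumes "(D, \<psi>) \<in> \<A>" "open B" shows "open (D \<inter> \<psi> -` B)"
  using continuous_open_preimage[OF chart(5,1)[OF assms(1)] assms(2)] .

lemma chart_image_open:
  assumes "(D, \<psi>) \<in> \<A>" "open N" "N \<subseteq> D" shows "open (\<psi> ` N)"
proof -
  obtain \<phi> where \<phi>: "homeomorphism D (\<psi> ` D) \<psi> \<phi>" using chart(3)[OF assms(1)] by blast
  have "\<psi> ` N = \<psi> ` D \<inter> \<phi> -` N"
    using homeomorphism_apply1[OF \<phi>] assms(3) by (auto simp: image_iff)
  then show ?thesis
    using continuous_open_preimage[OF homeomorphism_cont2[OF \<phi>] chart(2)[OF assms(1)] assms(2)] by simp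
qed

lemma transition:
  assumes A: "(D, \<psi>) \<in> \<A>" "(D', \<psi>') \<in> \<A>"
  defines "S \<equiv> D \<inter> \<psi> -` (\<psi>' ` D')" and "\<tau> \<equiv> inv_into D' \<psi>' \<circ> \<psi>"
  shows "open S" "smooth_on S \<tau>" "\<And>y. y \<in> S \<Longrightarrow> \<tau> y \<in> D'" "\<And>y. y \<in> S \<Longrightarrow> \<psi>' (\<tau> y) = \<psi> y"
    "\<And>y u. y \<in> D \<Longrightarrow> u \<in> D' \<Longrightarrow> \<psi>' u = \<psi> y \<Longrightarrow> y \<in> S \<and> \<tau> y = u"
proof -
  show "open S" unfolding S_def by (rule chart_preimage_open[OF A(1) chart(2)[OF A(2)]])
  show "smooth_on S \<tau>" unfolding S_def \<tau>_def using atlas A unfolding smooth_atlas_def by fast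
  show "\<tau> y \<in> D'" if "y \<in> S" for y using that by (auto simp: S_def \<tau>_def intro: inv_into_into)
  show "\<psi>' (\<tau> y) = \<psi> y" if "y \<in> S" for y using that by (auto simp: S_def \<tau>_def intro: f_inv_into_f)
  show "y \<in> S \<and> \<tau> y = u" if "y \<in> D" "u \<in> D'" "\<psi>' u = \<psi> y" for y u
  proof -
    have "\<psi> y \<in> \<psi>' ` D'" using that by (metis imageI)
    moreover have "inv_into D' \<psi>' (\<psi> y) = u" using inv_into_f_f[OF chart(4)[OF A(2)] that(2)] that(3) by simp
    ultimately show ?thesis using that(1) by (simp add: S_def \<tau>_def)
  qed
qed

lemma f_S3S3: "f x \<in> S3S3" using imm by (auto simp: immersion_def)

lemma smooth_f: "(D, \<psi>) \<in> \<A> \<Longrightarrow> smooth_on D (f \<circ> \<psi>)" using imm by (auto simp: immersion_def)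

lemma patch:
  assumes A: "(D, \<psi>) \<in> \<A>" shows "lagrangian_patch D (f \<circ> \<psi>)"
proof
  show "open D" by (rule chart(1)[OF A])
  show "smooth_on D (f \<circ> \<psi>)" by (rule smooth_f[OF A])
  show "(f \<circ> \<psi>) u \<in> S3S3" for u by (simp add: f_S3S3)
  show "inj (\<lambda>w. dd (f \<circ> \<psi>) w u)" if "u \<in> D" for u
  proof -
    have "inj (differential (f \<circ> \<psi>) u)" using imm A that unfolding immersion_def by blast
    then show ?thesis by (simp add: differential_def)
  qed
  fix u v w assume u: "u \<in> D"
  have t: "dd (f \<circ> \<psi>) w u \<in> tangent_image \<A> f (\<psi> u)" for w
    using A u unfolding tangent_image_def differential_def by blast
  have "nk_J (f (\<psi> u)) (dd (f \<circ> \<psi>) v u) \<in> normal_space \<A> f (\<psi> u)"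
    using lag t[of v] unfolding lagrangian_def by blast
  then show "nk_metric ((f \<circ> \<psi>) u) (nk_J ((f \<circ> \<psi>) u) (dd (f \<circ> \<psi>) v u)) (dd (f \<circ> \<psi>) w u) = 0"
    using t[of w] by (simp add: normal_space_def)
qed

lemma dd_transition:
  assumes A: "(D, \<psi>) \<in> \<A>" "(D', \<psi>') \<in> \<A>" and y: "y \<in> D \<inter> \<psi> -` (\<psi>' ` D')"
  shows "dd (f \<circ> \<psi>) w y = dd (f \<circ> \<psi>') (dd (inv_into D' \<psi>' \<circ> \<psi>) w y) ((inv_into D' \<psi>' \<circ> \<psi>) y)"
proof -
  note t = transition[OF A]
  have "dd (f \<circ> \<psi>) w y = dd (\<lambda>y. (f \<circ> \<psi>') ((inv_into D' \<psi>' \<circ> \<psi>) y)) w y"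
    by (rule dd_cong[OF t(1) y]) (use t(4) in simp)
  also have "\<dots> = dd (f \<circ> \<psi>') (dd (inv_into D' \<psi>' \<circ> \<psi>) w y) ((inv_into D' \<psi>' \<circ> \<psi>) y)"
    by (rule dd_chain[OF smooth_on_differentiable[OF t(2) y] smooth_on_differentiable[OF smooth_f[OF A(2)] t(3)[OF y]]])
  finally show ?thesis .
qed

lemma tangent_image_chart:
  assumes A: "(D, \<psi>) \<in> \<A>" and u: "u \<in> D"
  shows "tangent_image \<A> f (\<psi> u) = range (\<lambda>w. dd (f \<circ> \<psi>) w u)"
proof
  show "range (\<lambda>w. dd (f \<circ> \<psi>) w u) \<subseteq> tangent_image \<A> f (\<psi> u)"
    using A u unfolding tangent_image_def differential_def by blast
  show "tangent_image \<A> f (\<psi> u) \<subseteq> range (\<lambda>w. dd (f \<circ> \<psi>) w u)"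
  proof
    fix n assume "n \<in> tangent_image \<A> f (\<psi> u)"
    then obtain D' \<psi>' u' v where A': "(D', \<psi>') \<in> \<A>" "u' \<in> D'" "\<psi>' u' = \<psi> u" and n: "n = dd (f \<circ> \<psi>') v u'"
      unfolding tangent_image_def differential_def by blast
    have t: "u' \<in> D' \<inter> \<psi>' -` (\<psi> ` D) \<and> (inv_into D \<psi> \<circ> \<psi>') u' = u"
      by (rule transition(5)[OF A'(1) A A'(2) u A'(3)[symmetric]])
    show "n \<in> range (\<lambda>w. dd (f \<circ> \<psi>) w u)"
      unfolding n dd_transition[OF A'(1) A t[THEN conjunct1]] t[THEN conjunct2] by (rule rangeI)
  qed
qed

abbreviation sec :: "(real^3) set \<Rightarrow> (real^3 \<Rightarrow> 'm) \<Rightarrow> real^3 \<Rightarrow> real^3 \<Rightarrow> real^3 \<Rightarrow> real" where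
  "sec D \<psi> \<equiv> sectional_curvature D (induced_metric (f \<circ> \<psi>))"

lemma sectional_curvature_chart_coframe:
  assumes A: "(D, \<psi>) \<in> \<A>" "(D', \<psi>') \<in> \<A>" and V: "V \<subseteq> D'" "y' \<in> V"
    and e: "smooth_tensor V e"
    and g: "\<And>y v w. y \<in> V \<Longrightarrow> induced_metric (f \<circ> \<psi>') y v w = e v y \<bullet> e w y"
    and de: "\<And>y v w. y \<in> V \<Longrightarrow> dd (e w) v y - dd (e v) w y = - c *\<^sub>R (e v y \<times> e w y)"
    and z: "z \<in> D" "\<psi> z = \<psi>' y'" and uv: "u \<noteq> v" "independent {u, v}"
  shows "sec D \<psi> z u v = c\<^sup>2 / 4"
proof -
  let ?\<tau> = "inv_into D' \<psi>' \<circ> \<psi>"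
  note t = transition[OF A]
  have Vo: "open V" using e by (simp add: smooth_tensor_def)
  define S where "S = (D \<inter> \<psi> -` (\<psi>' ` D')) \<inter> ?\<tau> -` V"
  have S: "open S" unfolding S_def by (rule continuous_open_preimage[OF smooth_on_continuous[OF t(2)] t(1) Vo])
  have SD: "y \<in> D \<inter> \<psi> -` (\<psi>' ` D')" if "y \<in> S" for y using that by (simp add: S_def)
  have \<tau>: "smooth_on S ?\<tau>" by (rule smooth_on_subset[OF t(2)]) (auto simp: S_def)
  have \<tau>V: "?\<tau> ` S \<subseteq> V" by (auto simp: S_def)
  have zS: "z \<in> S" using t(5)[OF z(1) _ z(2)[symmetric]] V by (auto simp: S_def)
  interpret lagrangian_patch D "f \<circ> \<psi>" by (rule patch[OF A(1)])
  have g': "induced_metric (f \<circ> \<psi>) y v w = e (dd ?\<tau> v y) (?\<tau> y) \<bullet> e (dd ?\<tau> w y) (?\<tau> y)" if y: "y \<in> S" for y v w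
  proof -
    have "\<psi> y = \<psi>' (?\<tau> y)" using t(4)[OF SD[OF y]] by simp
    then have "induced_metric (f \<circ> \<psi>) y v w = induced_metric (f \<circ> \<psi>') (?\<tau> y) (dd ?\<tau> v y) (dd ?\<tau> w y)"
      unfolding induced_metric_def differential_def dd_transition[OF A SD[OF y]] by simp
    also have "\<dots> = e (dd ?\<tau> v y) (?\<tau> y) \<bullet> e (dd ?\<tau> w y) (?\<tau> y)"
      by (rule g) (use \<tau>V y in blast)
    finally show ?thesis .
  qed
  show ?thesis
    by (rule sectional_curvature_coframe[OF smooth_metric_induced pullback_coframe(1)[OF e \<tau> S \<tau>V de] zS _ g'
          pullback_coframe(2)[OF e \<tau> S \<tau>V de] uv]) (auto simp: S_def)
qed

end

section \<open>Constant angle functions\<close>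

locale constant_angles = lagrangian_immersion \<A> f
  for \<A> :: "(real^3, 'm::topological_space) atlas" and f :: "'m \<Rightarrow> quat \<times> quat" +
  fixes c :: "3 \<Rightarrow> real" and W :: "'m set"
  assumes W: "open W" "closure W = UNIV"
    and ang: "\<And>x. x \<in> W \<Longrightarrow> \<exists>(D, \<psi>)\<in>\<A>. \<exists>U E. open U \<and> U \<subseteq> D \<and> x \<in> \<psi> ` U \<and>
           angle_functions (f \<circ> \<psi>) U E (\<lambda>i u. c i)"
begin

abbreviation a :: "3 \<Rightarrow> real" where "a i \<equiv> cos (c i + pi/6)"
abbreviation b :: "3 \<Rightarrow> real" where "b i \<equiv> cos (c i - pi/6)"

lemma frame_at:
  assumes "x \<in> W"
  obtains D \<psi> U E u where "(D, \<psi>) \<in> \<A>" "u \<in> U" "\<psi> u = x" "angle_frame D (f \<circ> \<psi>) U E a b"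
proof -
  obtain D \<psi> U E u where "(D, \<psi>) \<in> \<A>" "open U" "U \<subseteq> D" "u \<in> U" "\<psi> u = x" "angle_functions (f \<circ> \<psi>) U E (\<lambda>i u. c i)"
    using ang[OF assms] by blast
  then show thesis using that frame_from_angles[OF patch] by blast
qed

lemma chart_dense_closed:
  assumes A: "(D, \<psi>) \<in> \<A>" and N: "open N" "N \<subseteq> D"
    and h: "continuous_on N h" "closed K" "\<And>y. y \<in> N \<Longrightarrow> \<psi> y \<in> W \<Longrightarrow> h y \<in> K" and y: "y \<in> N"
  shows "h y \<in> K"
proof (rule ccontr)
  assume "h y \<notin> K"
  let ?N = "N \<inter> h -` (- K)"
  have "open ?N" using continuous_open_preimage[OF h(1) N(1)] h(2) by (simp add: open_Compl)
  then have "open (\<psi> ` ?N)" using chart_image_open[OF A] N by blast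
  moreover have "\<psi> y \<in> \<psi> ` ?N" using y \<open>h y \<notin> K\<close> by blast
  ultimately have "W \<inter> \<psi> ` ?N \<noteq> {}"
    using W(2) open_Int_closure_eq_empty[of "\<psi> ` ?N" W] by blast
  then obtain z where "z \<in> ?N" "\<psi> z \<in> W" by blast
  then show False using h(3) by blast
qed

subsection \<open>Proportional weight points\<close>

text \<open>The first argument of \<open>nkG\<close> is \<open>\<nabla>\<^sub>X Y\<close> at \<open>f x\<close> in left trivialisation; its explicit form
does not refer to a chart and depends continuously on the point.\<close>

lemma second_form_on_dense:
  assumes pq: "p \<noteq> q" "a p * b q = b p * a q" and x: "x \<in> W"
    and V: "open V" "x \<in> V" "\<And>y. y \<in> V \<Longrightarrow> X (f y) \<in> tangent_image \<A> f y" "\<And>y. y \<in> V \<Longrightarrow> Y (f y) \<in> tangent_image \<A> f y"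
    and dY: "Y differentiable (at (f x))" and n: "n \<in> tangent_image \<A> f x"
  shows "nkG (dd (\<lambda>z. triv z (Y z)) (X (f x)) (f x) + nkQ (triv (f x) (X (f x))) (triv (f x) (Y (f x))))
     (nkj (triv (f x) n)) = 0"
proof -
  obtain D \<psi> U E u where A: "(D, \<psi>) \<in> \<A>" and u: "u \<in> U" "\<psi> u = x" and fr: "angle_frame D (f \<circ> \<psi>) U E a b"
    by (rule frame_at[OF x])
  have uD: "u \<in> D" by (rule angle_frame.UD[OF fr u(1)])
  define U' where "U' = U \<inter> (D \<inter> \<psi> -` V)"
  have U': "open U'" "U' \<subseteq> U" "u \<in> U'"
    using chart_preimage_open[OF A V(1)] angle_frame.U[OF fr] u V(2) uD by (auto simp: U'_def)
  interpret angle_frame D "f \<circ> \<psi>" U' E a b by (rule angle_frame_subset[OF fr U'(1,2)])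
  have t: "\<exists>\<eta>. Z (f (\<psi> y)) = dd (f \<circ> \<psi>) \<eta> y" if "y \<in> U'" "\<And>y. y \<in> V \<Longrightarrow> Z (f y) \<in> tangent_image \<A> f y" for y Z
  proof -
    have "Z (f (\<psi> y)) \<in> tangent_image \<A> f (\<psi> y)" using that by (auto simp: U'_def)
    then show ?thesis using tangent_image_chart[OF A UD[OF that(1)]] by auto
  qed
  obtain \<xi> where \<xi>: "X (f x) = dd (f \<circ> \<psi>) \<xi> u" using t[OF U'(3), of X] V(3) u by auto
  obtain t0 where t0: "n = dd (f \<circ> \<psi>) t0 u" using n tangent_image_chart[OF A uD] u by auto
  let ?LY = "\<lambda>z. triv z (Y z)"
  have F: "(f \<circ> \<psi>) differentiable (at u)" by (rule smooth_on_differentiable[OF smooth_F uD])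
  have dL: "?LY differentiable (at ((f \<circ> \<psi>) u))" using differentiable_triv[OF dY] u by simp
  have "nkG (dd (\<lambda>y. ?LY ((f \<circ> \<psi>) y)) \<xi> u + nkQ (\<omega> \<xi> u) (?LY ((f \<circ> \<psi>) u))) (nkj (\<omega> t0 u)) = 0"
  proof (rule second_form_vanishes[OF U'(3) pq])
    show "\<exists>\<eta>. ?LY ((f \<circ> \<psi>) y) = \<omega> \<eta> y" if "y \<in> U'" for y
      using t[OF that, of Y] V(4) by (auto simp: \<omega>_def)
    show "(\<lambda>y. ?LY ((f \<circ> \<psi>) y)) differentiable (at u)"
      using differentiable_chain_at[OF F dL] by (simp add: o_def)
  qed
  moreover have "dd (\<lambda>y. ?LY ((f \<circ> \<psi>) y)) \<xi> u = dd ?LY (X (f x)) (f x)"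
    unfolding dd_chain[OF F dL] \<xi> using u by simp
  ultimately show ?thesis using u by (simp add: \<omega>_def \<xi> t0)
qed

text \<open>For the extended fields, \<open>\<nabla>\<^sub>X Y\<close> is orthogonal to \<open>J\<close> of the tangent space on a dense set, hence
everywhere by continuity, hence tangent. Its normal part is then zero.\<close>

lemma two_equal_angles_totally_geodesic:
  assumes pq: "p \<noteq> q" "a p * b q = b p * a q"
  shows "totally_geodesic \<A> f"
  unfolding totally_geodesic_def
proof (intro allI impI)
  fix x X Y
  assume ext: "extends_tangent_field \<A> f x X \<and> extends_tangent_field \<A> f x Y"
  obtain D \<psi> u where A: "(D, \<psi>) \<in> \<A>" and u: "u \<in> D" "\<psi> u = x" by (rule chart_cover)
  interpret lagrangian_patch D "f \<circ> \<psi>" by (rule patch[OF A])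
  have nX: "vector_field_near S3S3 tangent_S3S3 (f x) X" and nY: "vector_field_near S3S3 tangent_S3S3 (f x) Y"
    using ext by (auto simp: extends_tangent_field_def)
  obtain V1 V2 where V1: "open V1" "x \<in> V1" "\<And>y. y \<in> V1 \<Longrightarrow> X (f y) \<in> tangent_image \<A> f y"
    and V2: "open V2" "x \<in> V2" "\<And>y. y \<in> V2 \<Longrightarrow> Y (f y) \<in> tangent_image \<A> f y"
    using ext unfolding extends_tangent_field_def by blast
  obtain U1 U2 where U1: "open U1" "f x \<in> U1" "smooth_on U1 X" and U2: "open U2" "f x \<in> U2" "smooth_on U2 Y"
    using nX nY unfolding vector_field_near_def by blast
  define V where "V = V1 \<inter> V2"
  define B where "B = U1 \<inter> U2"
  have V: "open V" "x \<in> V" using V1 V2 by (auto simp: V_def)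
  have B: "open B" "f x \<in> B" "smooth_on B X" "smooth_on B Y"
    using U1 U2 by (auto simp: B_def intro: smooth_on_subset)
  have cF: "continuous_on D (f \<circ> \<psi>)" by (rule smooth_on_continuous[OF smooth_F])
  define N where "N = (D \<inter> \<psi> -` V) \<inter> (D \<inter> (f \<circ> \<psi>) -` B)"
  have N: "open N" "N \<subseteq> D" "u \<in> N"
    using chart_preimage_open[OF A V(1)] continuous_open_preimage[OF cF D B(1)] u V(2) B(2)
    by (auto simp: N_def)
  let ?L = "\<lambda>z. triv z (Y z)"
  define K where "K z = dd ?L (X z) z + nkQ (triv z (X z)) (triv z (Y z))" for z
  have sid: "smooth_on B (\<lambda>z. z)" by (rule smooth_on_linear) (rule linear_ident)
  have sL: "smooth_on B (\<lambda>z. triv z (Z z))" if "smooth_on B Z" for Z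
    by (rule smooth_on_bilinear[OF bounded_bilinear_triv sid that B(1)])
  have "smooth_on B K"
    unfolding K_def[abs_def]
    by (intro smooth_on_add smooth_on_tensor[OF smooth_tensor_dd[OF sL[OF B(4)] B(1)] B(3)]
        smooth_on_bilinear[OF bounded_bilinear_nkQ] sL B)
  then have "continuous_on B K" by (rule smooth_on_continuous)
  then have cK: "continuous_on N (\<lambda>y. K ((f \<circ> \<psi>) y))"
    by (rule continuous_on_compose2[OF _ continuous_on_subset[OF cF N(2)]]) (auto simp: N_def)
  have perp: "nkG (K (f x)) (nkj (\<omega> t u)) = 0" for t
  proof -
    have st: "smooth_on D (\<omega> t)" using smooth_\<omega> by (simp add: smooth_tensor_def)
    have cj: "continuous_on N (\<lambda>y. nkj (\<omega> t y))"
      by (rule continuous_on_subset[OF smooth_on_continuous[OF smooth_on_linear_comp[OF bounded_linear_nkj st D]] N(2)])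
    \<comment> \<open>the orthogonality is a closed condition, and it holds on a dense set\<close>
    have "nkG (K ((f \<circ> \<psi>) u)) (nkj (\<omega> t u)) \<in> {0}"
    proof (rule chart_dense_closed[OF A N(1,2) _ _ _ N(3), of "\<lambda>y. nkG (K ((f \<circ> \<psi>) y)) (nkj (\<omega> t y))"])
      show "continuous_on N (\<lambda>y. nkG (K ((f \<circ> \<psi>) y)) (nkj (\<omega> t y)))"
        by (rule bounded_bilinear.continuous_on[OF bounded_bilinear_nkG cK cj])
      show "closed {0::real}" by simp
      fix y assume y: "y \<in> N" "\<psi> y \<in> W"
      then have yD: "y \<in> D" and yV: "\<psi> y \<in> V" and yB: "f (\<psi> y) \<in> B" by (auto simp: N_def)
      have "nkG (K (f (\<psi> y))) (nkj (triv (f (\<psi> y)) (dd (f \<circ> \<psi>) t y))) = 0"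
        unfolding K_def
      proof (rule second_form_on_dense[OF pq y(2) V(1) yV])
        show "X (f y) \<in> tangent_image \<A> f y" "Y (f y) \<in> tangent_image \<A> f y" if "y \<in> V" for y
          using that V1(3) V2(3) by (auto simp: V_def)
        show "Y differentiable (at (f (\<psi> y)))" by (rule smooth_on_differentiable[OF B(4) yB])
        show "dd (f \<circ> \<psi>) t y \<in> tangent_image \<A> f (\<psi> y)" unfolding tangent_image_chart[OF A yD] by blast
      qed
      then show "nkG (K ((f \<circ> \<psi>) y)) (nkj (\<omega> t y)) \<in> {0}" by (simp add: \<omega>_def)
    qed
    then show ?thesis using u by simp
  qed
  define w where "w = levi_civita S3S3 tangent_S3S3 nk_metric X Y (f x)"
  have w: "w \<in> tangent_S3S3 (f x)" "triv (f x) w = K (f x)"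
    unfolding w_def K_def by (rule levi_civita_S3S3[OF f_S3S3 near_tangentI[OF nX] near_tangentI[OF nY]])+
  have "K (f x) \<in> range (\<lambda>w. \<omega> w u)" using tangent_iff_normal[OF u(1)] perp by blast
  then obtain t where t: "K (f x) = \<omega> t u" by blast
  have "w = untriv (f x) (triv (f x) w)" by (rule untriv_triv[OF f_S3S3 w(1), symmetric])
  also have "\<dots> = dd (f \<circ> \<psi>) t u" unfolding w(2) t dF_eq[OF u(1)] using u by simp
  finally have wt: "w = dd (f \<circ> \<psi>) t u" .
  have ti: "tangent_image \<A> f x = range (\<lambda>w. dd (f \<circ> \<psi>) w u)" using tangent_image_chart[OF A u(1)] u(2) by simp
  have lin: "linear (\<lambda>w. dd (f \<circ> \<psi>) w u)" by (rule dd_linear[OF smooth_on_differentiable[OF smooth_F u(1)]])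
  show "second_fundamental_form \<A> f x X Y = 0"
    unfolding second_fundamental_form_def normal_part_def w_def[symmetric]
  proof (rule the_equality)
    have "0 \<in> tangent_S3S3 (f x)"
      unfolding tangent_iff
      by (rule range_eqI[of _ _ 0]) (simp add: bounded_bilinear.zero_right[OF bounded_bilinear_untriv])
    moreover have "nk_metric (f x) 0 n = 0" if "n \<in> tangent_image \<A> f x" for n
    proof -
      have "nk_metric (f x) (0 *\<^sub>R n') n = 0" for n'
        by (simp add: nk_metric_def nk_J_def case_prod_unfold bounded_bilinear.zero_right[OF bounded_bilinear_qmul])
      then show ?thesis by simp
    qed
    ultimately show "0 \<in> normal_space \<A> f x \<and> w - 0 \<in> tangent_image \<A> f x"
      using wt by (auto simp: normal_space_def ti)
    fix n assume n: "n \<in> normal_space \<A> f x \<and> w - n \<in> tangent_image \<A> f x"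
    then obtain s where "w - n = dd (f \<circ> \<psi>) s u" by (auto simp: ti)
    then have nt: "n = dd (f \<circ> \<psi>) (t - s) u" using wt linear_diff[OF lin, of t s] by (simp add: algebra_simps)
    then have "nk_metric (f x) n n = 0" using n by (auto simp: normal_space_def ti)
    then have "induced_metric (f \<circ> \<psi>) u (t - s) (t - s) = 0" using nt u(2) by (simp add: induced_metric_def differential_def)
    then have "t - s = 0" using smooth_metric_induced u(1) unfolding smooth_metric_def by (metis less_irrefl)
    then show "n = 0" using nt linear_0[OF lin] by simp
  qed
qed

subsection \<open>Pairwise independent weight points\<close>

context
  assumes d: "\<And>i j. i \<noteq> j \<Longrightarrow> a i * b j \<noteq> b i * a j"
begin

text \<open>The same number serves for all charts, because the coframe can be pulled back to each of them.\<close>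

lemma curvature_on_dense:
  assumes x: "x \<in> W"
  shows "\<exists>k\<in>{0, 3/16}. \<forall>D \<psi> z u v. (D, \<psi>) \<in> \<A> \<longrightarrow> z \<in> D \<longrightarrow> \<psi> z = x \<longrightarrow> u \<noteq> v \<longrightarrow> independent {u, v} \<longrightarrow>
     sec D \<psi> z u v = k"
proof -
  obtain D' \<psi>' U E y where A': "(D', \<psi>') \<in> \<A>" and y: "y \<in> U" "\<psi>' y = x" and fr: "angle_frame D' (f \<circ> \<psi>') U E a b"
    by (rule frame_at[OF x])
  interpret angle_frame D' "f \<circ> \<psi>'" U E a b by (rule fr)
  obtain V k where V: "open V" "y \<in> V" "V \<subseteq> U" and k: "k\<^sup>2 = 0 \<or> k\<^sup>2 = 3/4"
    and de: "\<And>y x w. y \<in> V \<Longrightarrow> dd (e w) x y - dd (e x) w y = - k *\<^sub>R (e x y \<times> e w y)"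
    using coframe_constant[OF y(1) d] by blast
  have eV: "smooth_tensor V e"
    using smooth_tensor_e V unfolding smooth_tensor_def by (auto intro: smooth_on_subset)
  have "sec D \<psi> z u v = k\<^sup>2 / 4"
    if "(D, \<psi>) \<in> \<A>" "z \<in> D" "\<psi> z = x" "u \<noteq> v" "independent {u, v}" for D \<psi> z u v
    by (rule sectional_curvature_chart_coframe[OF that(1) A' _ V(2) eV _ de that(2) _ that(4,5)])
      (use V U y that induced_metric_e in auto)
  moreover have "k\<^sup>2 / 4 \<in> {0, 3/16}" using k by auto
  ultimately show ?thesis by blast
qed

lemma continuous_curvature:
  assumes A: "(D, \<psi>) \<in> \<A>" and uv: "u \<noteq> v" "independent {u, v}"
  shows "continuous_on D (\<lambda>z. sec D \<psi> z u v)"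
  by (rule continuous_on_sectional_curvature[OF lagrangian_patch.smooth_metric_induced[OF patch[OF A]] uv])

lemma curvature_values:
  assumes A: "(D, \<psi>) \<in> \<A>" and z: "z \<in> D" and uv: "u \<noteq> v" "independent {u, v}"
  shows "sec D \<psi> z u v \<in> {0, 3/16}"
proof (rule chart_dense_closed[OF A chart(1)[OF A] subset_refl continuous_curvature[OF A uv] _ _ z])
  show "closed {0, 3/16 :: real}" by (simp add: finite_imp_closed)
  show "sec D \<psi> y u v \<in> {0, 3/16}" if "y \<in> D" "\<psi> y \<in> W" for y
    using curvature_on_dense[OF that(2)] A that(1) uv by metis
qed

lemma curvature_chart_independent:
  assumes A: "(D, \<psi>) \<in> \<A>" "(D', \<psi>') \<in> \<A>" and z: "z \<in> D" "z' \<in> D'" "\<psi>' z' = \<psi> z"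
    and uv: "u \<noteq> v" "independent {u, v}" and uv': "u' \<noteq> v'" "independent {u', v'}"
  shows "sec D \<psi> z u v = sec D' \<psi>' z' u' v'"
proof -
  let ?\<tau> = "inv_into D' \<psi>' \<circ> \<psi>" and ?S = "D \<inter> \<psi> -` (\<psi>' ` D')"
  note t = transition[OF A]
  let ?K = "\<lambda>y. sec D \<psi> y u v"
  let ?K' = "\<lambda>y. sec D' \<psi>' y u' v'"
  have zS: "z \<in> ?S" "?\<tau> z = z'" using t(5)[OF z] by auto
  have "?K z - ?K' (?\<tau> z) \<in> {0}"
  proof (rule chart_dense_closed[OF A(1) t(1) _ _ _ _ zS(1)])
    show "?S \<subseteq> D" by blast
    show "continuous_on ?S (\<lambda>y. ?K y - ?K' (?\<tau> y))"
    proof (intro continuous_on_diff)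
      show "continuous_on ?S ?K" by (rule continuous_on_subset[OF continuous_curvature[OF A(1) uv]]) blast
      show "continuous_on ?S (\<lambda>y. ?K' (?\<tau> y))"
        by (rule continuous_on_compose2[OF continuous_curvature[OF A(2) uv'] smooth_on_continuous[OF t(2)]])
          (use t(3) in blast)
    qed
    show "closed {0::real}" by simp
    fix y assume y: "y \<in> ?S" "\<psi> y \<in> W"
    obtain k where k: "\<And>D \<psi>' z u v. (D, \<psi>') \<in> \<A> \<Longrightarrow> z \<in> D \<Longrightarrow> \<psi>' z = \<psi> y \<Longrightarrow> u \<noteq> v \<Longrightarrow> independent {u, v} \<Longrightarrow>
     sec D \<psi>' z u v = k"
      using curvature_on_dense[OF y(2)] by blast
    have "?K y = k" by (rule k[OF A(1) _ refl uv]) (use y in blast)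
    moreover have "?K' (?\<tau> y) = k" by (rule k[OF A(2) t(3)[OF y(1)] t(4)[OF y(1)] uv'])
    ultimately show "?K y - ?K' (?\<tau> y) \<in> {0}" by simp
  qed
  then show ?thesis using zS(2) by simp
qed

lemma distinct_angles_constant_curvature:
  assumes conn: "connected (UNIV :: 'm set)"
  shows "constant_sectional_curvature \<A> f"
proof -
  let ?u = "axis 1 1 :: real^3" and ?v = "axis 2 1 :: real^3"
  have uv: "?u \<noteq> ?v" "independent {?u, ?v}"
  proof -
    show "?u \<noteq> ?v" by (simp add: axis_eq_axis)
    have "{?u, ?v} \<subseteq> Basis" by (auto simp: Basis_vec_def)
    then show "independent {?u, ?v}" by (rule independent_mono[OF independent_Basis])
  qed
  have "\<exists>k. \<forall>D \<psi> z. (D, \<psi>) \<in> \<A> \<longrightarrow> z \<in> D \<longrightarrow> \<psi> z = x \<longrightarrow> sec D \<psi> z ?u ?v = k" for x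
  proof -
    obtain D \<psi> z where A: "(D, \<psi>) \<in> \<A>" "z \<in> D" "\<psi> z = x" by (rule chart_cover)
    show ?thesis
      by (rule exI[of _ "sec D \<psi> z ?u ?v"])
        (use curvature_chart_independent[OF _ A(1) _ A(2) _ uv uv] A(3) in blast)
  qed
  then obtain \<kappa> where \<kappa>: "\<And>x D \<psi> z. (D, \<psi>) \<in> \<A> \<Longrightarrow> z \<in> D \<Longrightarrow> \<psi> z = x \<Longrightarrow>
      sec D \<psi> z ?u ?v = \<kappa> x" by metis
  have "continuous_on (\<psi> ` D) \<kappa>" if A: "(D, \<psi>) \<in> \<A>" for D \<psi>
  proof -
    obtain \<phi> where \<phi>: "homeomorphism D (\<psi> ` D) \<psi> \<phi>" using chart(3)[OF A] by blast
    have "continuous_on (\<psi> ` D) (\<lambda>x. sec D \<psi> (\<phi> x) ?u ?v)"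
      by (rule continuous_on_compose2[OF continuous_curvature[OF A uv] homeomorphism_cont2[OF \<phi>]])
        (simp add: homeomorphism_image2[OF \<phi>])
    then show ?thesis
      by (rule continuous_on_eq) (auto simp: homeomorphism_apply1[OF \<phi>] intro: \<kappa>[OF A])
  qed
  then have "continuous_on (\<Union>(D, \<psi>)\<in>\<A>. \<psi> ` D) \<kappa>"
    using chart(2) by (intro continuous_on_open_UN) auto
  moreover have "(\<Union>(D, \<psi>)\<in>\<A>. \<psi> ` D) = UNIV" using atlas by (simp add: smooth_atlas_def)
  ultimately have cont: "continuous_on UNIV \<kappa>" by simp
  have "\<kappa> x \<in> {0, 3/16}" for x
  proof -
    obtain D \<psi> z where A: "(D, \<psi>) \<in> \<A>" "z \<in> D" "\<psi> z = x" by (rule chart_cover)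
    show ?thesis using curvature_values[OF A(1,2) uv] \<kappa>[OF A] by simp
  qed
  then have "range \<kappa> \<subseteq> {0, 3/16}" by (rule image_subsetI)
  then have "finite (range \<kappa>)" by (rule finite_subset) simp
  with conn cont have "\<kappa> constant_on UNIV" by (rule continuous_finite_range_constant)
  then obtain k where k: "\<And>x. \<kappa> x = k" unfolding constant_on_def by blast
  have K: "sec D \<psi> z u v = k"
    if "(D, \<psi>) \<in> \<A>" "z \<in> D" "u \<noteq> v" "independent {u, v}" for D \<psi> z u v
    using curvature_chart_independent[OF that(1) that(1) that(2) that(2) refl that(3,4) uv] \<kappa>[OF that(1,2) refl] k by simp
  show ?thesis
    unfolding constant_sectional_curvature_def
  proof (intro exI[of _ k] ballI)
    fix c assume "c \<in> \<A>"
    then show "case c of (D, \<psi>) \<Rightarrow> \<forall>z\<in>D. \<forall>u v. u \<noteq> v \<and> independent {u, v} \<longrightarrow>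
        sec D \<psi> z u v = k"
      by (cases c) (simp add: K)
  qed
qed

end

end

theorem theorem1:
  fixes \<A> :: "(real^3, 'm::{t2_space, second_countable_topology}) atlas"
    and f :: "'m \<Rightarrow> quat \<times> quat"
  assumes "smooth_atlas \<A>"
    and "connected (UNIV :: 'm set)"
    and "immersion \<A> f"
    and "lagrangian \<A> f"
    and "constant_angle_functions \<A> f"
  shows "totally_geodesic \<A> f \<or> constant_sectional_curvature \<A> f"
proof -
  obtain c :: "3 \<Rightarrow> real" and W where W: "open W" "closure W = UNIV"
    and ang: "\<forall>x\<in>W. \<exists>(D, \<psi>)\<in>\<A>. \<exists>U E. open U \<and> U \<subseteq> D \<and> x \<in> \<psi> ` U \<and>
           angle_functions (f \<circ> \<psi>) U E (\<lambda>i u. c i)"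
    using assms(5) unfolding constant_angle_functions_def by blast
  interpret constant_angles \<A> f c W
    by unfold_locales (use assms W ang in blast)+
  show ?thesis
  proof (cases "\<exists>p q. p \<noteq> q \<and> a p * b q = b p * a q")
    case True
    then show ?thesis using two_equal_angles_totally_geodesic by blast
  next
    case False
    then show ?thesis using distinct_angles_constant_curvature[OF _ assms(2)] by blast
  qed
qed

end
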